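(* Let $l\ge 1$ be an integer, let $\Omega\subseteq\mathbb{R}^4$ be a bounded domain, and let $\lambda_1\le\lambda_2\le\cdots$ be the eigenvalues of the Dirichlet problem for the poly-Laplacian $(-\Delta)^l$ on $\Omega$. (1) If $l=1$, then for every integer $k\ge 1$ $$\begin{aligned}\sum_{i=1}^k\lambda_i\geq{}& \frac{2}{3\omega_4^{\frac{1}{2}}}\left( \frac{(2\pi)^4}{V } \right)^{\frac{1}{2}}k^{\frac{3}{2}}+\frac{1}{12}\frac{V }{I }k-\frac{7\omega^{\frac{1}{2}}_4}{960(2\pi)^2}\frac{V^{\frac52} }{I^2 }k^{\frac{1}{2}}+\frac{47\omega_4}{114688(2\pi)^4}\frac{V^4 }{I^3 }\\ &+\frac{\omega_4^{\frac{5}{4}}}{150\rho^7}\left( \frac{V }{(2\pi)^4} \right)^{\frac{33}{4}}k^{-\frac{1}{4}}-\frac{449}{122880}\frac{\omega^{\frac{3}{2}}_4}{\rho^8}\left( \frac{V }{(2\pi)^4} \right)^{\frac{19}{2}}k^{-\frac{1}{2}}.\end{aligned}$$ (2) If $l=2$, then for every integer $k\ge 1$ $$\begin{aligned}\sum_{i=1}^k\lambda_i\geq{}& \frac{1}{2\omega_4}\frac{(2\pi)^4}{V }k^2+\frac{\pi^2}{12\omega^{\frac{1}{2}}_4}\frac{V^{\frac{1}{2}} }{I }k^{\frac{3}{2}}-\frac{1}{80}\frac{V^2 }{I^2 }k+\frac{61\omega^{\frac{1}{2}}_4}{1280\rho^6}\left( \frac{V }{(2\pi)^4}\right)^{\frac{13}{2}}k^{\frac{1}{2}}\\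 &+\frac{\omega_4^{\frac{3}{4}}}{150\rho^7}\left( \frac{V }{(2\pi)^4}\right)^{\frac{31}{4}}k^{\frac{1}{4}}-\frac{17423\,\omega_4}{1843200\rho^8}\left( \frac{V }{(2\pi)^4}\right)^{9}+\frac{7\omega^{\frac{5}{4}}_4}{1200\rho^9}\left( \frac{V }{(2\pi)^4}\right)^{\frac{41}{4}}k^{-\frac{1}{4}}.\end{aligned}$$ (3) If $l\geq 3$ and $k\ge1$ is an integer with $k\geq \max\{k_1,k_2\}$, where $$k_1=\frac{1}{455} \max_{1\leq i\leq 2l+3} \left\{ \left(\frac{C^{i+1}_{2l+4}}{27C^{i}_{2l+4}} +\frac{1}{2}\right)^4,\left(\frac{C^{i+1}_{2l+3}}{27C^{i}_{2l+3}} +\frac{1}{2}\right)^4 ,\left(\frac{C^{i+1}_{2l+2}}{27C^{i}_{2l+2}} +\frac{1}{2}\right)^4 \right\},$$ $$k_2=\frac{1}{455} \max_{1\leq i\leq 2l+3}\left\{ \left( \frac{C^{i+1}_{2l+4}}{2C^{i}_{2l+4}} \right)^{4} , \left( \frac{C^{i+1}_{2l+3}}{2C^{i}_{2l+3}}\right)^{4}, \left( \frac{C^{i+1}_{2l+2}}{2C^{i}_{2l+2}} \right)^4\right\},$$ then $$\begin{aligned}\sum_{i=1}^k\lambda_i\geq{}& \frac{2}{(l+2)\omega_4^{\frac{l}{2}}}\alpha^{-\frac{l}{2}}k^{\frac{l+2}{2}}+\frac{(2\pi)^8l}{12\omega_4^{\frac{l-1}{2}}V I }\alpha^{\frac{5-l}{2}}k^{\frac{l+1}{2}}-\frac{128(4l+7)(2l+1)\pi^{12}}{3\omega_4^{\frac{2l-3}{4}}(VI)^{\frac{3}{2}}}\alpha^{\frac{15-2l}{4}}k^{\frac{2l+1}{4}}\\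 &+\frac{(2l+3)(2l-1)(l+1)}{12\omega_4^{\frac{l-2}{2}}\rho^4}\alpha^{\frac{10-l}{2}}k^{\frac{l}{2}}-\frac{(2l+3)(2l+1)(l+1)l}{18\omega_4^{\frac{2l-5}{4}}\rho^5}\alpha^{\frac{25-2l}{4}}k^{\frac{2l-1}{4}}.\end{aligned}$$
   Context: Eigenvalue problem: $(-\Delta)^l u=\lambda u$ in $\Omega$, $u=\frac{\partial u}{\partial\nu}=\cdots=\frac{\partial^{l-1}u}{\partial\nu^{l-1}}=0$ on $\partial\Omega$ (Dirichlet conditions, understood in the usual weak sense $u\in H^l_0(\Omega)$). The spectrum is real and discrete, $0<\lambda_1\le\lambda_2\le\cdots\to\infty$, each eigenvalue repeated according to its finite multiplicity. Notation: $V=V(\Omega)$ is the volume of $\Omega$; $\omega_4=\frac{\pi^2}{2}$ is the volume of the unit ball of $\mathbb{R}^4$; $I=I(\Omega)=\int_\Omega|x|^2dx$; $\alpha=(2\pi)^{-4}V$; $\rho=2(2\pi)^{-4}\sqrt{VI}$; $C^m_a=\frac{a!}{m!(a-m)!}$ is the binomial coefficient, with $C^m_a=0$ for $m>a$. In the maxima defining $k_1,k_2$, terms with a zero denominator ($C^i_a$ with $i>a$) are omitted. *)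

theory Defs
  imports "HOL-Analysis.Analysis"
begin

section \<open>Test functions and classical derivatives\<close>

definition pdiff :: "'n::finite \<Rightarrow> (real^'n \<Rightarrow> real) \<Rightarrow> real^'n \<Rightarrow> real" where
  "pdiff i f x = frechet_derivative f (at x) (axis i 1)"

text \<open>Mixed derivatives are indexed by words of coordinate directions instead of multi-indices;
  the order of the derivative is the length of the word.\<close>

definition pdiffs :: "'n::finite list \<Rightarrow> (real^'n \<Rightarrow> real) \<Rightarrow> real^'n \<Rightarrow> real" where
  "pdiffs is f = foldr pdiff is f"

text \<open>If all iterated partial derivatives are differentiable everywhere, then all of them are
  continuous, so this is the class \<open>C\<close>-infinity.\<close>

definition smooth :: "(real^'n::finite \<Rightarrow> real) \<Rightarrow> bool" where
  "smooth f \<longleftrightarrow> (\<forall>is x. pdiffs is f differentiable (at x))"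

definition test_functions :: "(real^'n::finite) set \<Rightarrow> (real^'n \<Rightarrow> real) set" where
  "test_functions \<Omega> = {\<phi>. smooth \<phi> \<and> (\<exists>K. compact K \<and> K \<subseteq> \<Omega> \<and> (\<forall>x. x \<notin> K \<longrightarrow> \<phi> x = 0))}"

definition laplacian :: "(real^'n::finite \<Rightarrow> real) \<Rightarrow> real^'n \<Rightarrow> real" where
  "laplacian f x = (\<Sum>i\<in>UNIV. pdiff i (pdiff i f) x)"

definition poly_laplacian :: "nat \<Rightarrow> (real^'n::finite \<Rightarrow> real) \<Rightarrow> real^'n \<Rightarrow> real" where
  "poly_laplacian l = (\<lambda>f x. - laplacian f x) ^^ l"

section \<open>The Sobolev space with zero boundary values\<close>

text \<open>Elements of \<open>L\<close>-2 are represented by functions on the whole space; only their values on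
  \<open>\<Omega>\<close> matter, and only up to null sets.\<close>

definition square_integrable :: "(real^'n::finite) set \<Rightarrow> (real^'n \<Rightarrow> real) set" where
  "square_integrable \<Omega> = {u. u \<in> borel_measurable (lebesgue_on \<Omega>) \<and>
     integrable (lebesgue_on \<Omega>) (\<lambda>x. (u x)\<^sup>2)}"

definition weak_deriv ::
    "(real^'n::finite) set \<Rightarrow> 'n list \<Rightarrow> (real^'n \<Rightarrow> real) \<Rightarrow> (real^'n \<Rightarrow> real) \<Rightarrow> bool" where
  "weak_deriv \<Omega> is u v \<longleftrightarrow> u \<in> square_integrable \<Omega> \<and> v \<in> square_integrable \<Omega> \<and>
     (\<forall>\<phi>\<in>test_functions \<Omega>.
        integral\<^sup>L (lebesgue_on \<Omega>) (\<lambda>x. u x * pdiffs is \<phi> x) =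
        (-1) ^ length is * integral\<^sup>L (lebesgue_on \<Omega>) (\<lambda>x. v x * \<phi> x))"

text \<open>The closure of the test functions in the Sobolev space of order \<open>l\<close>: \<open>v is\<close> is the weak
  derivative of \<open>u\<close> along \<open>is\<close>, and the test functions \<open>\<phi> n\<close> converge to \<open>u\<close> in the Sobolev norm.\<close>

definition sobolev_H0 :: "nat \<Rightarrow> (real^'n::finite) set \<Rightarrow> (real^'n \<Rightarrow> real) set" where
  "sobolev_H0 l \<Omega> = {u. \<exists>v. (\<forall>is. length is \<le> l \<longrightarrow> weak_deriv \<Omega> is u (v is)) \<and>
     (\<exists>\<phi>::nat \<Rightarrow> real^'n \<Rightarrow> real. (\<forall>n. \<phi> n \<in> test_functions \<Omega>) \<and>
        (\<forall>is. length is \<le> l \<longrightarrow>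
           (\<lambda>n. integral\<^sup>L (lebesgue_on \<Omega>) (\<lambda>x. (pdiffs is (\<phi> n) x - v is x)\<^sup>2)) \<longlonglongrightarrow> 0))}"

section \<open>Dirichlet eigenvalues of the poly-Laplacian\<close>

text \<open>The equation holds in the sense of distributions, the boundary conditions are encoded in the
  Sobolev space.  The zero function is included.\<close>

definition eigenspace :: "nat \<Rightarrow> (real^'n::finite) set \<Rightarrow> real \<Rightarrow> (real^'n \<Rightarrow> real) set" where
  "eigenspace l \<Omega> \<mu> = {u \<in> sobolev_H0 l \<Omega>. \<forall>\<phi>\<in>test_functions \<Omega>.
     integral\<^sup>L (lebesgue_on \<Omega>) (\<lambda>x. u x * poly_laplacian l \<phi> x) =
     \<mu> * integral\<^sup>L (lebesgue_on \<Omega>) (\<lambda>x. u x * \<phi> x)}"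

text \<open>The dimension of a space of functions modulo almost everywhere equality on \<open>\<Omega>\<close> is \<open>m\<close>.\<close>

definition has_ae_dim :: "(real^'n::finite) set \<Rightarrow> (real^'n \<Rightarrow> real) set \<Rightarrow> nat \<Rightarrow> bool" where
  "has_ae_dim \<Omega> E m \<longleftrightarrow> (\<exists>e::nat \<Rightarrow> real^'n \<Rightarrow> real. (\<forall>j<m. e j \<in> E) \<and>
     (\<forall>c::nat \<Rightarrow> real. (AE x in lebesgue_on \<Omega>. (\<Sum>j<m. c j * e j x) = 0) \<longrightarrow> (\<forall>j<m. c j = 0)) \<and>
     (\<forall>u\<in>E. \<exists>c::nat \<Rightarrow> real. AE x in lebesgue_on \<Omega>. u x = (\<Sum>j<m. c j * e j x)))"

text \<open>\<open>ev 1 \<le> ev 2 \<le> \<dots>\<close> lists all eigenvalues, each one repeated according to its finite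
  multiplicity; a number \<open>\<mu>\<close> that is not an eigenvalue has multiplicity 0 and does not occur.  The
  value \<open>ev 0\<close> is irrelevant.\<close>

definition dirichlet_eigenvalues :: "nat \<Rightarrow> (real^'n::finite) set \<Rightarrow> (nat \<Rightarrow> real) \<Rightarrow> bool" where
  "dirichlet_eigenvalues l \<Omega> ev \<longleftrightarrow> mono_on {1..} ev \<and>
     (\<forall>\<mu>. finite {i\<in>{1..}. ev i = \<mu>} \<and>
          has_ae_dim \<Omega> (eigenspace l \<Omega> \<mu>) (card {i\<in>{1..}. ev i = \<mu>}))"

section \<open>Constants\<close>

definition vol :: "(real^4) set \<Rightarrow> real" where
  "vol \<Omega> = measure lebesgue \<Omega>"

definition inertia :: "(real^4) set \<Rightarrow> real" where
  "inertia \<Omega> = integral\<^sup>L (lebesgue_on \<Omega>) (\<lambda>x. (norm x)\<^sup>2)"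

definition omega4 :: real where
  "omega4 = unit_ball_vol 4"

lemma omega4_eq: "omega4 = pi\<^sup>2 / 2"
  using unit_ball_vol_even[of 2] by (simp add: omega4_def fact_numeral)

definition alpha :: "(real^4) set \<Rightarrow> real" where
  "alpha \<Omega> = vol \<Omega> / (2 * pi) ^ 4"

definition rho :: "(real^4) set \<Rightarrow> real" where
  "rho \<Omega> = 2 / (2 * pi) ^ 4 * sqrt (vol \<Omega> * inertia \<Omega>)"

text \<open>The condition \<open>a choose i \<noteq> 0\<close> omits the terms with a zero denominator.\<close>

definition k1 :: "nat \<Rightarrow> real" where
  "k1 l = 1 / 455 * Max {(real (a choose (i + 1)) / (27 * real (a choose i)) + 1 / 2) ^ 4 | a i.
     a \<in> {2 * l + 4, 2 * l + 3, 2 * l + 2} \<and> i \<in> {1..2 * l + 3} \<and> a choose i \<noteq> 0}"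

definition k2 :: "nat \<Rightarrow> real" where
  "k2 l = 1 / 455 * Max {(real (a choose (i + 1)) / (2 * real (a choose i))) ^ 4 | a i.
     a \<in> {2 * l + 4, 2 * l + 3, 2 * l + 2} \<and> i \<in> {1..2 * l + 3} \<and> a choose i \<noteq> 0}"

end

theory Submission
  imports Defs "HOL-Probability.Characteristic_Functions"
begin

text \<open>Let \<open>u\<^sub>1, \<dots>, u\<^sub>k\<close> be orthonormal eigenfunctions, extended by zero, and let \<open>f\<close> be the sum of the
  squared moduli of their unitary Fourier transforms.  Bessel's inequality for the functions \<open>exp (-i \<xi> \<bullet> x)\<close> on
  \<open>\<Omega>\<close> gives \<open>0 \<le> f \<le> \<alpha>\<close> and the Lipschitz constant \<open>\<rho>\<close> of \<open>f\<close>; by Plancherel's theorem \<open>f\<close> has mass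
  \<open>k\<close>, and its moment of order \<open>2l\<close> is at most the sum of the eigenvalues.  Among all such \<open>f\<close> this
  moment is smallest for the radial profile that equals \<open>\<alpha>\<close> up to a radius \<open>t\<close> and then decreases
  with slope \<open>\<rho>\<close> to zero.  Up to constants, its moments are those of the uniform distribution on \<open>[t, t + \<alpha> / \<rho>]\<close>; in
  dimension four, the condition that fixes \<open>t\<close> is quadratic in the square of the midpoint of this
  interval, so \<open>t\<close> is explicit and what remains are polynomial inequalities in one small parameter.\<close>

section \<open>Homogeneous densities in polar coordinates\<close>

text \<open>A sharp cutoff of height \<alpha> on the ball of radius \<kappa> = (k / (omega4 *
  \<alpha>)) powr (1/4), the radius in Weyl's law, has mass k and its moment is exactly the leading
  term. The Lipschitz bound forces a transition layer of width \<alpha> / \<rho>; in units of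
  \<kappa> this width is the small parameter y, and every other term of the theorem is a power of y
  times a multiple of the leading term. Comparing \<Omega> with the ball of equal volume gives y ^ 4
  * k \<le> 9/4096, so y \<le> 22/100 for every k \<ge> 1. For l \<ge> 3 the coefficients grow with
  l, and k \<ge> k2 enters as y * (2 * l + 3) \<le> 4. The obstacle in the bathtub step is that f is
  not radial. It is not rearranged but compared with the profile along each ray, by means of a
  function that is constant on rays and agrees with f on one sphere; hence the polar coordinates for
  homogeneous densities. The other obstacle is that eigenfunctions are mere limits of test
  functions: Fatou's lemma carries the identities over as upper bounds, which is enough for the
  energy, while the mass also needs a lower bound.\<close>

lemma nn_integral_homogeneous_cball:
  fixes A :: "'a::euclidean_space \<Rightarrow> real"
  assumes [measurable]: "A \<in> borel_measurable borel"
    and hom: "\<And>c x. c > 0 \<Longrightarrow> A (c *\<^sub>R x) = A x" and r: "r > 0"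
  shows "(\<integral>\<^sup>+x. ennreal (A x) * indicator (cball 0 r) x \<partial>lborel) =
    ennreal (r ^ DIM('a)) * (\<integral>\<^sup>+x. ennreal (A x) * indicator (cball 0 1) x \<partial>lborel)"
proof -
  have "(\<integral>\<^sup>+x. ennreal (A x) * indicator (cball 0 r) x \<partial>lborel) =
    (\<integral>\<^sup>+x. ennreal (A x) * indicator (cball 0 r) x
       \<partial>(density (distr lborel borel (\<lambda>x::'a. 0 + r *\<^sub>R x)) (\<lambda>_. \<bar>r\<bar>^DIM('a))))"
    using lborel_affine[of r "0::'a"] r by simp
  also have "\<dots> = (\<integral>\<^sup>+x. ennreal (r ^ DIM('a)) * (ennreal (A x) * indicator (cball 0 1) x) \<partial>lborel)"
    using r
  proof -
    have "(\<lambda>x. ennreal (A x) * indicator (cball 0 r) x) \<in> borel_measurable borel"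
      by (intro borel_measurable_times_ennreal borel_measurable_indicator) auto
    moreover have "indicator (cball 0 r) (r *\<^sub>R x) = (indicator (cball 0 1) x :: ennreal)" for x :: 'a
      using r by (simp add: indicator_def)
    ultimately show ?thesis using r by (simp add: nn_integral_density nn_integral_distr hom)
  qed
  also have "\<dots> = ennreal (r ^ DIM('a)) * (\<integral>\<^sup>+x. ennreal (A x) * indicator (cball 0 1) x \<partial>lborel)"
    by (intro nn_integral_cmult borel_measurable_times_ennreal borel_measurable_indicator) auto
  finally show ?thesis .
qed

text \<open>By homogeneity the ball of radius \<open>r\<close> carries mass
  \<open>M * r ^ DIM('a)\<close>. The half-lines generate the Borel sets, so this distribution
  function determines the image measure.\<close>

lemma distr_norm_homogeneous:
  fixes A :: "'a::euclidean_space \<Rightarrow> real" and M :: real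
  assumes [measurable]: "A \<in> borel_measurable borel"
    and hom: "\<And>c x. c > 0 \<Longrightarrow> A (c *\<^sub>R x) = A x"
    and M: "(\<integral>\<^sup>+x. ennreal (A x) * indicator (cball 0 1) x \<partial>lborel) = ennreal M" and M0: "M \<ge> 0"
  shows "distr (density lborel A) borel norm =
    density lborel (\<lambda>r. ennreal (DIM('a) * M * r ^ (DIM('a) - 1) * indicator {0..} r))"
    (is "?L = ?R")
proof (rule measure_eqI_generator_eq[where E = "range atMost" and \<Omega> = UNIV and A = "\<lambda>i::nat. {..real i}"])
  have eq: "emeasure ?L {..r} = ennreal (if r \<ge> 0 then M * r ^ DIM('a) else 0)" for r
  proof -
    have "emeasure ?L {..r} = (\<integral>\<^sup>+x. ennreal (A x) * indicator (cball 0 r) x \<partial>lborel)"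
    proof -
      have "norm -` {..r} = cball (0::'a) r" by auto
      then show ?thesis
        by (simp add: emeasure_distr emeasure_density)
    qed
    also have "\<dots> = ennreal (if r \<ge> 0 then M * r ^ DIM('a) else 0)"
    proof (cases "r > 0")
      case True
      then show ?thesis
        using M0 by (subst nn_integral_homogeneous_cball[OF assms(1) hom])
          (auto simp: M ennreal_mult'[symmetric] mult.commute)
    next
      case False
      have "(\<integral>\<^sup>+x. ennreal (A x) * indicator (cball 0 r) x \<partial>lborel) = (\<integral>\<^sup>+(x::'a). 0 \<partial>lborel)"
      proof (rule nn_integral_cong_AE)
        show "AE x in lborel. ennreal (A x) * indicator (cball (0::'a) r) x = 0"
          using AE_lborel_singleton[of "0::'a"]
        proof eventually_elim
          case (elim x)
          then have "x \<notin> cball 0 r" using False by (simp add: not_le)  (smt (verit) zero_less_norm_iff)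
          then show ?case by simp
        qed
      qed
      then show ?thesis using False by (cases "r = 0") (auto simp: zero_power[OF DIM_positive])
    qed
    finally show ?thesis .
  qed
  have eqR: "emeasure ?R {..r} = ennreal (if r \<ge> 0 then M * r ^ DIM('a) else 0)" for r
  proof (cases "r \<ge> 0")
    case True
    have "emeasure ?R {..r} = (\<integral>\<^sup>+x. ennreal (DIM('a) * M * x ^ (DIM('a) - 1)) * indicator {0..r} x \<partial>lborel)"
      by (subst emeasure_density) (auto intro!: nn_integral_cong simp: indicator_def)
    also have "\<dots> = ennreal (M * r ^ DIM('a) - M * 0 ^ DIM('a))"
      using True M0
      by (intro nn_integral_FTC_Icc) (auto intro!: derivative_eq_intros simp: DIM_positive)
    finally show ?thesis using True by (simp add: zero_power[OF DIM_positive])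
  next
    case False
    have "emeasure ?R {..r} = (\<integral>\<^sup>+x. 0 \<partial>(lborel :: real measure))"
      using False
      by (subst emeasure_density) (auto intro!: nn_integral_cong simp del: nn_integral_const simp: indicator_def)
    then show ?thesis using False by simp
  qed
  show "emeasure ?L X = emeasure ?R X" if "X \<in> range atMost" for X
    using that eq eqR by auto
  show "emeasure ?L {..real i} \<noteq> \<infinity>" for i by (simp add: eq)
  show "Int_stable (range (atMost :: real \<Rightarrow> _))" by (auto simp: Int_stable_def)
  show "sets ?L = sigma_sets UNIV (range atMost)" "sets ?R = sigma_sets UNIV (range atMost)"
    by (simp_all add: borel_eq_atMost)
  show "(\<Union>i::nat. {..real i}) = UNIV" using real_arch_simple by auto
qed auto

text \<open>Polar coordinates without a surface measure: the angular factor enters only through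
  \<open>M\<close>, its mass in the unit ball.\<close>

lemma integral_homogeneous_radial:
  fixes A :: "'a::euclidean_space \<Rightarrow> real" and g :: "real \<Rightarrow> real" and M :: real
  assumes [measurable]: "A \<in> borel_measurable borel"
    and hom: "\<And>c x. c > 0 \<Longrightarrow> A (c *\<^sub>R x) = A x" and nonneg: "\<And>x. A x \<ge> 0"
    and M: "(\<integral>\<^sup>+x. ennreal (A x) * indicator (cball 0 1) x \<partial>lborel) = ennreal M" and M0: "M \<ge> 0"
    and [measurable]: "g \<in> borel_measurable borel"
  shows "(LBINT x. A x * g (norm x)) =
      DIM('a) * M * (LBINT r. r ^ (DIM('a) - 1) * g r * indicator {0..} r)"
proof -
  have "(LBINT x. A x * g (norm x)) = (\<integral>x. g (norm x) \<partial>density lborel A)"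
    by (subst integral_density) (auto simp: nonneg)
  also have "\<dots> = (\<integral>r. g r \<partial>distr (density lborel A) borel norm)"
    by (subst integral_distr) auto
  also have "\<dots> = (LBINT r. (DIM('a) * M * r ^ (DIM('a) - 1) * indicator {0..} r) * g r)"
    by (subst distr_norm_homogeneous[OF assms(1) _ M M0], simp add: hom, subst integral_density)
      (auto simp: M0 indicator_def)
  also have "\<dots> = DIM('a) * M * (LBINT r. r ^ (DIM('a) - 1) * g r * indicator {0..} r)"
    by (subst integral_mult_right_zero[symmetric]) (simp add: mult_ac)
  finally show ?thesis .
qed

section \<open>The bathtub principle for Lipschitz densities\<close>

definition profile :: "real \<Rightarrow> real \<Rightarrow> real \<Rightarrow> real \<Rightarrow> real" where
  "profile \<alpha> \<rho> t r = max 0 (min \<alpha> (\<alpha> - \<rho> * (r - t)))"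

lemma borel_measurable_profile [measurable]: "profile \<alpha> \<rho> t \<in> borel_measurable borel"
  unfolding profile_def by measurable

lemma continuous_on_profile: "continuous_on UNIV (profile \<alpha> \<rho> t)"
  unfolding profile_def by (intro continuous_intros)

lemma profile_eq_0: "\<rho> > 0 \<Longrightarrow> r \<ge> t + \<alpha> / \<rho> \<Longrightarrow> profile \<alpha> \<rho> t r = 0"
  by (simp add: profile_def field_simps)

lemma profile_eq_top: "\<alpha> \<ge> 0 \<Longrightarrow> \<rho> > 0 \<Longrightarrow> r \<le> t \<Longrightarrow> profile \<alpha> \<rho> t r = \<alpha>"
  by (simp add: profile_def max_def min_def mult_nonneg_nonpos)

lemma profile_eq_slope:
  "\<rho> > 0 \<Longrightarrow> t \<le> r \<Longrightarrow> r \<le> t + \<alpha> / \<rho> \<Longrightarrow> profile \<alpha> \<rho> t r = \<alpha> - \<rho> * (r - t)"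
  by (simp add: profile_def field_simps max_absorb2 min_absorb2 mult_left_mono)

text \<open>Integration by parts explains the value: the profile has slope \<open>- \<rho>\<close>
  on \<open>[t, T]\<close> and is constant elsewhere, so the integral is \<open>\<rho> / q\<close>
  times that of \<open>r ^ q\<close> over \<open>[t, T]\<close>.\<close>

lemma integral_power_profile:
  assumes "\<alpha> > 0" "\<rho> > 0" "t \<ge> 0" "q > 0"
  defines "T \<equiv> t + \<alpha> / \<rho>"
  shows "(LBINT r. r ^ (q - 1) * profile \<alpha> \<rho> t r * indicator {0..} r) =
    \<rho> * (T ^ (q + 1) - t ^ (q + 1)) / (q * (q + 1))"
proof -
  have T: "T > t" using assms by (simp add: T_def)
  have 1: "has_bochner_integral lborel (\<lambda>r. (\<alpha> * r ^ (q - 1)) * indicator {0..t} r)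
      (\<alpha> * t ^ q / q - \<alpha> * 0 ^ q / q)"
    using assms by (intro has_bochner_integral_FTC_Icc_real) (auto intro!: derivative_eq_intros continuous_intros)
  have 2: "has_bochner_integral lborel (\<lambda>r. ((\<alpha> - \<rho> * (r - t)) * r ^ (q - 1)) * indicator {t..T} r)
      (((\<alpha> + \<rho> * t) * T ^ q / q - \<rho> * T ^ (q + 1) / (q + 1)) - ((\<alpha> + \<rho> * t) * t ^ q / q - \<rho> * t ^ (q + 1) / (q + 1)))"
  proof (rule has_bochner_integral_FTC_Icc_real)
    show "((\<lambda>r. (\<alpha> + \<rho> * t) * r ^ q / q - \<rho> * r ^ (q + 1) / (q + 1)) has_real_derivative
      (\<alpha> - \<rho> * (x - t)) * x ^ (q - 1)) (at x)" for x
    proof -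
      have x: "x ^ q = x * x ^ (q - 1)" using \<open>q > 0\<close> by (cases q) auto
      have "((\<lambda>r. (\<alpha> + \<rho> * t) * r ^ q / q - \<rho> * r ^ (q + 1) / (q + 1)) has_real_derivative
          (\<alpha> + \<rho> * t) * (q * x ^ (q - 1)) / q - \<rho> * (real (q + 1) * x ^ q) / (q + 1)) (at x)"
        using DERIV_diff[OF DERIV_cdivide[OF DERIV_cmult[OF DERIV_pow[of q x]]]
            DERIV_cdivide[OF DERIV_cmult[OF DERIV_pow[of "q + 1" x]]],
            of "\<alpha> + \<rho> * t" q \<rho> "q + 1"]
        by simp
      also have "(\<alpha> + \<rho> * t) * (q * x ^ (q - 1)) / q - \<rho> * (real (q + 1) * x ^ q) / (q + 1) =
          (\<alpha> + \<rho> * t) * x ^ (q - 1) - \<rho> * x ^ q"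
        using \<open>q > 0\<close> by (simp del: of_nat_add)
      also have "\<dots> = (\<alpha> - \<rho> * (x - t)) * x ^ (q - 1)"
        by (simp add: x algebra_simps)
      finally show ?thesis .
    qed
  qed (use T in \<open>auto intro!: continuous_intros\<close>)
  have "(LBINT r. r ^ (q - 1) * profile \<alpha> \<rho> t r * indicator {0..} r) =
    (LBINT r. (\<alpha> * r ^ (q - 1)) * indicator {0..t} r + ((\<alpha> - \<rho> * (r - t)) * r ^ (q - 1)) * indicator {t..T} r)"
  proof (rule integral_cong_AE)
    \<comment> \<open>Both pieces contain the point \<open>t\<close>, so equality holds only off a
      null set.\<close>
    show "AE r in lborel. r ^ (q - 1) * profile \<alpha> \<rho> t r * indicator {0..} r =
      (\<alpha> * r ^ (q - 1)) * indicator {0..t} r + ((\<alpha> - \<rho> * (r - t)) * r ^ (q - 1)) * indicator {t..T} r"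
      using AE_lborel_singleton[of t]
    proof eventually_elim
      case (elim r)
      consider "r < 0" | "0 \<le> r" "r < t" | "t < r" "r \<le> T" | "T < r" "t < r" using elim T by linarith
      then show ?case
        using assms T by cases (auto simp: profile_eq_0 profile_eq_top profile_eq_slope T_def indicator_def)
    qed
  qed measurable
  also have "\<dots> = \<alpha> * t ^ q / q - \<alpha> * 0 ^ q / q +
      (((\<alpha> + \<rho> * t) * T ^ q / q - \<rho> * T ^ (q + 1) / (q + 1)) - ((\<alpha> + \<rho> * t) * t ^ q / q - \<rho> * t ^ (q + 1) / (q + 1)))"
    using has_bochner_integral_add[OF 1 2] by (rule has_bochner_integral_integral_eq)
  also have "\<dots> = \<rho> * (T ^ (q + 1) - t ^ (q + 1)) / (q * (q + 1))"
  proof -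
    have a: "\<alpha> = \<rho> * (T - t)" using assms by (simp add: T_def)
    have 1: "1 / real q - 1 / (real q + 1) = 1 / (real q * (real q + 1))"
      using \<open>q > 0\<close> by (simp add: field_simps)
    have "?thesis \<longleftrightarrow> \<rho> * (T ^ (q + 1) - t ^ (q + 1)) * (1 / real q - 1 / (real q + 1)) =
        \<rho> * (T ^ (q + 1) - t ^ (q + 1)) * (1 / (real q * (real q + 1)))"
      using \<open>q > 0\<close> unfolding a by (simp add: algebra_simps diff_divide_distrib zero_power)
    with 1 show ?thesis by simp
  qed
  finally show ?thesis .
qed

lemma has_bochner_integral_norm_power_profile:
  fixes \<alpha> \<rho> t :: real and p :: nat
  assumes "\<alpha> > 0" "\<rho> > 0" "t \<ge> 0"
  defines "T \<equiv> t + \<alpha> / \<rho>" and "q \<equiv> DIM('a::euclidean_space) + p"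
  shows "has_bochner_integral lborel (\<lambda>x::'a. norm x ^ p * profile \<alpha> \<rho> t (norm x))
    (DIM('a) * unit_ball_vol DIM('a) * \<rho> * (T ^ (q + 1) - t ^ (q + 1)) / (q * (q + 1)))"
proof -
  let ?F = "\<lambda>x::'a. norm x ^ p * profile \<alpha> \<rho> t (norm x)"
  have "integrable lborel (\<lambda>x. indicator (cball 0 T) x *\<^sub>R ?F x)"
    by (rule borel_integrable_compact)
       (auto intro!: continuous_intros continuous_on_compose2[OF continuous_on_profile])
  also have "(\<lambda>x. indicator (cball 0 T) x *\<^sub>R ?F x) = ?F"
    using assms by (auto simp: fun_eq_iff indicator_def profile_eq_0 T_def)
  finally have int: "integrable lborel ?F" .
  have "(LBINT x. ?F x) = (LBINT x. 1 * (norm x ^ p * profile \<alpha> \<rho> t (norm (x::'a))))" by simp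
  also have "\<dots> = DIM('a) * unit_ball_vol DIM('a) *
      (LBINT r. r ^ (DIM('a) - 1) * (r ^ p * profile \<alpha> \<rho> t r) * indicator {0..} r)"
    by (rule integral_homogeneous_radial) (auto simp: emeasure_cball)
  also have "(\<lambda>r::real. r ^ (DIM('a) - 1) * (r ^ p * profile \<alpha> \<rho> t r) * indicator {0..} r) =
      (\<lambda>r. r ^ (q - 1) * profile \<alpha> \<rho> t r * indicator {0..} r)"
  proof -
    have "q - 1 = (DIM('a) - 1) + p" using DIM_positive[where 'a='a] by (simp add: q_def del: DIM_positive)
    then have "r ^ (q - 1) = r ^ (DIM('a) - 1) * r ^ p" for r :: real by (simp only: power_add)
    then show ?thesis by (simp add: mult.assoc)
  qed
  also have "(LBINT r. r ^ (q - 1) * profile \<alpha> \<rho> t r * indicator {0..} r) =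
      \<rho> * (T ^ (q + 1) - t ^ (q + 1)) / (q * (q + 1))"
    unfolding T_def using assms by (intro integral_power_profile) (auto simp: q_def)
  finally show ?thesis using int by (simp add: has_bochner_integral_iff ring_distribs mult.assoc)
qed

text \<open>The integral vanishes iff \<open>r0 ^ p\<close> is the quotient of the increments of
  \<open>r ^ (n + p) / (n + p)\<close> and \<open>r ^ n / n\<close> over \<open>[t, T]\<close>. The
  quotient of their derivatives is \<open>r ^ p\<close>, so Cauchy's mean value theorem supplies
  \<open>r0\<close> strictly inside.\<close>

lemma exists_balancing_radius:
  fixes t T :: real
  assumes "0 \<le> t" "t < T" "n > 0"
  shows "\<exists>r0. t < r0 \<and> r0 < T \<and>
    (LBINT r. r ^ (n - 1) * ((r ^ p - r0 ^ p) * indicator {t..T} r) * indicator {0..} r) = 0"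
proof -
  have "\<exists>c. t < c \<and> c < T \<and> (T ^ (n + p) / (n + p) - t ^ (n + p) / (n + p)) * c ^ (n - 1) =
     (T ^ n / n - t ^ n / n) * c ^ (n + p - 1)"
    using assms by (intro GMVT') (auto intro!: derivative_eq_intros continuous_intros)
  then obtain c where c: "t < c" "c < T" "(T ^ (n + p) / (n + p) - t ^ (n + p) / (n + p)) * c ^ (n - 1) =
     (T ^ n / n - t ^ n / n) * c ^ (n + p - 1)" by blast
  have "c ^ (n + p - 1) = c ^ (n - 1) * c ^ p"
    using \<open>n > 0\<close> by (simp flip: power_add)
  with c assms have eq: "(T ^ (n + p) / (n + p) - t ^ (n + p) / (n + p)) = (T ^ n / n - t ^ n / n) * c ^ p"
    by auto
  have p1: "x ^ (n + p - Suc 0) = x ^ p * x ^ (n - Suc 0)" for x :: real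
    using \<open>n > 0\<close> by (simp add: add.commute flip: power_add)
  have "has_bochner_integral lborel (\<lambda>r. (r ^ (n + p - 1) - c ^ p * r ^ (n - 1)) * indicator {t..T} r)
      ((T ^ (n + p) / (n + p) - c ^ p * T ^ n / n) - (t ^ (n + p) / (n + p) - c ^ p * t ^ n / n))"
    using assms
    by (intro has_bochner_integral_FTC_Icc_real) (auto intro!: derivative_eq_intros continuous_intros)
  also have "(\<lambda>r. (r ^ (n + p - 1) - c ^ p * r ^ (n - 1)) * indicator {t..T} r) =
     (\<lambda>r. r ^ (n - 1) * ((r ^ p - c ^ p) * indicator {t..T} r) * indicator {0..} r)"
    using assms by (auto simp: fun_eq_iff indicator_def algebra_simps p1)
  finally show ?thesis
    using c eq by (intro exI[of _ c]) (auto simp: has_bochner_integral_iff algebra_simps diff_divide_distrib)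
qed

text \<open>The constant \<open>r0\<close> is chosen such that the weight \<open>r\<^sup>p - r0\<^sup>p\<close> has radial mean zero on the annulus where
  the profile decreases.  There \<open>f - profile\<close> is increasing on every ray, so that its value at radius
  \<open>r0\<close> can be subtracted without changing the weighted integral, and the integrand becomes
  nonnegative.\<close>

lemma bathtub:
  fixes f :: "'a::euclidean_space \<Rightarrow> real"
  assumes [measurable]: "f \<in> borel_measurable borel"
    and f0: "\<And>x. 0 \<le> f x" and f1: "\<And>x. f x \<le> \<alpha>"
    and lip: "\<And>x y. \<bar>f x - f y\<bar> \<le> \<rho> * norm (x - y)"
    and pos: "\<alpha> > 0" "\<rho> > 0" "t \<ge> 0"
    and int: "integrable lborel f" "integrable lborel (\<lambda>x. norm x ^ p * f x)"
    and mass: "(LBINT x. profile \<alpha> \<rho> t (norm (x::'a))) \<le> (LBINT x. f x)"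
  shows "(LBINT x. norm x ^ p * profile \<alpha> \<rho> t (norm (x::'a))) \<le> (LBINT x. norm x ^ p * f x)"
proof -
  define T where "T = t + \<alpha> / \<rho>"
  have T: "t < T" using pos by (simp add: T_def)
  obtain r0 where r0: "t < r0" "r0 < T"
    and bal: "(LBINT r. r ^ (DIM('a) - 1) * ((r ^ p - r0 ^ p) * indicator {t..T} r) * indicator {0..} r) = 0"
    using exists_balancing_radius[OF pos(3) T, of "DIM('a)" p] by auto
  \<comment> \<open>The value of \<open>f\<close> on the same ray at radius \<open>r0\<close>. At
    the origin the quotient is 0 by convention and \<open>A\<close> takes the value
    \<open>f 0\<close>.\<close>
  define A where "A = (\<lambda>x::'a. f ((r0 / norm x) *\<^sub>R x))"
  define g where "g = (\<lambda>r. (r ^ p - r0 ^ p) * indicator {t..T} r)"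
  let ?P = "\<lambda>x::'a. profile \<alpha> \<rho> t (norm x)"
  have [measurable]: "A \<in> borel_measurable borel" "g \<in> borel_measurable borel"
    unfolding A_def g_def by measurable
  have A: "0 \<le> A x" "A x \<le> \<alpha>" for x using f0 f1 by (auto simp: A_def)
  have intP: "integrable lborel ?P" "integrable lborel (\<lambda>x. norm x ^ p * ?P x)"
    using has_bochner_integral_norm_power_profile[OF pos, of 0, where 'a='a]
      has_bochner_integral_norm_power_profile[OF pos, of p, where 'a='a]
    by (simp_all add: has_bochner_integral_iff)
  have "(\<integral>\<^sup>+x. ennreal (A x) * indicator (cball 0 1) x \<partial>lborel) \<le>
      (\<integral>\<^sup>+(x::'a). ennreal \<alpha> * indicator (cball 0 1) x \<partial>lborel)"
    using A by (intro nn_integral_mono) (auto simp: indicator_def ennreal_leI)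
  also have "\<dots> < \<infinity>"
    by (simp add: nn_integral_cmult_indicator emeasure_cball ennreal_mult_less_top)
  finally obtain M where M: "M \<ge> 0"
    "(\<integral>\<^sup>+x. ennreal (A x) * indicator (cball 0 1) x \<partial>lborel) = ennreal M"
    by (cases "\<integral>\<^sup>+x. ennreal (A x) * indicator (cball 0 1) x \<partial>lborel") auto
  have hom: "A (c *\<^sub>R x) = A x" if "c > 0" for c x
    using that by (simp add: A_def)
  have Ag: "(LBINT x. A x * g (norm x)) = 0"
    using integral_homogeneous_radial[of A M g] hom A M bal by (simp add: g_def)
  have g0: "(LBINT x. 1 * g (norm (x::'a))) = 0"
    using integral_homogeneous_radial[of "\<lambda>x::'a. 1" "unit_ball_vol DIM('a)" g] bal
    by (simp add: g_def emeasure_cball)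
  have int_g: "integrable lborel (\<lambda>x::'a. g (norm x))"
  proof -
    have "integrable lborel (\<lambda>x::'a. indicator (cball 0 T - ball 0 t) x *\<^sub>R (norm x ^ p - r0 ^ p))"
      by (rule borel_integrable_compact) (auto intro!: continuous_intros compact_diff)
    also have "(\<lambda>x::'a. indicator (cball 0 T - ball 0 t) x *\<^sub>R (norm x ^ p - r0 ^ p)) = (\<lambda>x. g (norm x))"
      by (auto simp: g_def fun_eq_iff indicator_def)
    finally show ?thesis .
  qed
  have int_Ag: "integrable lborel (\<lambda>x. A x * g (norm x))"
  proof (rule Bochner_Integration.integrable_bound[OF integrable_mult_right[OF int_g, of \<alpha>]])
    have "\<bar>A x\<bar> \<le> \<bar>\<alpha>\<bar>" for x using A[of x] by linarith
    then show "AE x in lborel. norm (A x * g (norm x)) \<le> norm (\<alpha> * g (norm x))"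
      by (auto simp: abs_mult intro!: mult_right_mono)
  qed measurable
  define h0 where "h0 = profile \<alpha> \<rho> t r0"
  have h0: "h0 = \<alpha> - \<rho> * (r0 - t)" using r0 pos by (auto simp: h0_def T_def intro!: profile_eq_slope)
  \<comment> \<open>Both terms integrate to 0 because \<open>A\<close> and the constant
    \<open>h0\<close> are homogeneous of degree 0 and \<open>g\<close> is balanced. They are the
    values of \<open>f\<close> and of the profile at radius \<open>r0\<close>.\<close>
  have "0 = (LBINT x. A x * g (norm x) - h0 * g (norm x))"
    using Ag g0 int_Ag int_g by simp
  also have "\<dots> \<le> (LBINT x. (norm x ^ p * f x - norm x ^ p * ?P x) - r0 ^ p * (f x - ?P x))"
  proof (rule integral_mono_AE)
    show "AE x in lborel. A x * g (norm x) - h0 * g (norm x) \<le>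
       (norm x ^ p * f x - norm x ^ p * ?P x) - r0 ^ p * (f x - ?P x)"
      using AE_lborel_singleton[of "0::'a"]
    proof eventually_elim
      case (elim x)
      have *: "(norm x ^ p * f x - norm x ^ p * ?P x) - r0 ^ p * (f x - ?P x) = (norm x ^ p - r0 ^ p) * (f x - ?P x)"
        by (simp add: algebra_simps)
      \<comment> \<open>Below \<open>t\<close> the profile is maximal and the weight is at most 0;
        beyond \<open>T\<close> the profile vanishes and the weight is at least 0. In both regions
        the product is nonnegative and \<open>g\<close> is 0, so only the annulus needs the
        Lipschitz bound.\<close>
      consider "norm x < t" | "t \<le> norm x" "norm x \<le> T" | "T < norm x" by linarith
      then show ?case
      proof cases
        case 1
        then have "norm x ^ p \<le> r0 ^ p" using r0 by (intro power_mono) auto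
        then show ?thesis unfolding * using 1 f1[of x] pos
          by (simp add: g_def profile_eq_top mult_nonpos_nonpos)
      next
        case 3
        then have "norm x ^ p \<ge> r0 ^ p" using r0 pos by (intro power_mono) auto
        then show ?thesis unfolding * using 3 f0[of x] pos
          by (simp add: g_def profile_eq_0 T_def)
      next
        case 2
        have P: "?P x = \<alpha> - \<rho> * (norm x - t)" using 2 pos by (intro profile_eq_slope) (auto simp: T_def)
        have "x - (r0 / norm x) *\<^sub>R x = ((norm x - r0) / norm x) *\<^sub>R x"
          using elim by (simp add: diff_divide_distrib scaleR_left_diff_distrib)
        then have "norm (x - (r0 / norm x) *\<^sub>R x) = \<bar>norm x - r0\<bar>"
          using elim by simp
        \<comment> \<open>Between the two radii \<open>f\<close> changes at most as fast as the
          profile falls. Hence \<open>f - profile\<close>, minus its value at \<open>r0\<close>, has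
          the sign of \<open>norm x - r0\<close>, which is also the sign of the weight.\<close>
        then have d: "\<bar>f x - A x\<bar> \<le> \<rho> * \<bar>norm x - r0\<bar>"
          using lip[of x "(r0 / norm x) *\<^sub>R x"] by (simp add: A_def)
        have "0 \<le> (norm x ^ p - r0 ^ p) * ((f x - ?P x) - (A x - h0))"
        proof (cases "norm x \<ge> r0")
          case True
          then have "norm x ^ p \<ge> r0 ^ p" using r0 pos by (intro power_mono) auto
          moreover have "(f x - ?P x) - (A x - h0) \<ge> 0"
            using d True by (simp add: P h0 algebra_simps)
          ultimately show ?thesis by simp
        next
          case False
          then have "norm x ^ p \<le> r0 ^ p" by (intro power_mono) auto
          moreover have "(f x - ?P x) - (A x - h0) \<le> 0"
            using d False by (simp add: P h0 algebra_simps)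
          ultimately show ?thesis by (simp add: mult_nonpos_nonpos)
        qed
        then show ?thesis unfolding * using 2 by (simp add: g_def algebra_simps)
      qed
    qed
  qed (use int intP int_Ag int_g in auto)
  \<comment> \<open>The surplus of mass is multiplied by \<open>r0 ^ p \<ge> 0\<close>, so an
    inequality between the masses is enough.\<close>
  also have "\<dots> = (LBINT x. norm x ^ p * f x) - (LBINT x. norm x ^ p * ?P x)
      - r0 ^ p * ((LBINT x. f x) - (LBINT x. ?P x))"
    using int intP by simp
  finally show ?thesis
    using mass r0 pos by (smt (verit) mult_nonneg_nonneg zero_le_power)
qed

section \<open>Moments of the uniform distribution on an interval\<close>

text \<open>The left side is the cubic Taylor polynomial of \<open>z ^ q\<close> at 1. Multiplying
  the polynomial for \<open>n\<close> by \<open>z\<close> gives the one for \<open>n + 1\<close>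
  plus \<open>n * (n - 1) * (n - 2) / 6 * (z - 1) ^ 4\<close>, which is nonnegative; this drives the
  induction.\<close>

lemma cubic_Taylor_lower_bound:
  fixes z :: real
  assumes "z \<ge> 0" "q \<ge> 3"
  shows "1 + q * (z - 1) + q * (q - 1) / 2 * (z - 1)\<^sup>2 + q * (q - 1) * (q - 2) / 6 * (z - 1) ^ 3 \<le> z ^ q"
  using \<open>q \<ge> 3\<close>
proof (induction q rule: dec_induct)
  case base
  show ?case by (simp add: power2_eq_square power3_eq_cube algebra_simps)
next
  case (step n)
  define w where "w = z - 1"
  have "0 \<le> real n * (real n - 1) * (real n - 2) / 6 * w ^ 4" using step by simp
  moreover have "1 + real (Suc n) * w + real (Suc n) * (real (Suc n) - 1) / 2 * w\<^sup>2
      + real (Suc n) * (real (Suc n) - 1) * (real (Suc n) - 2) / 6 * w ^ 3 +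
      real n * (real n - 1) * (real n - 2) / 6 * w ^ 4 =
     (1 + w) * (1 + real n * w + real n * (real n - 1) / 2 * w\<^sup>2 + real n * (real n - 1) * (real n - 2) / 6 * w ^ 3)"
    by (simp add: field_simps power2_eq_square power3_eq_cube power4_eq_xxxx)
  moreover have "(1 + w) * (1 + real n * w + real n * (real n - 1) / 2 * w\<^sup>2 + real n * (real n - 1) * (real n - 2) / 6 * w ^ 3) \<le> z * z ^ n"
    using mult_left_mono[OF step.IH assms(1)] by (simp add: w_def)
  ultimately show ?case by (simp add: w_def)
qed

text \<open>The \<open>q\<close>-th moment of the uniform distribution on \<open>[t, t + y]\<close>.\<close>

definition unif_moment :: "real \<Rightarrow> real \<Rightarrow> nat \<Rightarrow> real" where
  "unif_moment t y q = ((t + y) ^ (q + 1) - t ^ (q + 1)) / ((q + 1) * y)"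

lemma unif_moment_scale:
  assumes "c \<noteq> 0"
  shows "unif_moment (c * t) (c * y) q = c ^ q * unif_moment t y q"
proof -
  have "(c * t + c * y) ^ (q + 1) - (c * t) ^ (q + 1) = c ^ (q + 1) * ((t + y) ^ (q + 1) - t ^ (q + 1))"
    by (simp only: power_mult_distrib[symmetric] right_diff_distrib distrib_left)
  then show ?thesis using assms by (simp add: unif_moment_def)
qed

text \<open>Average the cubic Taylor bound with \<open>z = s\<^sup>2\<close> over
  \<open>[t, t + y]\<close>. Write M2, M4, M6 for the moments. Since M4 = 1, the cubic part averages
  to M6 - 3 M4 + 3 M2 - 1 = M6 + 3 M2 - 4, and the linear and quadratic parts combine to q (q - 2)
  (1 - M2).\<close>

lemma unif_moment_even_ge:
  assumes "q \<ge> 3" "y > 0" "unif_moment t y 4 = 1"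
  shows "1 + q * (q - 2) * (1 - unif_moment t y 2)
     + q * (q - 1) * (q - 2) / 6 * (unif_moment t y 6 + 3 * unif_moment t y 2 - 4)
     \<le> unif_moment t y (2 * q)"
proof -
  define b c :: real where "b = real q * (real q - 1) / 2" and "c = real q * (real q - 1) * (real q - 2) / 6"
  \<comment> \<open>An antiderivative of \<open>s ^ (2 * q)\<close> minus its Taylor polynomial in
    powers of \<open>s\<^sup>2 - 1\<close>. Monotonicity of \<open>G\<close> is the integrated
    inequality.\<close>
  define G where "G = (\<lambda>s::real. s ^ (2 * q + 1) / (2 * q + 1) - ((1 - real q + b - c) * s + (real q - 2 * b + 3 * c) * (s ^ 3 / 3)
     + (b - 3 * c) * (s ^ 5 / 5) + c * (s ^ 7 / 7)))"
  have "G t \<le> G (t + y)"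
  proof (rule DERIV_nonneg_imp_nondecreasing[where f = G])
    fix s :: real
    let ?D = "s ^ (2 * q) - ((1 - real q + b - c) + (real q - 2 * b + 3 * c) * s ^ 2 + (b - 3 * c) * s ^ 4 + c * s ^ 6)"
    have "((\<lambda>s. s ^ (2 * q + 1) / (2 * q + 1)) has_real_derivative (s ^ (2 * q))) (at s)"
      using DERIV_cdivide[OF DERIV_pow[of "2 * q + 1" s], of "real (2 * q + 1)"] by simp
    then have "(G has_real_derivative ?D) (at s)"
      unfolding G_def by (rule DERIV_diff) (auto intro!: derivative_eq_intros)
    moreover have "?D \<ge> 0"
    proof -
      have "(1 - real q + b - c) + (real q - 2 * b + 3 * c) * s ^ 2 + (b - 3 * c) * s ^ 4 + c * s ^ 6 =
         1 + real q * (s\<^sup>2 - 1) + b * (s\<^sup>2 - 1)\<^sup>2 + c * (s\<^sup>2 - 1) ^ 3"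
        by (simp add: algebra_simps power2_eq_square power3_eq_cube eval_nat_numeral)
      also have "\<dots> \<le> (s\<^sup>2) ^ q"
        unfolding b_def c_def using assms by (intro cubic_Taylor_lower_bound) auto
      finally show ?thesis by (simp add: power_mult)
    qed
    ultimately show "\<exists>D. (G has_real_derivative D) (at s) \<and> D \<ge> 0" by blast
  qed (use assms in simp)
  also have "G (t + y) = G t + y * unif_moment t y (2 * q) -
     (y * (1 - real q + b - c) + (real q - 2 * b + 3 * c) * (y * unif_moment t y 2) + (b - 3 * c) * (y * unif_moment t y 4)
     + c * (y * unif_moment t y 6))"
  proof -
    have um: "y * unif_moment t y n = (t + y) ^ (n + 1) / (n + 1) - t ^ (n + 1) / (n + 1)" for n
    proof -
      have "y * unif_moment t y n = ((t + y) ^ (n + 1) - t ^ (n + 1)) / (n + 1)"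
        using assms(2) by (simp add: unif_moment_def add.commute)
      then show ?thesis by (simp only: diff_divide_distrib)
    qed
    have um': "y * unif_moment t y 2 = (t + y) ^ 3 / 3 - t ^ 3 / 3" "y * unif_moment t y 4 = (t + y) ^ 5 / 5 - t ^ 5 / 5"
      "y * unif_moment t y 6 = (t + y) ^ 7 / 7 - t ^ 7 / 7"
      using um[of 2] um[of 4] um[of 6] by simp_all
    have lin: "A1 - (c0 * (t + y) + c1 * p1 + c2 * q1 + c3 * r1) =
        (A0 - (c0 * t + c1 * p0 + c2 * q0 + c3 * r0)) + (A1 - A0) -
        (y * c0 + c1 * (p1 - p0) + c2 * (q1 - q0) + c3 * (r1 - r0))" for A0 A1 c0 c1 c2 c3 p0 p1 q0 q1 r0 r1 :: real
      by (simp add: algebra_simps)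
    show ?thesis
      unfolding um[of "2 * q"] um' G_def by (rule lin)
  qed
  finally have "0 \<le> y * (unif_moment t y (2 * q) -
     ((1 - real q + b - c) + (real q - 2 * b + 3 * c) * unif_moment t y 2 + (b - 3 * c)
     + c * unif_moment t y 6))"
    using assms(3) by (simp add: algebra_simps)
  then have *: "0 \<le> unif_moment t y (2 * q) -
     ((1 - real q + b - c) + (real q - 2 * b + 3 * c) * unif_moment t y 2 + (b - 3 * c)
     + c * unif_moment t y 6)"
    using assms(2) by (simp add: zero_le_mult_iff)
  have "(1 - real q + b - c) + (real q - 2 * b + 3 * c) * M2 + (b - 3 * c) + c * M6 =
     1 + real q * (real q - 2) * (1 - M2) + c * (M6 + 3 * M2 - 4)" for M2 M6
    by (simp add: b_def field_simps)
  with * have "0 \<le> unif_moment t y (2 * q) -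
      (1 + real q * (real q - 2) * (1 - unif_moment t y 2) + c * (unif_moment t y 6 + 3 * unif_moment t y 2 - 4))"
    by (simp only:)
  then show ?thesis by (simp add: c_def)
qed

text \<open>The closed forms come from solving \<open>unif_moment t y 4 = 1\<close>, a quadratic equation for \<open>(t + y / 2)\<^sup>2\<close>.\<close>

definition normalised_interval :: "real \<Rightarrow> real \<Rightarrow> bool" where
  "normalised_interval t y \<longleftrightarrow> unif_moment t y 4 = 1 \<and>
     unif_moment t y 2 = sqrt (1 + y ^ 4 / 20) - y\<^sup>2 / 6 \<and>
     unif_moment t y 6 = sqrt (1 + y ^ 4 / 20) * (1 - y ^ 4 / 5) + y\<^sup>2 / 2 + 3/70 * y ^ 6"

text \<open>In terms of the midpoint \<open>T\<close> the even moments are polynomials in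
  \<open>T\<^sup>2\<close> and \<open>y\<^sup>2\<close>. The fourth is
  \<open>(T\<^sup>2 + y\<^sup>2 / 4)\<^sup>2 - y ^ 4 / 20\<close>, so equating it to 1 gives
  \<open>T\<^sup>2 = R - y\<^sup>2 / 4\<close>. Smallness of \<open>y\<close> makes the left end
  \<open>t = T - y / 2\<close> nonnegative.\<close>

lemma exists_normalised_interval:
  assumes y: "0 < y" "y \<le> 1/4"
  shows "\<exists>t\<ge>0. normalised_interval t y"
proof -
  define R where "R = sqrt (1 + y ^ 4 / 20)"
  have R: "R\<^sup>2 = 1 + y ^ 4 / 20" by (simp add: R_def)
  have R1: "R \<ge> 1" by (simp add: R_def)
  have y2: "y\<^sup>2 \<le> 1" using y by (simp add: power_le_one)
  define T where "T = sqrt (R - y\<^sup>2 / 4)"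
  have T: "T\<^sup>2 = R - y\<^sup>2 / 4" using R1 y2 by (simp add: T_def)
  have "sqrt (y\<^sup>2 / 4) \<le> T" unfolding T_def using R1 y2 by (intro real_sqrt_le_mono) linarith
  then have T0: "y / 2 \<le> T" using y by (simp add: real_sqrt_divide)
  define t where "t = T - y / 2"
  have m2: "unif_moment t y 2 = T\<^sup>2 + y\<^sup>2 / 12"
    using y(1) by (simp add: unif_moment_def t_def field_simps) algebra
  have m4: "unif_moment t y 4 = (T\<^sup>2)\<^sup>2 + T\<^sup>2 * y\<^sup>2 / 2 + y ^ 4 / 80"
    using y(1) by (simp add: unif_moment_def t_def field_simps) algebra
  have m6: "unif_moment t y 6 = (T\<^sup>2) ^ 3 + 5/4 * (T\<^sup>2)\<^sup>2 * y\<^sup>2 + 3/16 * T\<^sup>2 * y ^ 4 + y ^ 6 / 448"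
    using y(1) by (simp add: unif_moment_def t_def field_simps) algebra
  have 4: "unif_moment t y 4 = 1" 
  proof -
    have "(R - y\<^sup>2 / 4)\<^sup>2 + (R - y\<^sup>2 / 4) * y\<^sup>2 / 2 + y ^ 4 / 80 = R\<^sup>2 - y ^ 4 / 20"
      by (simp add: field_simps) algebra
    then show ?thesis unfolding m4 T R by simp
  qed
  have 6: "unif_moment t y 6 = R * (1 - y ^ 4 / 5) + y\<^sup>2 / 2 + 3/70 * y ^ 6"
  proof -
    have "(R - y\<^sup>2 / 4) ^ 3 + 5/4 * (R - y\<^sup>2 / 4)\<^sup>2 * y\<^sup>2 + 3/16 * (R - y\<^sup>2 / 4) * y ^ 4 + y ^ 6 / 448 =
        R * R\<^sup>2 + y\<^sup>2 / 2 * R\<^sup>2 - R * y ^ 4 / 4 + y ^ 6 / 56"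
      by (simp add: field_simps) algebra
    then show ?thesis unfolding m6 T R by (simp add: algebra_simps flip: power_add)
  qed
  have "0 \<le> t" using T0 by (simp add: t_def)
  moreover have "unif_moment t y 2 = R - y\<^sup>2 / 6" using m2 T by simp
  ultimately show ?thesis using 4 6 by (auto simp: normalised_interval_def R_def)
qed

section \<open>Polynomial lower bounds for the moments of the normalised interval\<close>

lemma sqrt_quartic_bounds:
  fixes y :: real
  shows "1 + y ^ 4 / 40 - y ^ 8 / 3200 \<le> sqrt (1 + y ^ 4 / 20)" "sqrt (1 + y ^ 4 / 20) \<le> 1 + y ^ 4 / 40"
proof -
  define a where "a = y ^ 4"
  have a: "a \<ge> 0" "y ^ 8 = a\<^sup>2" by (simp_all add: a_def flip: power_mult)
  have "sqrt (1 + a / 20) \<le> sqrt ((1 + a / 40)\<^sup>2)"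
    by (intro real_sqrt_le_mono) (simp add: power2_eq_square field_simps)
  then show "sqrt (1 + y ^ 4 / 20) \<le> 1 + y ^ 4 / 40" using a by (simp add: a_def)
  \<comment> \<open>The second Taylor polynomial of the root. Its square stays below
    \<open>1 + a / 20\<close> up to \<open>a = 160\<close>; beyond that the polynomial itself is at
    most 1.\<close>
  have "1 + a / 40 - a\<^sup>2 / 3200 \<le> sqrt (1 + a / 20)"
  proof (cases "a \<le> 160")
    case True
    have "(1 + a / 40 - a\<^sup>2 / 3200)\<^sup>2 = 1 + a / 20 - a ^ 3 / 64000 * (1 - a / 160)"
      by (simp add: field_simps power2_eq_square power3_eq_cube)
    also have "\<dots> \<le> 1 + a / 20" using a True by simp
    finally show ?thesis by (rule real_le_rsqrt)
  next
    case False
    then have "a * 160 \<le> a * a" using a by (intro mult_left_mono) auto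
    then have "1 + a / 40 - a\<^sup>2 / 3200 \<le> 1" using False by (simp add: power2_eq_square)
    also have "1 \<le> sqrt (1 + a / 20)" using a by simp
    finally show ?thesis .
  qed
  then show "1 + y ^ 4 / 40 - y ^ 8 / 3200 \<le> sqrt (1 + y ^ 4 / 20)"
    unfolding a(2) by (simp only: a_def)
qed

text \<open>The sixth moment is known exactly, so only the root is estimated. The expansions agree
  up to \<open>y ^ 4\<close>. At \<open>y ^ 6\<close> the true coefficient 3/70 exceeds the claimed
  one by more than 0.0022, which pays for \<open>y ^ 7 / 100\<close> because
  \<open>y \<le> 22/100\<close>; at \<open>y ^ 8\<close> the loss 17/3200 is below the permitted 449
  * 3 / 245760.\<close>

lemma normalised_bound_1:
  fixes y :: real
  assumes y: "0 < y" "y \<le> 22/100" and m: "normalised_interval t y"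
  shows "1 + y\<^sup>2 / 2 - 7/40 * y ^ 4 + 47 * 96 / 114688 * y ^ 6 + y ^ 7 / 100 - 449 * 3 / 245760 * y ^ 8 \<le> unif_moment t y 6"
proof -
  have y1: "y ^ n \<le> 1" for n using y by (intro power_le_one) auto
  have "(1 + y ^ 4 / 40 - y ^ 8 / 3200) * (1 - y ^ 4 / 5) \<le> sqrt (1 + y ^ 4 / 20) * (1 - y ^ 4 / 5)"
    using y1[of 4] by (intro mult_right_mono sqrt_quartic_bounds) auto
  moreover have "(1 + y ^ 4 / 40 - y ^ 8 / 3200) * (1 - y ^ 4 / 5) = 1 - 7/40 * y ^ 4 - 17/3200 * y ^ 8 + y ^ 12 / 16000"
    by (simp add: field_simps flip: power_add)
  moreover have "y ^ 6 * y \<le> y ^ 6 * (22/100)" using y by (intro mult_left_mono) auto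
  then have "y ^ 7 \<le> 22/100 * y ^ 6" by (simp add: eval_nat_numeral)
  moreover have "0 \<le> y ^ 6" "0 \<le> y ^ 12" "0 \<le> y ^ 8" using y by auto
  ultimately show ?thesis using m unfolding normalised_interval_def by linarith
qed

lemma normalised_bound_ge2:
  fixes y :: real
  assumes "q \<ge> 3" and y: "0 < y" "y \<le> 1" and norm: "normalised_interval t y"
  shows "1 + q * (q - 2) * (y\<^sup>2 / 6 - y ^ 4 / 40) - q * (q - 1) * (q - 2) / 30 * y ^ 4 \<le> unif_moment t y (2 * q)"
proof -
  define R where "R = sqrt (1 + y ^ 4 / 20)"
  have R: "R \<le> 1 + y ^ 4 / 40" "1 \<le> R"
    using sqrt_quartic_bounds[of y] by (auto simp: R_def)
  note mom = norm[unfolded normalised_interval_def R_def[symmetric]]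
  have "y ^ 4 \<le> 1" using y by (simp add: power_le_one)
  \<comment> \<open>In M6 + 3 M2 the terms in \<open>y\<^sup>2\<close> cancel and the root occurs
    only in the product \<open>R * (4 - y ^ 4 / 5)\<close>, for which \<open>R \<ge> 1\<close> is
    enough.\<close>
  then have "1 * (4 - y ^ 4 / 5) \<le> R * (4 - y ^ 4 / 5)" using R by (intro mult_right_mono) auto
  moreover have "0 \<le> y ^ 6" using assms by simp
  ultimately have 1: "- (y ^ 4 / 5) \<le> unif_moment t y 6 + 3 * unif_moment t y 2 - 4"
    using mom unfolding right_diff_distrib by linarith
  have 2: "y\<^sup>2 / 6 - y ^ 4 / 40 \<le> 1 - unif_moment t y 2"
    using mom R by simp
  have "real q * (real q - 1) * (real q - 2) / 6 * (- (y ^ 4 / 5)) \<le>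
      real q * (real q - 1) * (real q - 2) / 6 * (unif_moment t y 6 + 3 * unif_moment t y 2 - 4)"
    using assms 1 by (intro mult_left_mono) auto
  moreover have "real q * (real q - 2) * (y\<^sup>2 / 6 - y ^ 4 / 40) \<le> real q * (real q - 2) * (1 - unif_moment t y 2)"
    using assms 2 by (intro mult_left_mono) auto
  ultimately show ?thesis
    using unif_moment_even_ge[OF assms(1) y(1) mom[THEN conjunct1]] by simp
qed

text \<open>The hypothesis is the case \<open>q = 4\<close> of \<open>normalised_bound_ge2\<close>.
  It offers the coefficient 4/3 at \<open>y\<^sup>2\<close> where only 1/6 is claimed, and this gap
  absorbs all higher terms by crude estimates.\<close>

lemma normalised_bound_2:
  fixes y m :: real
  assumes y: "0 < y" "y \<le> 22/100" and m: "1 + 8 * (y\<^sup>2 / 6 - y ^ 4 / 40) - 24 / 30 * y ^ 4 \<le> m"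
  shows "1 + y\<^sup>2 / 6 - 2/5 * y ^ 4 + 61/640 * y ^ 6 + y ^ 7 / 75 - 17423/921600 * y ^ 8 + 7/600 * y ^ 9 \<le> m"
proof -
  have y1: "y ^ n \<le> 1" for n using y by (intro power_le_one) auto
  have "y ^ 2 * y ^ n \<le> y ^ 2 * 1" for n using y1 by (intro mult_left_mono) auto
  from this[of 4] this[of 5] this[of 7]
  have "y ^ 6 \<le> y\<^sup>2" "y ^ 7 \<le> y\<^sup>2" "y ^ 9 \<le> y\<^sup>2" by (simp_all flip: power_add)
  moreover have "y\<^sup>2 * y\<^sup>2 \<le> y\<^sup>2 * (22/100)\<^sup>2" using y by (intro mult_left_mono power_mono) auto
  then have "y ^ 4 \<le> 484/10000 * y\<^sup>2" by (simp add: power2_eq_square eval_nat_numeral)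
  moreover have "0 \<le> y ^ 8" "0 \<le> y\<^sup>2" using y by auto
  ultimately show ?thesis using m unfolding right_diff_distrib by linarith
qed

text \<open>Up to \<open>y\<^sup>2\<close> the two sides agree. The claim then gives away a cubic
  term, and this has to outweigh both the quartic loss in the hypothesis and the positive quartic
  term of the claim. Each quartic term can spend one factor \<open>y\<close> on \<open>l\<close> or
  on \<open>2 * l + 3\<close>, which the bound on \<open>y * (2 * l + 3)\<close> turns into a cubic
  one.\<close>

lemma normalised_bound_ge3:
  fixes y m :: real and l :: nat
  assumes y: "0 < y" "y * (2 * l + 3) \<le> 4" and l: "l \<ge> 1"
    and m: "1 + (real l + 2) * real l * (y\<^sup>2 / 6 - y ^ 4 / 40) - (real l + 2) * (real l + 1) * real l / 30 * y ^ 4 \<le> m"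
  shows "2 / (real l + 2) + real l / 3 * y\<^sup>2 - (4 * real l + 7) * (2 * real l + 1) / 12 * y ^ 3
      + (2 * real l + 3) * (2 * real l - 1) * (real l + 1) / 12 * y ^ 4
      - (2 * real l + 3) * (2 * real l + 1) * (real l + 1) * real l / 18 * y ^ 5 \<le> 2 / (real l + 2) * m"
proof -
  define L where "L = real l"
  have L: "L \<ge> 1" using l by (simp add: L_def)
  have yL: "y * (2 * L + 3) \<le> 4" using y by (simp add: L_def add.commute)
  have yL': "y * L \<le> 2" using yL y L by (simp add: algebra_simps)
  have y3: "y ^ 3 \<ge> 0" "y ^ 5 \<ge> 0" using y by auto
  have "2 / (L + 2) + L / 3 * y\<^sup>2 - (L / 20 + (L + 1) * L / 15) * y ^ 4 \<le> 2 / (L + 2) * m"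
  proof -
    have "2 / (L + 2) + L / 3 * y\<^sup>2 - (L / 20 + (L + 1) * L / 15) * y ^ 4 =
      2 / (L + 2) * (1 + (L + 2) * L * (y\<^sup>2 / 6 - y ^ 4 / 40) - (L + 2) * (L + 1) * L / 30 * y ^ 4)"
      using L by (simp add: field_simps)
    also have "\<dots> \<le> 2 / (L + 2) * m" using L m by (intro mult_left_mono) (auto simp: L_def)
    finally show ?thesis .
  qed
  moreover have "(L / 20 + (L + 1) * L / 15) * y ^ 4 + (2 * L + 3) * (2 * L - 1) * (L + 1) / 12 * y ^ 4 \<le>
      (4 * L + 7) * (2 * L + 1) / 12 * y ^ 3"
  proof -
    have "(L / 20 + (L + 1) * L / 15) * y ^ 4 + (2 * L + 3) * (2 * L - 1) * (L + 1) / 12 * y ^ 4 =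
       y ^ 3 * ((1 / 20 + (L + 1) / 15) * (y * L) + (2 * L - 1) * (L + 1) / 12 * (y * (2 * L + 3)))"
      by (simp add: field_simps power3_eq_cube power4_eq_xxxx)
    also have "\<dots> \<le> y ^ 3 * ((1 / 20 + (L + 1) / 15) * 2 + (2 * L - 1) * (L + 1) / 12 * 4)"
      using L yL yL' y3 by (intro mult_left_mono add_mono) auto
    also have "\<dots> \<le> y ^ 3 * ((4 * L + 7) * (2 * L + 1) / 12)"
      using L y3 by (intro mult_left_mono) (auto simp: field_simps)
    finally show ?thesis by (simp add: mult_ac)
  qed
  moreover have "0 \<le> (2 * L + 3) * (2 * L + 1) * (L + 1) * L / 18 * y ^ 5" using L y3 by simp
  ultimately show ?thesis unfolding L_def[symmetric] by linarith
qed

section \<open>Fourier transform and Plancherel's identity\<close>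

lemma borel_measurable_cis [measurable (raw)]:
  "f \<in> borel_measurable M \<Longrightarrow> (\<lambda>x. cis (f x)) \<in> borel_measurable M"
  by (rule measurable_compose[OF _ borel_measurable_continuous_onI]) (auto intro!: continuous_intros)

text \<open>\<open>lborel\<close> is the image of the product of one-dimensional Lebesgue measures
  under the coordinate map, so Fubini's theorem for finite products applies.\<close>

lemma
  fixes h :: "'a::euclidean_space \<Rightarrow> real \<Rightarrow> complex"
  assumes h: "\<And>b. b \<in> Basis \<Longrightarrow> integrable lborel (h b)"
  shows integrable_lborel_prod: "integrable lborel (\<lambda>x. \<Prod>b\<in>Basis. h b (x \<bullet> b))"
    and integral_lborel_prod:
      "(LBINT x. (\<Prod>b\<in>Basis. h b (x \<bullet> b))) = (\<Prod>b\<in>Basis. integral\<^sup>L lborel (h b))"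
proof -
  interpret product_sigma_finite "\<lambda>_. lborel :: real measure" ..
  have [measurable]: "h b \<in> borel_measurable borel" if "b \<in> Basis" for b
    using borel_measurable_integrable[OF h[OF that]] by simp
  have m: "(\<lambda>f. \<Sum>b\<in>Basis. f b *\<^sub>R b) \<in> (\<Pi>\<^sub>M b\<in>Basis. lborel) \<rightarrow>\<^sub>M (borel :: 'a measure)"
    by measurable
  have eq: "(\<Prod>b\<in>Basis. h b ((\<Sum>c\<in>Basis. f c *\<^sub>R c) \<bullet> b)) = (\<Prod>b\<in>Basis. h b (f b))" for f :: "'a \<Rightarrow> real"
    by (intro prod.cong) simp_all
  show "integrable lborel (\<lambda>x. \<Prod>b\<in>Basis. h b (x \<bullet> b))"
    by (subst lborel_eq, subst integrable_distr_eq[OF m])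
       (auto simp: eq intro!: product_integrable_prod h)
  show "(LBINT x. (\<Prod>b\<in>Basis. h b (x \<bullet> b))) = (\<Prod>b\<in>Basis. integral\<^sup>L lborel (h b))"
    by (subst lborel_eq, subst integral_distr[OF m])
       (auto simp: eq intro!: product_integral_prod h)
qed

text \<open>Up to the factor \<open>sqrt (2 * pi)\<close> this is the characteristic function of the
  standard normal distribution.\<close>

lemma
  fixes t :: real
  shows integrable_gaussian_cis: "integrable lborel (\<lambda>x. of_real (exp (- x\<^sup>2 / 2)) * cis (t * x))"
    and integral_gaussian_cis:
      "(LBINT x. of_real (exp (- x\<^sup>2 / 2)) * cis (t * x)) = of_real (sqrt (2 * pi) * exp (- t\<^sup>2 / 2))"
proof -
  have d: "std_normal_density x = exp (- x\<^sup>2 / 2) / sqrt (2 * pi)" for x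
    by (simp add: std_normal_density_def)
  interpret prob_space std_normal_distribution
    by (rule prob_space_normal_density) simp
  have "integrable std_normal_distribution (\<lambda>x. cis (t * x))"
    by (rule integrable_const_bound[where B = 1]) auto
  then have "integrable lborel (\<lambda>x. std_normal_density x *\<^sub>R cis (t * x))"
    by (subst (asm) integrable_density) auto
  then have "integrable lborel (\<lambda>x. of_real (sqrt (2 * pi)) * (std_normal_density x *\<^sub>R cis (t * x)))"
    by (rule integrable_mult_right)
  also have eq: "(\<lambda>x. of_real (sqrt (2 * pi)) * (std_normal_density x *\<^sub>R cis (t * x))) =
      (\<lambda>x. of_real (exp (- x\<^sup>2 / 2)) * cis (t * x))"
    by (simp add: d scaleR_conv_of_real fun_eq_iff)
  finally show "integrable lborel (\<lambda>x. of_real (exp (- x\<^sup>2 / 2)) * cis (t * x))" .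
  have "(LBINT x. of_real (sqrt (2 * pi)) * (std_normal_density x *\<^sub>R cis (t * x))) =
      of_real (sqrt (2 * pi)) * (\<integral>x. cis (t * x) \<partial>std_normal_distribution)"
    by (subst integral_density) (auto simp del: scaleR_conv_of_real mult_scaleR_right)
  also have "(\<integral>x. cis (t * x) \<partial>std_normal_distribution) = of_real (exp (- t\<^sup>2 / 2))"
    using fun_cong[OF char_std_normal_distribution, of t] by (simp add: char_def cis_conv_exp)
  finally show "(LBINT x. of_real (exp (- x\<^sup>2 / 2)) * cis (t * x)) = of_real (sqrt (2 * pi) * exp (- t\<^sup>2 / 2))"
    unfolding eq by simp
qed

lemma cis_sum: "finite A \<Longrightarrow> cis (\<Sum>a\<in>A. f a) = (\<Prod>a\<in>A. cis (f a))"
  by (induction A rule: finite_induct) (auto simp: cis_mult[symmetric])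

text \<open>Both the Gaussian and the character are products over the coordinates.\<close>

lemma
  fixes x :: "'a::euclidean_space"
  shows integrable_gaussian_cis_inner:
      "integrable lborel (\<lambda>\<xi>. of_real (exp (- (norm \<xi>)\<^sup>2 / 2)) * cis (\<xi> \<bullet> x))"
    and integral_gaussian_cis_inner:
      "(LBINT \<xi>. of_real (exp (- (norm \<xi>)\<^sup>2 / 2)) * cis (\<xi> \<bullet> x)) =
        of_real (sqrt (2 * pi) ^ DIM('a) * exp (- (norm x)\<^sup>2 / 2))"
proof -
  let ?h = "\<lambda>b r. of_real (exp (- r\<^sup>2 / 2)) * cis ((x \<bullet> b) * r)"
  have n: "exp (- (norm y)\<^sup>2 / 2) = (\<Prod>b\<in>Basis. exp (- (y \<bullet> b)\<^sup>2 / 2))" for y :: 'a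
  proof -
    have "(norm y)\<^sup>2 = (\<Sum>b\<in>Basis. (y \<bullet> b)\<^sup>2)"
      unfolding power2_norm_eq_inner by (subst euclidean_inner) (simp add: power2_eq_square)
    then have "- (norm y)\<^sup>2 / 2 = (\<Sum>b\<in>Basis. - (y \<bullet> b)\<^sup>2 / 2)"
      by (simp add: sum_divide_distrib sum_negf)
    then show ?thesis by (simp only: exp_sum[OF finite_Basis])
  qed
  have "of_real (exp (- (norm \<xi>)\<^sup>2 / 2)) * cis (\<xi> \<bullet> x) = (\<Prod>b\<in>Basis. ?h b (\<xi> \<bullet> b))" for \<xi>
    unfolding n by (subst euclidean_inner) (simp only: cis_sum[OF finite_Basis] prod.distrib of_real_prod mult.commute)
  then have eq: "(\<lambda>\<xi>. of_real (exp (- (norm \<xi>)\<^sup>2 / 2)) * cis (\<xi> \<bullet> x)) = (\<lambda>\<xi>. \<Prod>b\<in>Basis. ?h b (\<xi> \<bullet> b))"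
    by (rule ext)
  show "integrable lborel (\<lambda>\<xi>. of_real (exp (- (norm \<xi>)\<^sup>2 / 2)) * cis (\<xi> \<bullet> x))"
    unfolding eq by (intro integrable_lborel_prod integrable_gaussian_cis)
  have "(LBINT \<xi>. of_real (exp (- (norm \<xi>)\<^sup>2 / 2)) * cis (\<xi> \<bullet> x)) =
      (\<Prod>b\<in>Basis. of_real (sqrt (2 * pi) * exp (- (x \<bullet> b)\<^sup>2 / 2)))"
    unfolding eq by (subst integral_lborel_prod[OF integrable_gaussian_cis]) (simp only: integral_gaussian_cis)
  also have "\<dots> = of_real (sqrt (2 * pi) ^ DIM('a) * exp (- (norm x)\<^sup>2 / 2))"
    unfolding n[of x] of_real_prod[symmetric] prod.distrib by (simp only: prod_constant)
  finally show "(LBINT \<xi>. of_real (exp (- (norm \<xi>)\<^sup>2 / 2)) * cis (\<xi> \<bullet> x)) =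
        of_real (sqrt (2 * pi) ^ DIM('a) * exp (- (norm x)\<^sup>2 / 2))" .
qed

lemma integral_lborel_affine:
  fixes f :: "'a::euclidean_space \<Rightarrow> 'b::{banach, second_countable_topology}"
  assumes [measurable]: "f \<in> borel_measurable borel" and c: "c \<noteq> 0"
  shows "(LBINT x. f x) = \<bar>c\<bar> ^ DIM('a) *\<^sub>R (LBINT x. f (t + c *\<^sub>R x))"
proof -
  have "(LBINT x. f x) =
      (\<integral>x. f x \<partial>(density (distr lborel borel (\<lambda>x. t + c *\<^sub>R x)) (\<lambda>_. \<bar>c\<bar>^DIM('a))))"
    using lborel_affine[OF c, of t] by simp
  also have "\<dots> = \<bar>c\<bar> ^ DIM('a) *\<^sub>R (LBINT x. f (t + c *\<^sub>R x))"
    by (subst integral_density) (auto simp: integral_distr)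
  finally show ?thesis .
qed

text \<open>Without a normalising factor, so Plancherel's identity carries
  \<open>(2 * pi) ^ DIM('a)\<close>. The measure is \<open>lebesgue\<close> because eigenfunctions
  are only Lebesgue measurable; on Borel functions it may be exchanged for
  \<open>lborel\<close>.\<close>

definition fourier :: "('a::euclidean_space \<Rightarrow> complex) \<Rightarrow> 'a \<Rightarrow> complex" where
  "fourier f \<xi> = (\<integral>x. f x * cis (- (\<xi> \<bullet> x)) \<partial>lebesgue)"

lemma fourier_lborel:
  "f \<in> borel_measurable borel \<Longrightarrow> fourier f \<xi> = (LBINT x. f x * cis (- (\<xi> \<bullet> x)))"
  unfolding fourier_def by (rule integral_completion) simp

lemma integrable_mult_cis:
  assumes "integrable M f" "g \<in> borel_measurable M"
  shows "integrable M (\<lambda>x. f x * cis (g x))"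
  by (rule Bochner_Integration.integrable_bound[OF assms(1)])
     (use assms in \<open>auto simp: norm_mult\<close>)

text \<open>Fubini's theorem for the kernel
  \<open>f \<xi> * g x * cis (- (\<xi> \<bullet> x))\<close>, which is absolutely integrable on the
  product space. It moves the transform from one factor to the other.\<close>

lemma fourier_multiplication_formula:
  fixes f g :: "'a::euclidean_space \<Rightarrow> complex"
  assumes f: "integrable lborel f" and g: "integrable lborel g"
  shows "(LBINT \<xi>. f \<xi> * fourier g \<xi>) = (LBINT x. fourier f x * g x)"
proof -
  have [measurable]: "f \<in> borel_measurable borel" "g \<in> borel_measurable borel"
    using f g by (auto dest: borel_measurable_integrable)
  let ?F = "\<lambda>(\<xi>, x). f \<xi> * g x * cis (- (\<xi> \<bullet> x))"
  have int: "integrable (lborel \<Otimes>\<^sub>M lborel) ?F"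
  proof (rule lborel_pair.Fubini_integrable)
    show "?F \<in> borel_measurable (lborel \<Otimes>\<^sub>M lborel)"
      unfolding split_beta by measurable
    have "(\<lambda>\<xi>. \<integral>x. norm (?F (\<xi>, x)) \<partial>lborel) = (\<lambda>\<xi>. norm (f \<xi>) * (LBINT x. norm (g x)))"
      by (simp add: norm_mult)
    then show "integrable lborel (\<lambda>\<xi>. \<integral>x. norm (?F (\<xi>, x)) \<partial>lborel)"
      using f by simp
    show "AE \<xi> in lborel. integrable lborel (\<lambda>x. ?F (\<xi>, x))"
      using integrable_mult_cis[OF integrable_mult_right[OF g]] by simp
  qed
  have "(LBINT \<xi>. f \<xi> * fourier g \<xi>) = (LBINT \<xi>. (LBINT x. ?F (\<xi>, x)))"
    by (simp add: fourier_lborel mult.assoc)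
  also have "\<dots> = (LBINT x. (LBINT \<xi>. ?F (\<xi>, x)))"
    using lborel_pair.Fubini_integral[OF int] by simp
  also have "\<dots> = (LBINT x. fourier f x * g x)"
  proof (intro Bochner_Integration.integral_cong refl)
    fix x :: 'a
    have "(LBINT \<xi>. ?F (\<xi>, x)) = (LBINT \<xi>. (f \<xi> * cis (- (x \<bullet> \<xi>))) * g x)"
      by (simp add: inner_commute mult_ac)
    also have "\<dots> = fourier f x * g x" by (simp add: fourier_lborel)
    finally show "(LBINT \<xi>. ?F (\<xi>, x)) = fourier f x * g x" .
  qed
  finally show ?thesis .
qed

lemma continuous_compact_support:
  fixes \<phi> :: "'a::euclidean_space \<Rightarrow> real"
  assumes c: "continuous_on UNIV \<phi>" and K: "compact K" "\<And>x. x \<notin> K \<Longrightarrow> \<phi> x = 0"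
  shows "integrable lborel \<phi>" "\<exists>C>0. \<forall>x. \<bar>\<phi> x\<bar> \<le> C"
proof -
  have "integrable lborel (\<lambda>x. indicator K x *\<^sub>R \<phi> x)"
    using c by (intro borel_integrable_compact K) (auto intro: continuous_on_subset)
  also have "(\<lambda>x. indicator K x *\<^sub>R \<phi> x) = \<phi>" using K by (auto simp: indicator_def fun_eq_iff)
  finally show "integrable lborel \<phi>" .
  have "compact (\<phi> ` K)" by (intro compact_continuous_image continuous_on_subset[OF c] K subset_UNIV)
  then obtain C where "C > 0" "\<forall>y\<in>\<phi> ` K. norm y \<le> C"
    using compact_imp_bounded bounded_pos by blast
  then have "\<bar>\<phi> x\<bar> \<le> C" for x by (cases "x \<in> K") (auto simp: K(2))
  with \<open>C > 0\<close> show "\<exists>C>0. \<forall>x. \<bar>\<phi> x\<bar> \<le> C" by blast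
qed

lemma norm_fourier_le: "norm (fourier f \<xi>) \<le> (\<integral>x. norm (f x) \<partial>lebesgue)"
  unfolding fourier_def by (rule order_trans[OF integral_norm_bound]) (simp add: norm_mult)

lemma continuous_on_fourier:
  assumes "integrable lebesgue f"
  shows "continuous_on UNIV (fourier f)"
proof -
  have [measurable]: "f \<in> borel_measurable lebesgue" using assms by simp
  have [measurable]: "(\<lambda>x. \<xi> \<bullet> x) \<in> borel_measurable lebesgue" for \<xi> :: 'a
    by (rule measurable_completion) simp
  have "(\<lambda>n. fourier f (x n)) \<longlonglongrightarrow> fourier f a" if "x \<longlonglongrightarrow> a" for x :: "nat \<Rightarrow> 'a" and a
    unfolding fourier_def
  proof (rule integral_dominated_convergence[where w = "\<lambda>x. norm (f x)"])
    show "AE y in lebesgue. (\<lambda>n. f y * cis (- (x n \<bullet> y))) \<longlonglongrightarrow> f y * cis (- (a \<bullet> y))"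
      using that by (intro AE_I2 tendsto_intros)
  qed (use assms in \<open>auto simp: norm_mult\<close>)
  then show ?thesis by (auto simp: continuous_on_sequentially o_def)
qed

lemma fourier_minus_real:
  "fourier (\<lambda>x. complex_of_real (u x)) (- \<xi>) = cnj (fourier (\<lambda>x. complex_of_real (u x)) \<xi>)"
  unfolding fourier_def by (subst Bochner_Integration.integral_cnj[symmetric]) (simp add: cis_cnj)

lemma integrable_lborel_affine:
  fixes f :: "'a::euclidean_space \<Rightarrow> 'b::{banach, second_countable_topology}"
  assumes f: "integrable lborel f" and c: "c \<noteq> 0"
  shows "integrable lborel (\<lambda>x. f (t + c *\<^sub>R x))"
proof -
  have [measurable]: "f \<in> borel_measurable borel" using f by (auto dest: borel_measurable_integrable)
  have "integrable (density (distr lborel borel (\<lambda>x. t + c *\<^sub>R x)) (\<lambda>_. \<bar>c\<bar>^DIM('a))) f"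
    using f lborel_affine[OF c, of t] by simp
  then have "integrable lborel (\<lambda>x. \<bar>c\<bar>^DIM('a) *\<^sub>R f (t + c *\<^sub>R x))"
    by (subst (asm) integrable_density) (auto simp: integrable_distr_eq)
  from integrable_scaleR_right[OF this, of "inverse (\<bar>c\<bar>^DIM('a))"] show ?thesis
    using c by simp
qed

text \<open>Plancherel's identity is obtained by inserting a Gaussian factor that tends to 1: its Fourier
  transform is an approximate identity.\<close>

context
  fixes \<phi> :: "'a::euclidean_space \<Rightarrow> real" and K :: "'a set"
  assumes cont: "continuous_on UNIV \<phi>" and K: "compact K" "\<And>x. x \<notin> K \<Longrightarrow> \<phi> x = 0"
begin

private abbreviation "\<phi>hat \<equiv> fourier (\<lambda>x. complex_of_real (\<phi> x))"

private lemma [measurable]: "\<phi> \<in> borel_measurable borel"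
  using cont by (rule borel_measurable_continuous_onI)

private lemma int: "integrable lborel \<phi>"
  using continuous_compact_support[OF cont K] by blast

private lemma [measurable]: "\<phi>hat \<in> borel_measurable borel"
  by (intro borel_measurable_continuous_onI continuous_on_fourier)
     (use int in \<open>simp add: integrable_completion\<close>)

text \<open>Inverting the transform with a Gaussian damping of width \<open>1 / s\<close> averages
  \<phi> over a Gaussian of width \<open>s\<close> around \<open>x\<close>. The multiplication
  formula puts the transform on the damped character, and the substitution by
  \<open>x + s *\<^sub>R w\<close> cancels the powers of \<open>s\<close>.\<close>

lemma gaussian_regularisation:
  assumes s: "s > 0"
  shows "(LBINT \<xi>. of_real (exp (- (norm (s *\<^sub>R \<xi>))\<^sup>2 / 2)) * cis (\<xi> \<bullet> x) * \<phi>hat \<xi>) =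
    of_real (sqrt (2 * pi) ^ DIM('a) * (LBINT w. exp (- (norm w)\<^sup>2 / 2) * \<phi> (x + s *\<^sub>R w)))"
proof -
  let ?G = "\<lambda>z \<xi>. of_real (exp (- (norm \<xi>)\<^sup>2 / 2)) * cis (\<xi> \<bullet> z)"
  let ?f = "\<lambda>\<xi>. of_real (exp (- (norm (s *\<^sub>R \<xi>))\<^sup>2 / 2)) * cis (\<xi> \<bullet> x)"
  have f: "?f = (\<lambda>\<xi>. ?G (x /\<^sub>R s) (0 + s *\<^sub>R \<xi>))"
    using s by (simp add: fun_eq_iff mult.assoc[symmetric])
  have "integrable lborel ?f"
    unfolding f using s by (intro integrable_lborel_affine integrable_gaussian_cis_inner) simp
  then have "(LBINT \<xi>. ?f \<xi> * \<phi>hat \<xi>) = (LBINT y. fourier ?f y * of_real (\<phi> y))"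
    using int by (intro fourier_multiplication_formula) auto
  also have "\<dots> = \<bar>s\<bar> ^ DIM('a) *\<^sub>R (LBINT w. fourier ?f (x + s *\<^sub>R w) * of_real (\<phi> (x + s *\<^sub>R w)))"
    using s \<open>integrable lborel ?f\<close>
    by (intro integral_lborel_affine borel_measurable_times borel_measurable_continuous_onI continuous_on_fourier)
       (auto simp: integrable_completion cont)
  also have "\<dots> = (LBINT w. of_real (sqrt (2 * pi) ^ DIM('a) * (exp (- (norm w)\<^sup>2 / 2) * \<phi> (x + s *\<^sub>R w))))"
  proof -
    have "\<bar>s\<bar> ^ DIM('a) *\<^sub>R fourier ?f (x + s *\<^sub>R w) = of_real (sqrt (2 * pi) ^ DIM('a) * exp (- (norm w)\<^sup>2 / 2))" for w
    proof -
      have "fourier ?f (x + s *\<^sub>R w) = (LBINT \<xi>. ?G (- w) (0 + s *\<^sub>R \<xi>))"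
      proof (subst fourier_lborel)
        \<comment> \<open>The character at \<open>x\<close> cancels the centre of the substitution,
          so only the displacement \<open>w\<close> is left.\<close>
        have "cis (\<xi> \<bullet> x) * cis (- ((x + s *\<^sub>R w) \<bullet> \<xi>)) = cis ((0 + s *\<^sub>R \<xi>) \<bullet> - w)" for \<xi>
          by (simp add: cis_mult inner_add_left inner_add_right inner_commute)
        then show "(LBINT \<xi>. ?f \<xi> * cis (- ((x + s *\<^sub>R w) \<bullet> \<xi>))) = (LBINT \<xi>. ?G (- w) (0 + s *\<^sub>R \<xi>))"
          by (simp only: mult.assoc add_0_left)
      qed measurable
      then have "\<bar>s\<bar> ^ DIM('a) *\<^sub>R fourier ?f (x + s *\<^sub>R w) = (LBINT \<xi>. ?G (- w) \<xi>)"
        using integral_lborel_affine[of "?G (- w)" s 0] s by simp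
      also have "\<dots> = of_real (sqrt (2 * pi) ^ DIM('a) * exp (- (norm w)\<^sup>2 / 2))"
        by (subst integral_gaussian_cis_inner) simp
      finally show ?thesis .
    qed
    then show ?thesis
      by (subst integral_scaleR_right[symmetric]) (simp only: mult_scaleR_left[symmetric] of_real_mult mult.assoc)
  qed
  finally show ?thesis by (simp only: integral_complex_of_real Bochner_Integration.integral_mult_right_zero)
qed

text \<open>For each damping the squared transform has integral \<open>c * J m x * \<phi> x\<close>
  integrated over \<open>x\<close>, where \<open>J m\<close> is a mollification of \<phi>. Dominated
  convergence gives the limit of these numbers, and monotone convergence then yields integrability
  of the undamped square together with its integral.\<close>

lemma plancherel_compact_support:
  "has_bochner_integral lborel (\<lambda>\<xi>. (norm (\<phi>hat \<xi>))\<^sup>2) ((2 * pi) ^ DIM('a) * (LBINT x. (\<phi> x)\<^sup>2))"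
proof -
  obtain C where C: "C > 0" "\<And>x. \<bar>\<phi> x\<bar> \<le> C" using continuous_compact_support[OF cont K] by blast
  define s where "s = (\<lambda>m::nat. 1 / real (Suc m))"
  have s: "s m > 0" for m by (simp add: s_def)
  define c where "c = sqrt (2 * pi) ^ DIM('a)"
  have c2: "c * c = (2 * pi) ^ DIM('a)" unfolding c_def power_mult_distrib[symmetric] by simp
  define J where "J = (\<lambda>m x. \<integral>w. exp (- (norm w)\<^sup>2 / 2) * \<phi> (x + s m *\<^sub>R w) \<partial>lborel)"
  let ?g = "\<lambda>w::'a. exp (- (norm w)\<^sup>2 / 2)"
  have g: "integrable lborel ?g"
    using integrable_norm[OF integrable_gaussian_cis_inner[of "0::'a"]] by simp
  have "(LBINT w. complex_of_real (?g w)) = of_real c"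
    using integral_gaussian_cis_inner[of "0::'a"] by (simp add: c_def)
  then have gc: "(LBINT w. ?g w) = c" by (simp add: integral_complex_of_real)
  have c0: "c \<ge> 0" by (simp add: c_def)
  have int_sg: "integrable lborel (\<lambda>\<xi>::'a. ?g (s m *\<^sub>R \<xi>))" for m
    using integrable_lborel_affine[OF g, of "s m" 0] s[of m] by simp
  have bd: "norm (\<phi>hat \<xi>) \<le> (\<integral>x. norm (complex_of_real (\<phi> x)) \<partial>lebesgue)" for \<xi>
    by (rule norm_fourier_le)
  define B where "B = (\<integral>x. norm (complex_of_real (\<phi> x)) \<partial>lebesgue)"
  have B: "norm (\<phi>hat \<xi>) \<le> B" "0 \<le> B" for \<xi> using bd by (auto simp: B_def)
  have int_m: "integrable lborel (\<lambda>\<xi>. ?g (s m *\<^sub>R \<xi>) * (norm (\<phi>hat \<xi>))\<^sup>2)" for m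
  proof (rule Bochner_Integration.integrable_bound[OF integrable_mult_left[OF int_sg[of m], of "B\<^sup>2"]])
    show "AE \<xi> in lborel. norm (?g (s m *\<^sub>R \<xi>) * (norm (\<phi>hat \<xi>))\<^sup>2) \<le> norm (?g (s m *\<^sub>R \<xi>) * B\<^sup>2)"
      using B by (auto intro!: AE_I2 mult_left_mono power_mono simp: abs_mult)
  qed measurable
  have key: "(LBINT \<xi>. ?g (s m *\<^sub>R \<xi>) * (norm (\<phi>hat \<xi>))\<^sup>2) = (LBINT x. c * J m x * \<phi> x)" for m
  proof -
    \<comment> \<open>Because \<phi> is real, the squared modulus is
      \<open>\<phi>hat (- \<xi>) * \<phi>hat \<xi>\<close>, a product without conjugation to which
      the multiplication formula applies.\<close>
    let ?f = "\<lambda>\<xi>. of_real (?g (s m *\<^sub>R \<xi>)) * \<phi>hat (- \<xi>)"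
    have intf: "integrable lborel ?f"
    proof (rule Bochner_Integration.integrable_bound[OF integrable_mult_left[OF int_sg[of m], of B]])
      show "AE \<xi> in lborel. norm (?f \<xi>) \<le> norm (?g (s m *\<^sub>R \<xi>) * B)"
        using B by (auto intro!: AE_I2 mult_left_mono simp: abs_mult norm_mult)
    qed measurable
    have "complex_of_real (LBINT \<xi>. ?g (s m *\<^sub>R \<xi>) * (norm (\<phi>hat \<xi>))\<^sup>2) =
        (LBINT \<xi>. of_real (?g (s m *\<^sub>R \<xi>)) * (\<phi>hat (- \<xi>) * \<phi>hat \<xi>))"
      unfolding fourier_minus_real
      by (simp only: integral_complex_of_real[symmetric] of_real_mult mult.commute[of "cnj _"] complex_norm_square)
    also have "\<dots> = (LBINT x. fourier ?f x * of_real (\<phi> x))"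
      using fourier_multiplication_formula[OF intf, of "\<lambda>x. of_real (\<phi> x)"] int by (simp add: mult.assoc)
    also have "(\<lambda>x. fourier ?f x) = (\<lambda>x. of_real (c * J m x))"
    proof
      fix x
      have "fourier ?f x = (LBINT \<xi>. ?f \<xi> * cis (- (x \<bullet> \<xi>)))" by (rule fourier_lborel) measurable
      \<comment> \<open>Reflection in the origin turns the forward transform into the inverse one
        treated in \<open>gaussian_regularisation\<close>.\<close>
      also have "\<dots> = \<bar>-1\<bar> ^ DIM('a) *\<^sub>R (LBINT \<xi>. ?f (0 + (- 1) *\<^sub>R \<xi>) * cis (- (x \<bullet> (0 + (- 1) *\<^sub>R \<xi>))))"
        by (rule integral_lborel_affine) measurable
      also have "\<dots> = (LBINT \<xi>. of_real (exp (- (norm (s m *\<^sub>R \<xi>))\<^sup>2 / 2)) * cis (\<xi> \<bullet> x) * \<phi>hat \<xi>)"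
        by (simp add: mult_ac inner_commute)
      also have "\<dots> = of_real (c * J m x)"
        unfolding c_def J_def by (rule gaussian_regularisation[OF s])
      finally show "fourier ?f x = of_real (c * J m x)" .
    qed
    finally show ?thesis
      by (simp only: of_real_mult[symmetric] integral_complex_of_real of_real_eq_iff)
  qed
  have Jlim: "(\<lambda>m. J m x) \<longlonglongrightarrow> c * \<phi> x" for x
  proof -
    have "(\<lambda>m. J m x) \<longlonglongrightarrow> (LBINT w. ?g w * \<phi> x)"
      unfolding J_def
    proof (rule integral_dominated_convergence[where w = "\<lambda>w. ?g w * C"])
      have "s \<longlonglongrightarrow> 0" unfolding s_def by (rule LIMSEQ_Suc[OF lim_1_over_n])
      then have "(\<lambda>m. x + s m *\<^sub>R w) \<longlonglongrightarrow> x" for w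
        by (auto intro!: tendsto_eq_intros)
      then show "AE w in lborel. (\<lambda>m. ?g w * \<phi> (x + s m *\<^sub>R w)) \<longlonglongrightarrow> ?g w * \<phi> x"
        using cont by (intro AE_I2 tendsto_intros isCont_tendsto_compose[where g = \<phi>])
          (auto simp: continuous_on_eq_continuous_at)
      show "AE w in lborel. norm (?g w * \<phi> (x + s m *\<^sub>R w)) \<le> ?g w * C" for m
        using C by (auto simp: abs_mult intro!: mult_left_mono)
    qed (use g in auto)
    then show ?thesis using gc by simp
  qed
  have [measurable]: "J m \<in> borel_measurable borel" for m
    unfolding J_def by measurable
  have Jbd: "\<bar>J m x\<bar> \<le> c * C" for m x
  proof -
    have "\<bar>J m x\<bar> \<le> (LBINT w. \<bar>?g w * \<phi> (x + s m *\<^sub>R w)\<bar>)" unfolding J_def by (rule integral_abs_bound)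
    also have "\<dots> \<le> (LBINT w. ?g w * C)"
      using g C by (intro integral_mono') (auto simp: abs_mult intro!: mult_left_mono)
    finally show ?thesis using gc by simp
  qed
  have "(\<lambda>m. \<integral>x. c * J m x * \<phi> x \<partial>lborel) \<longlonglongrightarrow> (LBINT x. c * (c * \<phi> x) * \<phi> x)"
  proof (rule integral_dominated_convergence[where w = "\<lambda>x. (c * (c * C)) * \<bar>\<phi> x\<bar>"])
    show "AE x in lborel. (\<lambda>m. c * J m x * \<phi> x) \<longlonglongrightarrow> c * (c * \<phi> x) * \<phi> x"
      by (intro AE_I2 tendsto_intros Jlim)
    show "AE x in lborel. norm (c * J m x * \<phi> x) \<le> (c * (c * C)) * \<bar>\<phi> x\<bar>" for m
      using Jbd c0 by (auto simp: abs_mult intro!: mult_right_mono mult_left_mono)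
  qed (use int in auto)
  also have "(LBINT x. c * (c * \<phi> x) * \<phi> x) = (2 * pi) ^ DIM('a) * (LBINT x. (\<phi> x)\<^sup>2)"
    by (simp add: c2 power2_eq_square mult.assoc flip: integral_mult_right_zero) (simp add: c2 flip: mult.assoc)
  finally have lim: "(\<lambda>m. \<integral>\<xi>. ?g (s m *\<^sub>R \<xi>) * (norm (\<phi>hat \<xi>))\<^sup>2 \<partial>lborel) \<longlonglongrightarrow>
      (2 * pi) ^ DIM('a) * (LBINT x. (\<phi> x)\<^sup>2)"
    by (simp only: key)
  show ?thesis
  proof (rule has_bochner_integral_monotone_convergence[OF int_m _ _ lim])
    \<comment> \<open>The widths \<open>s m\<close> decrease, so the damping factors increase with
      \<open>m\<close>.\<close>
    have "?g (s m *\<^sub>R \<xi>) \<le> ?g (s n *\<^sub>R \<xi>)" if "m \<le> n" for m n and \<xi> :: 'a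
    proof -
      have "s n \<le> s m" using that by (simp add: s_def field_simps)
      then have "norm (s n *\<^sub>R \<xi>) \<le> norm (s m *\<^sub>R \<xi>)" using s[of n] s[of m] by (simp add: mult_right_mono)
      then show ?thesis by (simp add: power_mono)
    qed
    then show "AE \<xi> in lborel. mono (\<lambda>m. ?g (s m *\<^sub>R \<xi>) * (norm (\<phi>hat \<xi>))\<^sup>2)"
      by (auto simp: mono_def intro!: mult_right_mono)
    have "s \<longlonglongrightarrow> 0" unfolding s_def by (rule LIMSEQ_Suc[OF lim_1_over_n])
    then show "AE \<xi> in lborel. (\<lambda>m. ?g (s m *\<^sub>R \<xi>) * (norm (\<phi>hat \<xi>))\<^sup>2) \<longlonglongrightarrow> (norm (\<phi>hat \<xi>))\<^sup>2"
      by (auto intro!: tendsto_eq_intros)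
  qed measurable
qed

end

section \<open>Test functions and their Fourier transforms\<close>

lemma pdiffs_Nil [simp]: "pdiffs [] f = f"
  and pdiffs_Cons: "pdiffs (i # is) f = pdiff i (pdiffs is f)"
  and pdiffs_append: "pdiffs (is @ js) f = pdiffs is (pdiffs js f)"
  by (simp_all add: pdiffs_def)

lemma smooth_pdiffs: "smooth f \<Longrightarrow> smooth (pdiffs is f)"
  unfolding smooth_def by (simp add: pdiffs_append[symmetric])

lemma smooth_differentiable: "smooth f \<Longrightarrow> f differentiable (at x)"
  unfolding smooth_def by (metis pdiffs_Nil)

lemma smooth_continuous: "smooth f \<Longrightarrow> continuous_on UNIV f"
  by (simp add: continuous_on_eq_continuous_at differentiable_imp_continuous_within smooth_differentiable)

lemma pdiff_lincomb:
  assumes "\<And>x. f differentiable (at x)" "\<And>x. g differentiable (at x)"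
  shows "pdiff i (\<lambda>x. a * f x + b * g x) = (\<lambda>x. a * pdiff i f x + b * pdiff i g x)"
proof
  fix x
  have "((\<lambda>x. a * f x + b * g x) has_derivative
      (\<lambda>h. a * frechet_derivative f (at x) h + b * frechet_derivative g (at x) h)) (at x)"
    using assms by (intro has_derivative_add has_derivative_mult_right) (simp_all add: frechet_derivative_works[symmetric])
  from frechet_derivative_at[OF this] show "pdiff i (\<lambda>x. a * f x + b * g x) x = a * pdiff i f x + b * pdiff i g x"
    by (simp add: pdiff_def fun_eq_iff)
qed

lemma pdiffs_lincomb:
  assumes "smooth f" "smooth g"
  shows "pdiffs is (\<lambda>x. a * f x + b * g x) = (\<lambda>x. a * pdiffs is f x + b * pdiffs is g x)"
  by (induction "is")
     (simp_all add: pdiffs_Cons pdiff_lincomb smooth_differentiable[OF smooth_pdiffs] assms)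

lemma smooth_lincomb:
  assumes "smooth f" "smooth g"
  shows "smooth (\<lambda>x. a * f x + b * g x)"
  unfolding smooth_def pdiffs_lincomb[OF assms]
  by (intro allI derivative_intros smooth_differentiable[OF smooth_pdiffs] assms)

lemma pdiff_const_0: "pdiff i (\<lambda>x. 0) = (\<lambda>x. 0)"
  by (simp add: pdiff_def fun_eq_iff)

lemma smooth_0: "smooth (\<lambda>x. 0)"
proof -
  have "pdiffs is (\<lambda>x. 0) = (\<lambda>x. 0)" for "is" :: "'a list"
    by (induction "is") (simp_all add: pdiffs_Cons pdiff_const_0)
  then show ?thesis by (simp add: smooth_def)
qed

lemma test_functions_0: "(\<lambda>x. 0) \<in> test_functions S"
  unfolding test_functions_def by (auto simp: smooth_0 intro!: exI[of _ "{}"])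

lemma test_functions_lincomb:
  assumes "\<phi> \<in> test_functions S" "\<psi> \<in> test_functions S"
  shows "(\<lambda>x. a * \<phi> x + b * \<psi> x) \<in> test_functions S"
proof -
  obtain K L where "compact K" "K \<subseteq> S" "\<forall>x. x \<notin> K \<longrightarrow> \<phi> x = 0" "compact L" "L \<subseteq> S" "\<forall>x. x \<notin> L \<longrightarrow> \<psi> x = 0"
    using assms by (auto simp: test_functions_def)
  then show ?thesis
    using assms by (auto simp: test_functions_def smooth_lincomb intro!: exI[of _ "K \<union> L"])
qed

lemma test_functions_sum:
  assumes "finite A" "\<And>a. a \<in> A \<Longrightarrow> \<phi> a \<in> test_functions S"
  shows "(\<lambda>x. \<Sum>a\<in>A. \<phi> a x) \<in> test_functions S"
  using assms
proof (induction A rule: finite_induct)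
  case empty
  then show ?case by (simp add: test_functions_0)
next
  case (insert a A)
  then show ?case using test_functions_lincomb[of "\<phi> a" S "\<lambda>x. \<Sum>a\<in>A. \<phi> a x" 1 1] by simp
qed

lemma pdiff_eq_0_outside:
  assumes "closed K" "\<And>x. x \<notin> K \<Longrightarrow> \<phi> x = 0" "x \<notin> K"
  shows "pdiff i \<phi> x = 0"
proof -
  have "(\<phi> has_derivative (\<lambda>h. 0)) (at x)"
    by (rule has_derivative_transform_within_open[where f = "\<lambda>x. 0" and s = "- K"]) (use assms in auto)
  from frechet_derivative_at[OF this] show ?thesis by (simp add: pdiff_def fun_eq_iff)
qed

lemma pdiffs_eq_0_outside:
  assumes "closed K" "\<And>x. x \<notin> K \<Longrightarrow> \<phi> x = 0" "x \<notin> K"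
  shows "pdiffs is \<phi> x = 0"
  using assms(3)
proof (induction "is" arbitrary: x)
  case (Cons i "is")
  show ?case unfolding pdiffs_Cons by (rule pdiff_eq_0_outside[OF assms(1)]) (use Cons in auto)
qed (use assms in simp)

lemma test_functions_pdiffs:
  assumes "\<phi> \<in> test_functions S"
  shows "pdiffs is \<phi> \<in> test_functions S"
proof -
  obtain K where "compact K" "K \<subseteq> S" "\<And>x. x \<notin> K \<Longrightarrow> \<phi> x = 0"
    using assms by (auto simp: test_functions_def)
  moreover from this have "\<forall>x. x \<notin> K \<longrightarrow> pdiffs is \<phi> x = 0"
    using pdiffs_eq_0_outside compact_imp_closed by blast
  ultimately show ?thesis using assms by (auto simp: test_functions_def smooth_pdiffs)
qed

lemma test_functions_pdiff: "\<phi> \<in> test_functions S \<Longrightarrow> pdiff i \<phi> \<in> test_functions S"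
  using test_functions_pdiffs[of \<phi> S "[i]"] by (simp add: pdiffs_Cons)

lemma test_functions_neg_laplacian:
  assumes "\<phi> \<in> test_functions S"
  shows "(\<lambda>x. - laplacian \<phi> x) \<in> test_functions S"
proof -
  have "(\<lambda>x. \<Sum>i\<in>UNIV. pdiff i (pdiff i \<phi>) x) \<in> test_functions S"
    using assms by (intro test_functions_sum test_functions_pdiff) auto
  from test_functions_lincomb[OF this this, of "-1" 0] show ?thesis
    by (simp add: laplacian_def)
qed

lemma poly_laplacian_Suc: "poly_laplacian (Suc l) \<phi> = (\<lambda>x. - laplacian (poly_laplacian l \<phi>) x)"
  and poly_laplacian_0 [simp]: "poly_laplacian 0 \<phi> = \<phi>"
  by (simp_all add: poly_laplacian_def)

lemma test_functions_poly_laplacian: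
  "\<phi> \<in> test_functions S \<Longrightarrow> poly_laplacian l \<phi> \<in> test_functions S"
  by (induction l) (auto simp: poly_laplacian_Suc test_functions_neg_laplacian)

lemma test_functionsE:
  assumes "\<phi> \<in> test_functions S"
  obtains K where "continuous_on UNIV \<phi>" "compact K" "K \<subseteq> S" "\<And>x. x \<notin> K \<Longrightarrow> \<phi> x = 0"
  using assms smooth_continuous by (auto simp: test_functions_def)

lemma test_function_integrable:
  assumes "\<phi> \<in> test_functions S"
  shows "\<phi> \<in> borel_measurable borel" "integrable lborel \<phi>" "\<exists>C>0. \<forall>x. \<bar>\<phi> x\<bar> \<le> C"
  using test_functionsE[OF assms] continuous_compact_support
  by (metis borel_measurable_continuous_onI)+

lemma fourier_translate:
  assumes [measurable]: "f \<in> borel_measurable borel"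
  shows "fourier (\<lambda>x. f (x + a)) \<xi> = cis (\<xi> \<bullet> a) * fourier f \<xi>"
proof -
  have "fourier f \<xi> = (LBINT x. f (a + 1 *\<^sub>R x) * cis (- (\<xi> \<bullet> (a + 1 *\<^sub>R x))))"
    using integral_lborel_affine[of "\<lambda>x. f x * cis (- (\<xi> \<bullet> x))" 1 a] by (simp add: fourier_lborel)
  also have "\<dots> = (LBINT x. cis (- (\<xi> \<bullet> a)) * (f (x + a) * cis (- (\<xi> \<bullet> x))))"
  proof -
    have "cis (- (\<xi> \<bullet> (a + 1 *\<^sub>R x))) = cis (- (\<xi> \<bullet> a)) * cis (- (\<xi> \<bullet> x))" for x
      by (simp add: cis_mult inner_add_right)
    then show ?thesis by (simp add: add.commute mult.left_commute)
  qed
  also have "\<dots> = cis (- (\<xi> \<bullet> a)) * fourier (\<lambda>x. f (x + a)) \<xi>"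
    by (simp add: fourier_lborel)
  finally show ?thesis by (simp add: cis_mult mult.assoc[symmetric])
qed

lemma DERIV_along_axis:
  assumes "f differentiable (at (x + t *\<^sub>R axis i 1))"
  shows "((\<lambda>t. f (x + t *\<^sub>R axis i 1)) has_real_derivative pdiff i f (x + t *\<^sub>R axis i 1)) (at t)"
proof -
  let ?D = "frechet_derivative f (at (x + t *\<^sub>R axis i 1))"
  have "(f has_derivative ?D) (at (x + t *\<^sub>R axis i 1))" using assms by (simp add: frechet_derivative_works)
  moreover have "((\<lambda>t. x + t *\<^sub>R axis i 1) has_derivative (\<lambda>s. s *\<^sub>R axis i 1)) (at t)"
    by (auto intro!: derivative_eq_intros)
  ultimately have "((\<lambda>t. f (x + t *\<^sub>R axis i 1)) has_derivative (\<lambda>s. ?D (s *\<^sub>R axis i 1))) (at t)"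
    by (rule has_derivative_compose[rotated])
  moreover have "?D (s *\<^sub>R axis i 1) = pdiff i f (x + t *\<^sub>R axis i 1) * s" for s
    using linear_frechet_derivative[OF assms] by (simp add: linear_cmul pdiff_def mult.commute)
  ultimately show ?thesis by (simp add: has_field_derivative_def)
qed

text \<open>The transform of a difference quotient is known from \<open>fourier_translate\<close>.
  As the step tends to 0, its multiplier tends to the derivative of the exponential, while dominated
  convergence identifies the limit with the transform of the derivative.\<close>

lemma fourier_pdiff:
  assumes \<phi>: "\<phi> \<in> test_functions S"
  shows "fourier (\<lambda>x. complex_of_real (pdiff i \<phi> x)) \<xi> = \<i> * of_real (\<xi> $ i) * fourier (\<lambda>x. complex_of_real (\<phi> x)) \<xi>"
proof -
  let ?e = "axis i 1 :: real ^ 'a"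
  obtain K where K: "compact K" "\<And>x. x \<notin> K \<Longrightarrow> \<phi> x = 0" using test_functionsE[OF \<phi>] by metis
  obtain r where "\<forall>x\<in>K. norm x \<le> r" using compact_imp_bounded[OF K(1)] by (auto simp: bounded_iff)
  then have r: "K \<subseteq> cball 0 r" by auto
  obtain C where C: "C > 0" "\<And>x. \<bar>pdiff i \<phi> x\<bar> \<le> C"
    using test_function_integrable(3)[OF test_functions_pdiff[OF \<phi>]] by blast
  have diff: "\<phi> differentiable (at x)" for x
    using \<phi> by (simp add: test_functions_def smooth_differentiable)
  note [measurable] = test_function_integrable(1)[OF \<phi>] test_function_integrable(1)[OF test_functions_pdiff[OF \<phi>]]
  define h where "h = (\<lambda>n. 1 / real (Suc n))"
  have h: "0 < h n" "h n \<le> 1" for n by (auto simp: h_def)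
  have h0: "h \<longlonglongrightarrow> 0" unfolding h_def by (rule LIMSEQ_Suc[OF lim_1_over_n])
  have hlim: "filterlim h (at 0) sequentially"
    using h0 h by (auto simp: filterlim_at intro!: always_eventually less_imp_neq[THEN not_sym])
  define q where "q = (\<lambda>n x. (\<phi> (x + h n *\<^sub>R ?e) - \<phi> x) / h n)"
  have [measurable]: "q n \<in> borel_measurable borel" for n unfolding q_def by measurable
  have qb: "\<bar>q n x\<bar> \<le> C" for n x
  proof -
    \<comment> \<open>The mean value theorem bounds all difference quotients by the supremum of the
      derivative, uniformly in the step.\<close>
    have "\<exists>z>0. z < h n \<and> \<phi> (x + h n *\<^sub>R ?e) - \<phi> (x + 0 *\<^sub>R ?e) = (h n - 0) * pdiff i \<phi> (x + z *\<^sub>R ?e)"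
      by (rule MVT2) (use h diff in \<open>auto intro!: DERIV_along_axis\<close>)
    then obtain z where "q n x = pdiff i \<phi> (x + z *\<^sub>R ?e)" using h[of n] by (auto simp: q_def)
    then show ?thesis using C by simp
  qed
  \<comment> \<open>A shift by at most 1 keeps the supports in one ball, so the dominating function
    is integrable.\<close>
  have q0: "q n x = 0" if "x \<notin> cball 0 (r + 1)" for n x
  proof -
    have "x \<notin> K" using that r by auto
    moreover have "x + h n *\<^sub>R ?e \<notin> K"
    proof
      assume "x + h n *\<^sub>R ?e \<in> K"
      then have "norm (x + h n *\<^sub>R ?e) \<le> r" using r by auto
      moreover have "norm (h n *\<^sub>R ?e) \<le> 1" using h[of n] by simp
      ultimately have "norm x \<le> r + 1" using norm_triangle_ineq4[of "x + h n *\<^sub>R ?e" "h n *\<^sub>R ?e"] by simp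
      then show False using that by simp
    qed
    ultimately show ?thesis using K by (simp add: q_def)
  qed
  have fq: "fourier (\<lambda>x. complex_of_real (q n x)) \<xi> = (LBINT x. complex_of_real (q n x) * cis (- (\<xi> \<bullet> x)))" for n
    by (rule fourier_lborel) measurable
  have "(\<lambda>n. fourier (\<lambda>x. complex_of_real (q n x)) \<xi>) \<longlonglongrightarrow> fourier (\<lambda>x. complex_of_real (pdiff i \<phi> x)) \<xi>"
    unfolding fq
  proof (subst fourier_lborel, measurable, rule integral_dominated_convergence[where w = "\<lambda>x. C * indicator (cball 0 (r + 1)) x"])
    show "integrable lborel (\<lambda>x::real^'a. C * indicator (cball 0 (r + 1)) x)"
      by (intro integrable_mult_right integrable_real_indicator emeasure_bounded_finite bounded_cball) simp
    show "AE x in lborel. norm (complex_of_real (q n x) * cis (- (\<xi> \<bullet> x))) \<le> C * indicator (cball 0 (r + 1)) x" for n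
      using qb q0 C by (auto simp: norm_mult indicator_def)
    have "(\<lambda>n. q n x) \<longlonglongrightarrow> pdiff i \<phi> x" for x
    proof -
      have "((\<lambda>t. \<phi> (x + t *\<^sub>R ?e)) has_real_derivative pdiff i \<phi> (x + 0 *\<^sub>R ?e)) (at 0)"
        by (rule DERIV_along_axis) (simp add: diff)
      then have "((\<lambda>t. (\<phi> (x + (0 + t) *\<^sub>R ?e) - \<phi> (x + 0 *\<^sub>R ?e)) / t) \<longlongrightarrow> pdiff i \<phi> (x + 0 *\<^sub>R ?e)) (at 0)"
        by (simp add: DERIV_def)
      from filterlim_compose[OF this hlim] show ?thesis by (simp add: q_def)
    qed
    then show "AE x in lborel. (\<lambda>n. complex_of_real (q n x) * cis (- (\<xi> \<bullet> x))) \<longlonglongrightarrow> complex_of_real (pdiff i \<phi> x) * cis (- (\<xi> \<bullet> x))"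
      by (intro AE_I2 tendsto_intros)
  qed measurable
  moreover have "(\<lambda>n. fourier (\<lambda>x. complex_of_real (q n x)) \<xi>) \<longlonglongrightarrow> \<i> * of_real (\<xi> $ i) * fourier (\<lambda>x. complex_of_real (\<phi> x)) \<xi>"
  proof -
    have "fourier (\<lambda>x. complex_of_real (q n x)) \<xi> =
        (cis (h n * \<xi> $ i) - 1) / of_real (h n) * fourier (\<lambda>x. complex_of_real (\<phi> x)) \<xi>" for n
    proof -
      have int: "integrable lborel (\<lambda>x. complex_of_real (\<phi> x) * cis (- (\<xi> \<bullet> x)))"
        by (intro integrable_mult_cis integrable_of_real test_function_integrable(2)[OF \<phi>]) simp
      have "integrable lborel (\<lambda>x. complex_of_real (\<phi> (h n *\<^sub>R ?e + 1 *\<^sub>R x)))"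
        using integrable_lborel_affine[OF test_function_integrable(2)[OF \<phi>], of 1 "h n *\<^sub>R ?e"] by simp
      then have int2: "integrable lborel (\<lambda>x. complex_of_real (\<phi> (x + h n *\<^sub>R ?e)) * cis (- (\<xi> \<bullet> x)))"
        by (intro integrable_mult_cis) (simp_all add: add.commute)
      have "fourier (\<lambda>x. complex_of_real (q n x)) \<xi> =
         (fourier (\<lambda>x. complex_of_real (\<phi> (x + h n *\<^sub>R ?e))) \<xi> - fourier (\<lambda>x. complex_of_real (\<phi> x)) \<xi>) / of_real (h n)"
        using int int2 by (simp add: fourier_lborel q_def diff_divide_distrib left_diff_distrib)
      also have "fourier (\<lambda>x. complex_of_real (\<phi> (x + h n *\<^sub>R ?e))) \<xi> = cis (\<xi> \<bullet> (h n *\<^sub>R ?e)) * fourier (\<lambda>x. complex_of_real (\<phi> x)) \<xi>"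
        by (rule fourier_translate) measurable
      finally show ?thesis by (simp add: inner_axis left_diff_distrib)
    qed
    moreover have "(\<lambda>n. (cis (h n * \<xi> $ i) - 1) / of_real (h n)) \<longlonglongrightarrow> \<i> * of_real (\<xi> $ i)"
    proof -
      have "((\<lambda>z. exp (\<i> * (z * of_real (\<xi> $ i)))) has_field_derivative \<i> * of_real (\<xi> $ i)) (at 0)"
        by (auto intro!: derivative_eq_intros)
      then have "((\<lambda>z. (exp (\<i> * (z * of_real (\<xi> $ i))) - 1) / z) \<longlongrightarrow> \<i> * of_real (\<xi> $ i)) (at 0)"
        by (simp add: DERIV_def)
      moreover have "filterlim (\<lambda>n. complex_of_real (h n)) (at 0) sequentially"
        using tendsto_of_real[OF h0, where 'a=complex] h
        by (auto simp: filterlim_at intro!: always_eventually less_imp_neq[THEN not_sym])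
      ultimately have "(\<lambda>n. (exp (\<i> * (of_real (h n) * of_real (\<xi> $ i))) - 1) / of_real (h n)) \<longlonglongrightarrow> \<i> * of_real (\<xi> $ i)"
        by (rule filterlim_compose)
      then show ?thesis by (simp add: cis_conv_exp)
    qed
    ultimately show ?thesis by (simp only:) (intro tendsto_intros)
  qed
  ultimately show ?thesis by (rule LIMSEQ_unique)
qed

section \<open>Fourier multipliers of derivatives and the energy form on test functions\<close>

abbreviation rfourier :: "('a::euclidean_space \<Rightarrow> real) \<Rightarrow> 'a \<Rightarrow> complex" where
  "rfourier u \<equiv> fourier (\<lambda>x. complex_of_real (u x))"

lemma rfourier_pdiffs:
  assumes "\<phi> \<in> test_functions S"
  shows "rfourier (pdiffs is \<phi>) \<xi> = (\<Prod>i\<leftarrow>is. \<i> * of_real (\<xi> $ i)) * rfourier \<phi> \<xi>"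
  by (induction "is") (simp_all add: pdiffs_Cons fourier_pdiff[OF test_functions_pdiffs[OF assms]])

lemma rfourier_sum:
  assumes "finite A" "\<And>a. a \<in> A \<Longrightarrow> integrable lborel (u a)"
  shows "rfourier (\<lambda>x. \<Sum>a\<in>A. c a * u a x) \<xi> = (\<Sum>a\<in>A. of_real (c a) * rfourier (u a) \<xi>)"
proof -
  have [measurable]: "u a \<in> borel_measurable borel" if "a \<in> A" for a
    using assms(2)[OF that] by (auto dest: borel_measurable_integrable)
  have "integrable lborel (\<lambda>x. of_real (c a) * (of_real (u a x) * cis (- (\<xi> \<bullet> x))))" if "a \<in> A" for a
    by (intro integrable_mult_right integrable_mult_cis integrable_of_real assms that) simp
  then show ?thesis
    by (simp add: fourier_lborel sum_distrib_right mult.assoc Bochner_Integration.integral_sum)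
qed

lemma rfourier_lincomb:
  assumes "integrable lborel u" "integrable lborel w"
  shows "rfourier (\<lambda>x. a * u x + b * w x) \<xi> = of_real a * rfourier u \<xi> + of_real b * rfourier w \<xi>"
  using rfourier_sum[of "UNIV :: bool set" "\<lambda>b. if b then u else w" "\<lambda>c. if c then a else b" \<xi>] assms
  by (simp add: UNIV_bool add.commute)

lemma rfourier_poly_laplacian:
  fixes \<phi> :: "real^'n::finite \<Rightarrow> real"
  assumes \<phi>: "\<phi> \<in> test_functions S"
  shows "rfourier (poly_laplacian l \<phi>) \<xi> = of_real (norm \<xi> ^ (2 * l)) * rfourier \<phi> \<xi>"
proof (induction l)
  case (Suc l)
  let ?\<psi> = "poly_laplacian l \<phi>"
  have \<psi>: "?\<psi> \<in> test_functions S" using \<phi> by (rule test_functions_poly_laplacian)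
  have "rfourier (poly_laplacian (Suc l) \<phi>) \<xi> = rfourier (\<lambda>x. \<Sum>i\<in>UNIV. (- 1) * pdiff i (pdiff i ?\<psi>) x) \<xi>"
    by (simp add: poly_laplacian_Suc laplacian_def sum_negf)
  also have "\<dots> = (\<Sum>i\<in>UNIV. of_real (- 1) * rfourier (pdiff i (pdiff i ?\<psi>)) \<xi>)"
    by (rule rfourier_sum) (auto intro!: test_function_integrable test_functions_pdiff \<psi>)
  also have "\<dots> = (\<Sum>i\<in>UNIV. of_real ((\<xi> $ i)\<^sup>2)) * rfourier ?\<psi> \<xi>"
    unfolding sum_distrib_right
    by (intro sum.cong) (simp_all add: fourier_pdiff[OF \<psi>] fourier_pdiff[OF test_functions_pdiff[OF \<psi>]] power2_eq_square mult_ac)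
  also have "(\<Sum>i\<in>UNIV. complex_of_real ((\<xi> $ i)\<^sup>2)) = of_real ((norm \<xi>)\<^sup>2)"
    by (simp add: norm_vec_def L2_set_def sum_nonneg)
  finally show ?case by (simp add: Suc power_mult[symmetric] power_add power2_eq_square)
qed simp

text \<open>A multi-index of order \<open>l\<close> is represented by as many words as its
  multinomial coefficient counts. With this multiplicity the squared symbols of the derivatives add
  up to \<open>norm \<xi> ^ (2 * l)\<close> without further weights.\<close>

definition words :: "nat \<Rightarrow> 'n::finite list set" where
  "words l = {is. length is = l}"

lemma finite_words [simp]: "finite (words l :: 'n::finite list set)"
  using finite_lists_length_eq[of "UNIV :: 'n set" l] by (simp add: words_def)

lemma sum_words_Suc:
  fixes F :: "'n::finite list \<Rightarrow> 'b::comm_monoid_add"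
  shows "(\<Sum>is\<in>words (Suc l). F is) = (\<Sum>i\<in>UNIV. \<Sum>is\<in>words l. F (i # is))"
proof -
  have "words (Suc l) = (\<lambda>(i, is). i # is) ` (UNIV \<times> words l :: ('n \<times> 'n list) set)"
    by (auto simp: words_def length_Suc_conv image_def)
  moreover have "inj_on (\<lambda>(i, is). i # is) (UNIV \<times> words l :: ('n \<times> 'n list) set)" by (auto simp: inj_on_def)
  ultimately have "(\<Sum>is\<in>words (Suc l). F is) = (\<Sum>z\<in>UNIV \<times> words l. F (case z of (i, is) \<Rightarrow> i # is))"
    by (simp only: sum.reindex o_def)
  then show ?thesis by (simp add: sum.cartesian_product split_beta)
qed

text \<open>The power \<open>((norm \<xi>)\<^sup>2) ^ l\<close>, expanded without collecting equal
  monomials: one summand per word.\<close>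

lemma sum_words_prod_sq:
  fixes \<xi> :: "real^'n::finite"
  shows "(\<Sum>is\<in>words l. (\<Prod>i\<leftarrow>is. (\<xi> $ i)\<^sup>2)) = norm \<xi> ^ (2 * l)"
proof (induction l)
  case 0
  have "words 0 = {[] :: 'n list}" by (auto simp: words_def)
  then show ?case by simp
next
  case (Suc l)
  have "(\<Sum>i\<in>UNIV. (\<xi> $ i)\<^sup>2) = (norm \<xi>)\<^sup>2"
    by (simp add: norm_vec_def L2_set_def sum_nonneg)
  then show ?case
    by (simp only: sum_words_Suc list.map prod_list.Cons sum_distrib_left[symmetric] sum_distrib_right[symmetric] Suc)
      (simp add: power_add power2_eq_square)
qed

text \<open>Polarisation of the identity for squares. On complex numbers \<open>\<bullet>\<close> is
  the real part of the Hermitian product, which is what polarisation by a sum and a difference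
  produces.\<close>

lemma plancherel_test_functions:
  fixes \<phi> \<psi> :: "real^'n::finite \<Rightarrow> real"
  assumes \<phi>: "\<phi> \<in> test_functions S" and \<psi>: "\<psi> \<in> test_functions S"
  shows "has_bochner_integral lborel (\<lambda>\<xi>. rfourier \<phi> \<xi> \<bullet> rfourier \<psi> \<xi>)
    ((2 * pi) ^ CARD('n) * (LBINT x. \<phi> x * \<psi> x))"
proof -
  have pl: "has_bochner_integral lborel (\<lambda>\<xi>. (norm (rfourier \<phi> \<xi>))\<^sup>2) ((2 * pi) ^ CARD('n) * (LBINT x. (\<phi> x)\<^sup>2))"
    and int: "integrable lborel (\<lambda>x. (\<phi> x)\<^sup>2)" if t: "\<phi> \<in> test_functions S" for \<phi> :: "real^'n \<Rightarrow> real"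
  proof -
    obtain K where K: "continuous_on UNIV \<phi>" "compact K" "\<And>x. x \<notin> K \<Longrightarrow> \<phi> x = 0"
      using test_functionsE[OF t] by metis
    show "has_bochner_integral lborel (\<lambda>\<xi>. (norm (rfourier \<phi> \<xi>))\<^sup>2) ((2 * pi) ^ CARD('n) * (LBINT x. (\<phi> x)\<^sup>2))"
      using plancherel_compact_support[OF K] by simp
    show "integrable lborel (\<lambda>x. (\<phi> x)\<^sup>2)"
      by (rule continuous_compact_support[of _ K]) (use K in \<open>auto intro!: continuous_intros\<close>)
  qed
  let ?p = "\<lambda>x. 1 * \<phi> x + 1 * \<psi> x" and ?m = "\<lambda>x. 1 * \<phi> x + (- 1) * \<psi> x"
  have t: "?p \<in> test_functions S" "?m \<in> test_functions S" by (intro test_functions_lincomb assms)+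
  have "has_bochner_integral lborel (\<lambda>\<xi>. ((norm (rfourier ?p \<xi>))\<^sup>2 - (norm (rfourier ?m \<xi>))\<^sup>2) / 4)
      (((2 * pi) ^ CARD('n) * (LBINT x. (?p x)\<^sup>2) - (2 * pi) ^ CARD('n) * (LBINT x. (?m x)\<^sup>2)) / 4)"
    by (intro has_bochner_integral_divide_zero has_bochner_integral_diff pl t)
  also have "(\<lambda>\<xi>. ((norm (rfourier ?p \<xi>))\<^sup>2 - (norm (rfourier ?m \<xi>))\<^sup>2) / 4) = (\<lambda>\<xi>. rfourier \<phi> \<xi> \<bullet> rfourier \<psi> \<xi>)"
    unfolding rfourier_lincomb[OF test_function_integrable(2)[OF \<phi>] test_function_integrable(2)[OF \<psi>]]
    by (simp add: power2_norm_eq_inner inner_add_left inner_add_right inner_diff_left inner_diff_right inner_commute fun_eq_iff)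
  also have "((2 * pi) ^ CARD('n) * (LBINT x. (?p x)\<^sup>2) - (2 * pi) ^ CARD('n) * (LBINT x. (?m x)\<^sup>2)) / 4 =
      (2 * pi) ^ CARD('n) * (((LBINT x. (?p x)\<^sup>2) - (LBINT x. (?m x)\<^sup>2)) / 4)"
    by (simp add: right_diff_distrib)
  also have "((LBINT x. (?p x)\<^sup>2) - (LBINT x. (?m x)\<^sup>2)) / 4 = (LBINT x. ((?p x)\<^sup>2 - (?m x)\<^sup>2) / 4)"
    using int[OF t(1)] int[OF t(2)] by (simp del: mult_1 add: Bochner_Integration.integral_diff)
  also have "(\<lambda>x. ((?p x)\<^sup>2 - (?m x)\<^sup>2) / 4) = (\<lambda>x. \<phi> x * \<psi> x)"
    by (simp add: fun_eq_iff power2_eq_square algebra_simps)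
  finally show ?thesis .
qed

lemma norm_prod_list_imaginary:
  "(norm (\<Prod>i\<leftarrow>is. \<i> * complex_of_real (\<xi> $ i)))\<^sup>2 = (\<Prod>i\<leftarrow>is. (\<xi> $ i)\<^sup>2)"
  by (induction "is") (simp_all add: norm_mult power_mult_distrib)

lemma inner_mult_complex: "(c * z) \<bullet> (c * w) = (norm c)\<^sup>2 * (z \<bullet> w)" for c z w :: complex
  unfolding cmod_power2 by (simp add: inner_complex_def power2_eq_square algebra_simps)

text \<open>The weight \<open>norm \<xi> ^ (2 * l)\<close> is at once the sum of the squared symbols
  of the derivatives of order \<open>l\<close> and the symbol of \<open>poly_laplacian l\<close>.
  Computing the same integral in both ways replaces repeated integration by parts.\<close>

lemma energy_test_functions:
  fixes \<phi> \<psi> :: "real^'n::finite \<Rightarrow> real"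
  assumes \<phi>: "\<phi> \<in> test_functions S" and \<psi>: "\<psi> \<in> test_functions S"
  shows "has_bochner_integral lborel (\<lambda>\<xi>. norm \<xi> ^ (2 * l) * (rfourier \<phi> \<xi> \<bullet> rfourier \<psi> \<xi>))
      ((2 * pi) ^ CARD('n) * (\<Sum>is\<in>words l. \<integral>x. pdiffs is \<phi> x * pdiffs is \<psi> x \<partial>lborel))"
    and "(LBINT x. \<phi> x * poly_laplacian l \<psi> x) =
      (\<Sum>is\<in>words l. \<integral>x. pdiffs is \<phi> x * pdiffs is \<psi> x \<partial>lborel)"
proof -
  have "has_bochner_integral lborel (\<lambda>\<xi>. \<Sum>is\<in>words l. rfourier (pdiffs is \<phi>) \<xi> \<bullet> rfourier (pdiffs is \<psi>) \<xi>)
      (\<Sum>is\<in>words l. (2 * pi) ^ CARD('n) * (LBINT x. pdiffs is \<phi> x * pdiffs is \<psi> x))"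
    by (intro has_bochner_integral_sum plancherel_test_functions[of _ S] test_functions_pdiffs assms)
  also have "(\<lambda>\<xi>. \<Sum>is\<in>words l. rfourier (pdiffs is \<phi>) \<xi> \<bullet> rfourier (pdiffs is \<psi>) \<xi>) =
      (\<lambda>\<xi>. norm \<xi> ^ (2 * l) * (rfourier \<phi> \<xi> \<bullet> rfourier \<psi> \<xi>))"
    unfolding rfourier_pdiffs[OF \<phi>] rfourier_pdiffs[OF \<psi>] inner_mult_complex norm_prod_list_imaginary
    by (simp add: sum_words_prod_sq flip: sum_distrib_right)
  finally show 1: "has_bochner_integral lborel (\<lambda>\<xi>. norm \<xi> ^ (2 * l) * (rfourier \<phi> \<xi> \<bullet> rfourier \<psi> \<xi>))
      ((2 * pi) ^ CARD('n) * (\<Sum>is\<in>words l. \<integral>x. pdiffs is \<phi> x * pdiffs is \<psi> x \<partial>lborel))"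
    by (simp add: sum_distrib_left)
  have "has_bochner_integral lborel (\<lambda>\<xi>. rfourier \<phi> \<xi> \<bullet> rfourier (poly_laplacian l \<psi>) \<xi>)
      ((2 * pi) ^ CARD('n) * (LBINT x. \<phi> x * poly_laplacian l \<psi> x))"
    by (intro plancherel_test_functions[of _ S] test_functions_poly_laplacian assms)
  then have "has_bochner_integral lborel (\<lambda>\<xi>. norm \<xi> ^ (2 * l) * (rfourier \<phi> \<xi> \<bullet> rfourier \<psi> \<xi>))
      ((2 * pi) ^ CARD('n) * (LBINT x. \<phi> x * poly_laplacian l \<psi> x))"
    unfolding rfourier_poly_laplacian[OF \<psi>]
    by (simp only: scaleR_conv_of_real[symmetric] inner_scaleR_right)
  from has_bochner_integral_eq[OF 1 this] show "(LBINT x. \<phi> x * poly_laplacian l \<psi> x) =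
      (\<Sum>is\<in>words l. \<integral>x. pdiffs is \<phi> x * pdiffs is \<psi> x \<partial>lborel)"
    by simp
qed

section \<open>Eigenfunctions in the space of square integrable functions\<close>

definition L2_inner :: "(real^'n::finite) set \<Rightarrow> (real^'n \<Rightarrow> real) \<Rightarrow> (real^'n \<Rightarrow> real) \<Rightarrow> real" where
  "L2_inner S u w = integral\<^sup>L (lebesgue_on S) (\<lambda>x. u x * w x)"

lemma L2_inner_commute: "L2_inner S u w = L2_inner S w u"
  by (simp add: L2_inner_def mult.commute)

lemma square_integrable_mult:
  assumes "u \<in> square_integrable S" "w \<in> square_integrable S"
  shows "integrable (lebesgue_on S) (\<lambda>x. u x * w x)"
proof (rule Bochner_Integration.integrable_bound)
  show "integrable (lebesgue_on S) (\<lambda>x. (u x)\<^sup>2 + (w x)\<^sup>2)"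
    using assms by (auto simp: square_integrable_def)
  have "\<bar>a * b\<bar> \<le> a\<^sup>2 + b\<^sup>2" for a b :: real
  proof -
    have "2 * \<bar>a * b\<bar> \<le> a\<^sup>2 + b\<^sup>2" using sum_squares_bound[of "\<bar>a\<bar>" "\<bar>b\<bar>"] by (simp add: abs_mult)
    then show ?thesis using abs_ge_zero[of "a * b"] by linarith
  qed
  then show "AE x in lebesgue_on S. norm (u x * w x) \<le> norm ((u x)\<^sup>2 + (w x)\<^sup>2)"
    by (intro AE_I2) simp
qed (use assms in \<open>auto simp: square_integrable_def\<close>)

lemma square_integrable_lincomb:
  assumes "u \<in> square_integrable S" "w \<in> square_integrable S"
  shows "(\<lambda>x. a * u x + b * w x) \<in> square_integrable S"
proof -
  have "(\<lambda>x. (a * u x + b * w x)\<^sup>2) = (\<lambda>x. a\<^sup>2 * (u x)\<^sup>2 + b\<^sup>2 * (w x)\<^sup>2 + 2 * a * b * (u x * w x))"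
    by (simp add: fun_eq_iff power2_eq_square algebra_simps)
  then show ?thesis
    using assms square_integrable_mult[OF assms] by (auto simp: square_integrable_def)
qed

lemma square_integrable_diff:
  "u \<in> square_integrable S \<Longrightarrow> w \<in> square_integrable S \<Longrightarrow> (\<lambda>x. u x - w x) \<in> square_integrable S"
  using square_integrable_lincomb[of u S w 1 "-1"] by simp

lemma square_integrable_0: "(\<lambda>x. 0) \<in> square_integrable S"
  by (simp add: square_integrable_def)

lemma square_integrable_sum:
  assumes "finite A" "\<And>a. a \<in> A \<Longrightarrow> u a \<in> square_integrable S"
  shows "(\<lambda>x. \<Sum>a\<in>A. c a * u a x) \<in> square_integrable S"
  using assms
proof (induction A rule: finite_induct)
  case (insert a A)
  then show ?case
    using square_integrable_lincomb[of "u a" S "\<lambda>x. \<Sum>a\<in>A. c a * u a x" "c a" 1] by simp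
qed (simp add: square_integrable_0)

lemma L2_inner_lincomb:
  assumes "u \<in> square_integrable S" "w \<in> square_integrable S" "z \<in> square_integrable S"
  shows "L2_inner S (\<lambda>x. a * u x + b * w x) z = a * L2_inner S u z + b * L2_inner S w z"
  using square_integrable_mult[OF assms(1,3)] square_integrable_mult[OF assms(2,3)]
  by (simp add: L2_inner_def distrib_right mult.assoc)

lemma L2_inner_sum:
  assumes "finite A" "\<And>a. a \<in> A \<Longrightarrow> u a \<in> square_integrable S" "z \<in> square_integrable S"
  shows "L2_inner S (\<lambda>x. \<Sum>a\<in>A. c a * u a x) z = (\<Sum>a\<in>A. c a * L2_inner S (u a) z)"
  using assms
proof (induction A rule: finite_induct)
  case empty
  show ?case by (simp add: L2_inner_def)
next
  case (insert a A)
  then show ?case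
    using L2_inner_lincomb[of "u a" S "\<lambda>x. \<Sum>a\<in>A. c a * u a x" z "c a" 1]
    by (simp add: square_integrable_sum)
qed

lemma L2_inner_diff:
  assumes "u \<in> square_integrable S" "w \<in> square_integrable S" "z \<in> square_integrable S"
  shows "L2_inner S (\<lambda>x. u x - w x) z = L2_inner S u z - L2_inner S w z"
  using L2_inner_lincomb[OF assms, of 1 "-1"] by simp

lemma L2_inner_self_nonneg: "0 \<le> L2_inner S u u"
  by (simp add: L2_inner_def)

text \<open>Functions stand for themselves and not for classes, so the form is only semidefinite.
  The discriminant argument for \<open>u + t * w\<close> therefore treats a vanishing norm of
  \<open>w\<close> separately.\<close>

lemma L2_Cauchy_Schwarz:
  assumes u: "u \<in> square_integrable S" and w: "w \<in> square_integrable S"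
  shows "\<bar>L2_inner S u w\<bar> \<le> sqrt (L2_inner S u u) * sqrt (L2_inner S w w)"
proof -
  let ?P = "L2_inner S u w" and ?G = "L2_inner S w w" and ?F = "L2_inner S u u"
  have quad: "0 \<le> ?F + 2 * t * ?P + t\<^sup>2 * ?G" for t
  proof -
    let ?z = "\<lambda>x. 1 * u x + t * w x"
    have z: "?z \<in> square_integrable S" by (intro square_integrable_lincomb u w)
    have "0 \<le> L2_inner S ?z ?z" by (rule L2_inner_self_nonneg)
    also have "\<dots> = 1 * L2_inner S ?z u + t * L2_inner S ?z w"
      unfolding L2_inner_lincomb[OF u w z] L2_inner_commute[of S _ ?z] ..
    also have "\<dots> = ?F + 2 * t * ?P + t\<^sup>2 * ?G"
      unfolding L2_inner_lincomb[OF u w u] L2_inner_lincomb[OF u w w] L2_inner_commute[of S w u]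
      by (simp add: power2_eq_square algebra_simps)
    finally show ?thesis .
  qed
  have "?P\<^sup>2 \<le> ?F * ?G"
  proof (cases "?G = 0")
    case True
    have "?P = 0"
    proof (rule ccontr)
      assume "?P \<noteq> 0"
      \<comment> \<open>This \<open>t\<close> would make the affine function
        \<open>?F + 2 * t * ?P\<close> equal to -1.\<close>
      then have "2 * (- (?F + 1) / (2 * ?P)) * ?P = - (?F + 1)" by simp
      then show False using quad[of "- (?F + 1) / (2 * ?P)"] True by simp
    qed
    then show ?thesis using True by simp
  next
    case False
    then have G: "?G > 0" using L2_inner_self_nonneg[of S w] by simp
    \<comment> \<open>The minimum of the quadratic polynomial is attained at
      \<open>t = - ?P / ?G\<close>.\<close>
    have "2 * (- ?P / ?G) * ?P + (- ?P / ?G)\<^sup>2 * ?G = - (?P\<^sup>2 / ?G)"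
      using G by (simp add: power2_eq_square)
    then have "0 \<le> ?F - ?P\<^sup>2 / ?G"
      using quad[of "- ?P / ?G"] by linarith
    then show ?thesis using G by (simp add: field_simps)
  qed
  then have "sqrt (?P\<^sup>2) \<le> sqrt (?F * ?G)" by (rule real_sqrt_le_mono)
  then show ?thesis by (simp add: real_sqrt_mult)
qed

text \<open>Square integrability belongs to the notion because the Bochner integral of a
  non-integrable function is 0, so convergence of the integrals alone would say nothing.\<close>

definition L2_tendsto :: "(real^'n::finite) set \<Rightarrow> (nat \<Rightarrow> real^'n \<Rightarrow> real) \<Rightarrow> (real^'n \<Rightarrow> real) \<Rightarrow> bool" where
  "L2_tendsto S f u \<longleftrightarrow> u \<in> square_integrable S \<and> (\<forall>n. f n \<in> square_integrable S) \<and>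
     (\<lambda>n. L2_inner S (\<lambda>x. f n x - u x) (\<lambda>x. f n x - u x)) \<longlonglongrightarrow> 0"

text \<open>With \<open>?d\<close> and \<open>?e\<close> for the two errors, the difference of the
  products is the sum of the pairings of \<open>?d\<close> with \<open>?e\<close>, of
  \<open>?d\<close> with \<open>w\<close> and of \<open>u\<close> with \<open>?e\<close>;
  Cauchy-Schwarz makes each of them small.\<close>

lemma L2_tendsto_inner:
  assumes "L2_tendsto S f u" "L2_tendsto S g w"
  shows "(\<lambda>n. L2_inner S (f n) (g n)) \<longlonglongrightarrow> L2_inner S u w"
proof -
  let ?d = "\<lambda>n x. f n x - u x" and ?e = "\<lambda>n x. g n x - w x"
  have si: "u \<in> square_integrable S" "w \<in> square_integrable S" "f n \<in> square_integrable S" "g n \<in> square_integrable S"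
    "?d n \<in> square_integrable S" "?e n \<in> square_integrable S" for n
    using assms by (auto simp: L2_tendsto_def square_integrable_diff)
  have d: "(\<lambda>n. sqrt (L2_inner S (?d n) (?d n))) \<longlonglongrightarrow> 0" and e: "(\<lambda>n. sqrt (L2_inner S (?e n) (?e n))) \<longlonglongrightarrow> 0"
    using assms tendsto_real_sqrt unfolding L2_tendsto_def by force+
  let ?B = "\<lambda>n. sqrt (L2_inner S (?d n) (?d n)) * sqrt (L2_inner S (?e n) (?e n)) +
       sqrt (L2_inner S (?d n) (?d n)) * sqrt (L2_inner S w w) + sqrt (L2_inner S u u) * sqrt (L2_inner S (?e n) (?e n))"
  have "(\<lambda>n. L2_inner S (f n) (g n) - L2_inner S u w) \<longlonglongrightarrow> 0"
  proof (rule Lim_null_comparison[OF always_eventually])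
    have "?B \<longlonglongrightarrow> 0 * 0 + 0 * sqrt (L2_inner S w w) + sqrt (L2_inner S u u) * 0"
      by (intro tendsto_intros d e)
    then show "?B \<longlonglongrightarrow> 0" by simp
    show "\<forall>n. norm (L2_inner S (f n) (g n) - L2_inner S u w) \<le> ?B n"
    proof
      fix n
      have "L2_inner S (f n) (g n) - L2_inner S u w =
         L2_inner S (?d n) (?e n) + L2_inner S (?d n) w + L2_inner S u (?e n)"
      proof -
        have "L2_inner S (?d n) (?e n) = L2_inner S (f n) (?e n) - L2_inner S u (?e n)"
          by (rule L2_inner_diff[OF si(3) si(1) si(6)])
        moreover have "L2_inner S (?d n) w = L2_inner S (f n) w - L2_inner S u w"
          by (rule L2_inner_diff[OF si(3) si(1) si(2)])
        moreover have "L2_inner S (?e n) (f n) = L2_inner S (g n) (f n) - L2_inner S w (f n)"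
          by (rule L2_inner_diff[OF si(4) si(2) si(3)])
        ultimately show ?thesis
          using L2_inner_commute[of S "f n" "?e n"] L2_inner_commute[of S "f n" "g n"] L2_inner_commute[of S "f n" w]
          by linarith
      qed
      then show "norm (L2_inner S (f n) (g n) - L2_inner S u w) \<le> ?B n"
        using L2_Cauchy_Schwarz[OF si(5)[of n] si(6)[of n]] L2_Cauchy_Schwarz[OF si(5)[of n] si(2)]
          L2_Cauchy_Schwarz[OF si(1) si(6)[of n]] by simp
    qed
  qed
  then show ?thesis by (simp add: LIM_zero_iff)
qed

lemma L2_tendsto_const: "u \<in> square_integrable S \<Longrightarrow> L2_tendsto S (\<lambda>n. u) u"
  by (simp add: L2_tendsto_def L2_inner_def)

lemma L2_inner_test_function:
  assumes "open S" "\<phi> \<in> test_functions S" "\<psi> \<in> borel_measurable borel"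
  shows "L2_inner S \<phi> \<psi> = (LBINT x. \<phi> x * \<psi> x)"
proof -
  have [measurable]: "\<phi> \<in> borel_measurable borel" using test_function_integrable(1)[OF assms(2)] .
  have 0: "\<phi> x = 0" if "x \<notin> S" for x using assms(2) that by (auto simp: test_functions_def)
  have "L2_inner S \<phi> \<psi> = (\<integral>x. indicator S x *\<^sub>R (\<phi> x * \<psi> x) \<partial>lebesgue)"
    unfolding L2_inner_def using assms(1) by (intro integral_restrict_space) (simp add: borel_open)
  also have "\<dots> = (\<integral>x. \<phi> x * \<psi> x \<partial>lebesgue)"
    by (intro Bochner_Integration.integral_cong) (auto simp: indicator_def 0)
  also have "\<dots> = (LBINT x. \<phi> x * \<psi> x)"
    by (intro integral_completion borel_measurable_times) (use assms in simp_all)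
  finally show ?thesis .
qed

lemma integrable_lebesgue_on_bounded:
  fixes S :: "(real^'n::finite) set"
  assumes "open S" "bounded S" "continuous_on UNIV f"
  shows "integrable (lebesgue_on S) (f :: real^'n \<Rightarrow> real)"
proof -
  have [measurable]: "f \<in> borel_measurable borel" using assms(3) by (rule borel_measurable_continuous_onI)
  have "integrable lborel (\<lambda>x. indicator (closure S) x *\<^sub>R f x)"
    using assms by (intro borel_integrable_compact) (auto intro: continuous_on_subset)
  then have "integrable lborel (\<lambda>x. indicator S x *\<^sub>R (indicator (closure S) x *\<^sub>R f x))"
    by (rule integrable_mult_indicator[rotated]) (use assms(1) in simp)
  also have "(\<lambda>x. indicator S x *\<^sub>R (indicator (closure S) x *\<^sub>R f x)) = (\<lambda>x. indicator S x *\<^sub>R f x)"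
    using closure_subset[of S] by (auto simp: indicator_def fun_eq_iff)
  finally have "integrable lebesgue (\<lambda>x. indicator S x *\<^sub>R f x)"
    using assms(1) by (subst integrable_completion) (auto intro!: borel_measurable_scaleR borel_measurable_indicator simp: borel_open)
  then show ?thesis
    using assms(1) by (subst integrable_restrict_space) (auto simp: borel_open)
qed

lemma square_integrable_continuous:
  assumes "open S" "bounded S" "continuous_on UNIV f"
  shows "f \<in> square_integrable S"
  using integrable_lebesgue_on_bounded[OF assms] integrable_lebesgue_on_bounded[OF assms(1,2), of "\<lambda>x. (f x)\<^sup>2"] assms(3)
  by (auto simp: square_integrable_def intro!: continuous_intros)

lemma square_integrable_test_function:
  assumes "open S" "bounded S" "\<phi> \<in> test_functions S"
  shows "\<phi> \<in> square_integrable S"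
  using test_functionsE[OF assms(3)] square_integrable_continuous[OF assms(1,2)] by metis

lemma pdiffs_zero: "pdiffs is (\<lambda>x. 0) = (\<lambda>x. 0)"
  by (induction "is") (simp_all add: pdiffs_Cons pdiff_const_0)

text \<open>No density of the test functions is needed here: the difference \<open>d\<close> of the two functions is
  orthogonal to all test functions, hence belongs to every eigenspace, in particular to the one for
  \<open>ev 1 - 1\<close>, which has dimension 0.\<close>

lemma square_integrable_ae_unique:
  fixes ev :: "nat \<Rightarrow> real"
  assumes ev: "dirichlet_eigenvalues l S ev"
    and u: "u \<in> square_integrable S" and v: "v \<in> square_integrable S"
    and eq: "\<And>\<phi>. \<phi> \<in> test_functions S \<Longrightarrow> L2_inner S u \<phi> = L2_inner S v \<phi>"
    and si: "\<And>\<phi>. \<phi> \<in> test_functions S \<Longrightarrow> \<phi> \<in> square_integrable S"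
  shows "AE x in lebesgue_on S. u x = v x"
proof -
  define d where "d = (\<lambda>x. u x - v x)"
  have d: "d \<in> square_integrable S" unfolding d_def by (intro square_integrable_diff u v)
  have d0: "integral\<^sup>L (lebesgue_on S) (\<lambda>x. d x * \<phi> x) = 0" if "\<phi> \<in> test_functions S" for \<phi>
    using L2_inner_diff[OF u v si[OF that]] eq[OF that] by (simp add: d_def L2_inner_def)
  have "weak_deriv S is d (\<lambda>x. 0)" for "is"
    unfolding weak_deriv_def by (auto simp: d square_integrable_0 d0 test_functions_pdiffs)
  \<comment> \<open>\<open>sobolev_H0\<close> measures convergence against the weak derivatives
    \<open>v is\<close>, including the one for the empty word. With all of them 0, the constant
    sequence 0 converges.\<close>
  then have "d \<in> sobolev_H0 l S"
    unfolding sobolev_H0_def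
    by (auto intro!: exI[of _ "\<lambda>_ _. 0"] simp: test_functions_0 pdiffs_zero)
  then have "d \<in> eigenspace l S (ev 1 - 1)"
    unfolding eigenspace_def by (auto simp: d0 test_functions_poly_laplacian)
  moreover have "{i \<in> {1..}. ev i = ev 1 - 1} = {}"
  proof -
    have "ev 1 \<le> ev i" if "i \<ge> 1" for i
      using ev that by (auto simp: dirichlet_eigenvalues_def mono_on_def)
    then show ?thesis by force
  qed
  then have "has_ae_dim S (eigenspace l S (ev 1 - 1)) 0"
    using ev unfolding dirichlet_eigenvalues_def by (metis card.empty)
  ultimately have "AE x in lebesgue_on S. d x = 0"
    by (auto simp: has_ae_dim_def)
  then show ?thesis by (simp add: d_def)
qed

text \<open>Membership in \<open>sobolev_H0\<close> reduced to what the energy needs: approximation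
  of \<open>u\<close> itself and of its derivatives of order exactly \<open>l\<close>.\<close>

definition H0_approx :: "nat \<Rightarrow> (real^'n::finite) set \<Rightarrow> (real^'n \<Rightarrow> real) \<Rightarrow>
    ('n list \<Rightarrow> real^'n \<Rightarrow> real) \<Rightarrow> (nat \<Rightarrow> real^'n \<Rightarrow> real) \<Rightarrow> bool" where
  "H0_approx l S u v \<phi> \<longleftrightarrow> (\<forall>n. \<phi> n \<in> test_functions S) \<and> L2_tendsto S \<phi> u \<and>
     (\<forall>is\<in>words l. L2_tendsto S (\<lambda>n. pdiffs is (\<phi> n)) (v is))"

text \<open>The approximating sequence converges to \<open>v []\<close>, which is tied to
  \<open>u\<close> only by testing. By \<open>square_integrable_ae_unique\<close> the two agree
  almost everywhere, and so the sequence converges to \<open>u\<close>.\<close>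

lemma sobolev_H0_approx:
  fixes ev :: "nat \<Rightarrow> real"
  assumes S: "open S" "bounded S" and ev: "dirichlet_eigenvalues l S ev" and u: "u \<in> sobolev_H0 l S"
  shows "\<exists>v \<phi>. H0_approx l S u v \<phi>"
proof -
  obtain v \<phi> where v: "\<And>is. length is \<le> l \<Longrightarrow> weak_deriv S is u (v is)"
    and \<phi>: "\<And>n. \<phi> n \<in> test_functions S"
    and lim: "\<And>is. length is \<le> l \<Longrightarrow>
        (\<lambda>n::nat. integral\<^sup>L (lebesgue_on S) (\<lambda>x. (pdiffs is (\<phi> n) x - v is x)\<^sup>2)) \<longlonglongrightarrow> 0"
    using u unfolding sobolev_H0_def by blast
  have usi: "u \<in> square_integrable S" and vsi: "\<And>is. length is \<le> l \<Longrightarrow> v is \<in> square_integrable S"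
    using v[of "[]"] v by (auto simp: weak_deriv_def)
  have tsi: "\<psi> \<in> square_integrable S" if "\<psi> \<in> test_functions S" for \<psi>
    using square_integrable_test_function[OF S that] .
  have T: "L2_tendsto S (\<lambda>n. pdiffs is (\<phi> n)) (v is)" if "length is \<le> l" for "is"
    using lim[OF that] vsi[OF that] \<phi>
    by (auto simp: L2_tendsto_def L2_inner_def power2_eq_square tsi test_functions_pdiffs)
  have "AE x in lebesgue_on S. u x = v [] x"
  proof (rule square_integrable_ae_unique[OF ev usi vsi _ tsi])
    show "L2_inner S u \<psi> = L2_inner S (v []) \<psi>" if "\<psi> \<in> test_functions S" for \<psi>
      using v[of "[]"] that by (simp add: weak_deriv_def L2_inner_def)
  qed auto
  then have "L2_inner S (\<lambda>x. \<phi> n x - u x) (\<lambda>x. \<phi> n x - u x) =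
      L2_inner S (\<lambda>x. \<phi> n x - v [] x) (\<lambda>x. \<phi> n x - v [] x)" for n
    unfolding L2_inner_def
    by (intro integral_cong_AE) (use usi vsi[of "[]"] tsi[OF \<phi>[of n]] in \<open>auto simp: square_integrable_def\<close>)
  then have "L2_tendsto S \<phi> u"
    using T[of "[]"] usi by (simp add: L2_tendsto_def)
  then show ?thesis
    using T \<phi> by (auto simp: H0_approx_def words_def)
qed

section \<open>Weak eigenfunctions: energy, orthogonality and linear combinations\<close>

definition weak_eigenfunction :: "nat \<Rightarrow> (real^'n::finite) set \<Rightarrow> real \<Rightarrow> (real^'n \<Rightarrow> real) \<Rightarrow> bool" where
  "weak_eigenfunction l S \<mu> u \<longleftrightarrow> (\<exists>v \<phi>. H0_approx l S u v \<phi>) \<and>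
     (\<forall>\<psi>\<in>test_functions S. L2_inner S u (poly_laplacian l \<psi>) = \<mu> * L2_inner S u \<psi>)"

lemma weak_eigenfunction_square_integrable:
  "weak_eigenfunction l S \<mu> u \<Longrightarrow> u \<in> square_integrable S"
  by (auto simp: weak_eigenfunction_def H0_approx_def L2_tendsto_def)

lemma eigenspace_weak_eigenfunction:
  fixes ev :: "nat \<Rightarrow> real"
  assumes "open S" "bounded S" "dirichlet_eigenvalues l S ev" "u \<in> eigenspace l S \<mu>"
  shows "weak_eigenfunction l S \<mu> u"
  using sobolev_H0_approx[OF assms(1-3)] assms(4)
  by (simp add: weak_eigenfunction_def eigenspace_def L2_inner_def)

text \<open>This is the weak equation for \<open>u\<close> tested with \<open>w\<close>, itself only
  a limit of test functions. For fixed \<open>m\<close> the operator is shifted from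
  \<open>\<psi> m\<close> to derivatives of \<open>\<phi> n\<close> and \<open>n\<close> tends to
  infinity; afterwards \<open>m\<close> does. For \<open>w = u\<close> the energy is the eigenvalue
  times the squared norm.\<close>

lemma energy_identity:
  assumes S: "open S" "bounded S"
    and u: "H0_approx l S u v \<phi>" "weak_eigenfunction l S \<mu> u" and w: "H0_approx l S w v' \<psi>"
  shows "(\<Sum>is\<in>words l. L2_inner S (v is) (v' is)) = \<mu> * L2_inner S u w"
proof -
  have tsi: "\<psi> \<in> square_integrable S" if "\<psi> \<in> test_functions S" for \<psi>
    using square_integrable_test_function[OF S that] .
  have test: "\<phi> n \<in> test_functions S" "\<psi> n \<in> test_functions S" for n
    using u w by (auto simp: H0_approx_def)
  have eq: "(\<Sum>is\<in>words l. L2_inner S (v is) (pdiffs is (\<psi> m))) = \<mu> * L2_inner S u (\<psi> m)" for m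
  proof -
    have 1: "(\<lambda>n. L2_inner S (\<phi> n) (poly_laplacian l (\<psi> m))) \<longlonglongrightarrow> L2_inner S u (poly_laplacian l (\<psi> m))"
      using u test by (intro L2_tendsto_inner L2_tendsto_const tsi test_functions_poly_laplacian) (auto simp: H0_approx_def)
    have "L2_inner S (\<phi> n) (poly_laplacian l (\<psi> m)) = (\<Sum>is\<in>words l. L2_inner S (pdiffs is (\<phi> n)) (pdiffs is (\<psi> m)))" for n
      using energy_test_functions(2)[OF test(1) test(2), of n l m]
      by (simp add: L2_inner_test_function[OF S(1)] test_functions_poly_laplacian test_functions_pdiffs test test_function_integrable(1)[of _ S])
    then have 2: "(\<lambda>n. L2_inner S (\<phi> n) (poly_laplacian l (\<psi> m))) \<longlonglongrightarrow> (\<Sum>is\<in>words l. L2_inner S (v is) (pdiffs is (\<psi> m)))"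
      using u test by (simp only:, intro tendsto_sum L2_tendsto_inner L2_tendsto_const tsi test_functions_pdiffs)
        (auto simp: H0_approx_def)
    have "L2_inner S u (poly_laplacian l (\<psi> m)) = \<mu> * L2_inner S u (\<psi> m)"
      using u(2) test(2)[of m] by (simp add: weak_eigenfunction_def)
    then show ?thesis using LIMSEQ_unique[OF 1 2] by simp
  qed
  have "(\<lambda>m. \<Sum>is\<in>words l. L2_inner S (v is) (pdiffs is (\<psi> m))) \<longlonglongrightarrow> (\<Sum>is\<in>words l. L2_inner S (v is) (v' is))"
    using u w by (intro tendsto_sum L2_tendsto_inner L2_tendsto_const) (auto simp: H0_approx_def L2_tendsto_def)
  moreover have "(\<lambda>m. \<mu> * L2_inner S u (\<psi> m)) \<longlonglongrightarrow> \<mu> * L2_inner S u w"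
    using u w by (intro tendsto_mult_left L2_tendsto_inner L2_tendsto_const) (auto simp: H0_approx_def L2_tendsto_def)
  ultimately show ?thesis unfolding eq by (rule LIMSEQ_unique)
qed

text \<open>The energy form is symmetric, so both eigenvalues express the same number as a multiple
  of the inner product.\<close>

lemma weak_eigenfunction_orthogonal:
  assumes S: "open S" "bounded S"
    and u: "weak_eigenfunction l S \<mu> u" and w: "weak_eigenfunction l S \<nu> w" and "\<mu> \<noteq> \<nu>"
  shows "L2_inner S u w = 0"
proof -
  obtain v \<phi> where a: "H0_approx l S u v \<phi>" using u by (auto simp: weak_eigenfunction_def)
  obtain v' \<psi> where b: "H0_approx l S w v' \<psi>" using w by (auto simp: weak_eigenfunction_def)
  have "\<mu> * L2_inner S u w = \<nu> * L2_inner S u w"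
  proof -
    have "(\<Sum>is\<in>words l. L2_inner S (v is) (v' is)) = (\<Sum>is\<in>words l. L2_inner S (v' is) (v is))"
      by (intro sum.cong refl L2_inner_commute)
    then show ?thesis
      using energy_identity[OF S a u b] energy_identity[OF S b w a] L2_inner_commute[of S w u] by metis
  qed
  then show ?thesis using \<open>\<mu> \<noteq> \<nu>\<close> by simp
qed

lemma L2_tendsto_lincomb:
  assumes f: "L2_tendsto S f u" and g: "L2_tendsto S g w"
  shows "L2_tendsto S (\<lambda>n x. a * f n x + b * g n x) (\<lambda>x. a * u x + b * w x)"
proof -
  let ?d = "\<lambda>n x. f n x - u x" and ?e = "\<lambda>n x. g n x - w x"
  have d: "L2_tendsto S ?d (\<lambda>x. 0)" and e: "L2_tendsto S ?e (\<lambda>x. 0)"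
    using f g by (auto simp: L2_tendsto_def square_integrable_0 square_integrable_diff)
  have si: "?d n \<in> square_integrable S" "?e n \<in> square_integrable S" for n
    using d e by (auto simp: L2_tendsto_def)
  have "L2_inner S (\<lambda>x. (a * f n x + b * g n x) - (a * u x + b * w x)) (\<lambda>x. (a * f n x + b * g n x) - (a * u x + b * w x)) =
     a\<^sup>2 * L2_inner S (?d n) (?d n) + 2 * a * b * L2_inner S (?d n) (?e n) + b\<^sup>2 * L2_inner S (?e n) (?e n)" for n
  proof -
    have eq: "(\<lambda>x. (a * f n x + b * g n x) - (a * u x + b * w x)) = (\<lambda>x. a * ?d n x + b * ?e n x)" (is "?l = ?z")
      by (simp add: fun_eq_iff algebra_simps)
    have z: "?z \<in> square_integrable S" by (intro square_integrable_lincomb si)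
    have "L2_inner S ?z ?z = a * L2_inner S (?d n) ?z + b * L2_inner S (?e n) ?z"
      by (rule L2_inner_lincomb[OF si z])
    also have "L2_inner S (?d n) ?z = a * L2_inner S (?d n) (?d n) + b * L2_inner S (?e n) (?d n)"
      by (subst L2_inner_commute) (rule L2_inner_lincomb[OF si si(1)])
    also have "L2_inner S (?e n) ?z = a * L2_inner S (?d n) (?e n) + b * L2_inner S (?e n) (?e n)"
      by (subst L2_inner_commute) (rule L2_inner_lincomb[OF si si(2)])
    finally show ?thesis unfolding eq L2_inner_commute[of S "?e n" "?d n"]
      by (simp add: power2_eq_square algebra_simps)
  qed
  moreover have "(\<lambda>n. a\<^sup>2 * L2_inner S (?d n) (?d n) + 2 * a * b * L2_inner S (?d n) (?e n) + b\<^sup>2 * L2_inner S (?e n) (?e n)) \<longlonglongrightarrow>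
     a\<^sup>2 * L2_inner S (\<lambda>x. 0) (\<lambda>x. 0) + 2 * a * b * L2_inner S (\<lambda>x. 0) (\<lambda>x. 0) + b\<^sup>2 * L2_inner S (\<lambda>x. 0) (\<lambda>x. 0)"
    by (intro tendsto_intros L2_tendsto_inner d e)
  ultimately show ?thesis
    using f g by (auto simp: L2_tendsto_def square_integrable_lincomb L2_inner_def)
qed

lemma weak_eigenfunction_lincomb:
  assumes S: "open S" "bounded S"
    and u: "weak_eigenfunction l S \<mu> u" and w: "weak_eigenfunction l S \<mu> w"
  shows "weak_eigenfunction l S \<mu> (\<lambda>x. a * u x + b * w x)"
proof -
  obtain v \<phi> where A: "H0_approx l S u v \<phi>" using u by (auto simp: weak_eigenfunction_def)
  obtain v' \<psi> where B: "H0_approx l S w v' \<psi>" using w by (auto simp: weak_eigenfunction_def)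
  have t: "\<phi> n \<in> test_functions S" "\<psi> n \<in> test_functions S" for n
    using A B by (auto simp: H0_approx_def)
  then have s: "smooth (\<phi> n)" "smooth (\<psi> n)" for n by (auto simp: test_functions_def)
  have "H0_approx l S (\<lambda>x. a * u x + b * w x) (\<lambda>is x. a * v is x + b * v' is x) (\<lambda>n x. a * \<phi> n x + b * \<psi> n x)"
    using A B by (auto simp: H0_approx_def pdiffs_lincomb[OF s] intro!: L2_tendsto_lincomb test_functions_lincomb)
  moreover have "L2_inner S (\<lambda>x. a * u x + b * w x) (poly_laplacian l \<psi>) = \<mu> * L2_inner S (\<lambda>x. a * u x + b * w x) \<psi>"
    if t: "\<psi> \<in> test_functions S" for \<psi>
  proof -
    note si = u[THEN weak_eigenfunction_square_integrable] w[THEN weak_eigenfunction_square_integrable]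
    show ?thesis
      using u w t
      by (simp add: L2_inner_lincomb[OF si square_integrable_test_function[OF S]] test_functions_poly_laplacian
          weak_eigenfunction_def algebra_simps)
  qed
  ultimately show ?thesis by (auto simp: weak_eigenfunction_def)
qed

lemma weak_eigenfunction_0:
  shows "weak_eigenfunction l S \<mu> (\<lambda>x. 0)"
proof -
  have "H0_approx l S (\<lambda>x. 0) (\<lambda>is x. 0) (\<lambda>n x. 0)"
    by (simp add: H0_approx_def pdiffs_zero L2_tendsto_const square_integrable_0 test_functions_0)
  then show ?thesis by (auto simp: weak_eigenfunction_def L2_inner_def)
qed

lemma weak_eigenfunction_sum:
  assumes "open S" "bounded S" "finite A" "\<And>a. a \<in> A \<Longrightarrow> weak_eigenfunction l S \<mu> (u a)"
  shows "weak_eigenfunction l S \<mu> (\<lambda>x. \<Sum>a\<in>A. c a * u a x)"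
  using assms(3,4)
proof (induction A rule: finite_induct)
  case (insert a A)
  then show ?case
    using weak_eigenfunction_lincomb[OF assms(1,2), of l \<mu> "u a" "\<lambda>x. \<Sum>a\<in>A. c a * u a x" "c a" 1] by simp
qed (simp add: weak_eigenfunction_0)

section \<open>Orthonormal families of eigenfunctions\<close>

lemma L2_inner_self_eq_0:
  assumes "u \<in> square_integrable S" "L2_inner S u u = 0"
  shows "AE x in lebesgue_on S. u x = 0"
proof -
  have "AE x in lebesgue_on S. (u x)\<^sup>2 = 0"
    using assms by (subst integral_nonneg_eq_0_iff_AE[symmetric]) (auto simp: square_integrable_def L2_inner_def power2_eq_square)
  then show ?thesis by simp
qed

text \<open>The result is a matrix of coefficients rather than a family of functions, so the new
  functions are visibly linear combinations and remain in an eigenspace.\<close>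

lemma gram_schmidt_L2:
  fixes e :: "nat \<Rightarrow> real^'n::finite \<Rightarrow> real"
  assumes si: "\<And>j. j < m \<Longrightarrow> e j \<in> square_integrable S"
    and indep: "\<And>c. AE x in lebesgue_on S. (\<Sum>j<m. c j * e j x) = 0 \<Longrightarrow> \<forall>j<m. c j = (0::real)"
  shows "\<exists>a. \<forall>i<m. \<forall>j<m. L2_inner S (\<lambda>x. \<Sum>k<m. a i k * e k x) (\<lambda>x. \<Sum>k<m. a j k * e k x) = of_bool (i = j)"
  using assms
proof (induction m)
  case (Suc m)
  have "\<forall>j<m. c j = 0" if "AE x in lebesgue_on S. (\<Sum>j<m. c j * e j x) = 0" for c :: "nat \<Rightarrow> real"
  proof -
    have "AE x in lebesgue_on S. (\<Sum>j<Suc m. (if j < m then c j else 0) * e j x) = 0"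
      using that by simp
    from Suc.prems(2)[OF this] show ?thesis by (metis less_SucI)
  qed
  then obtain a where a: "\<And>i j. i < m \<Longrightarrow> j < m \<Longrightarrow>
      L2_inner S (\<lambda>x. \<Sum>k<m. a i k * e k x) (\<lambda>x. \<Sum>k<m. a j k * e k x) = of_bool (i = j)"
    using Suc.IH Suc.prems(1) by (meson less_SucI)
  define u where "u = (\<lambda>j x. \<Sum>k<m. a j k * e k x)"
  have usi: "u j \<in> square_integrable S" for j
    unfolding u_def using Suc.prems(1) by (intro square_integrable_sum) auto
  define p where "p = (\<lambda>x. \<Sum>j<m. L2_inner S (e m) (u j) * u j x)"
  have psi: "p \<in> square_integrable S" unfolding p_def by (intro square_integrable_sum usi) auto
  define z where "z = (\<lambda>x. e m x - p x)"
  have zsi: "z \<in> square_integrable S" unfolding z_def using Suc.prems(1) psi by (intro square_integrable_diff) auto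
  have zu: "L2_inner S z (u i) = 0" if "i < m" for i
  proof -
    have "L2_inner S p (u i) = (\<Sum>j<m. L2_inner S (e m) (u j) * L2_inner S (u j) (u i))"
      unfolding p_def by (intro L2_inner_sum usi) auto
    also have "\<dots> = (\<Sum>j<m. if j = i then L2_inner S (e m) (u i) else 0)"
      using a[OF _ that] by (intro sum.cong) (auto simp: u_def)
    also have "\<dots> = L2_inner S (e m) (u i)" using that by simp
    finally show ?thesis
      unfolding z_def using L2_inner_diff[OF Suc.prems(1)[of m] psi usi[of i]] by simp
  qed
  \<comment> \<open>The coefficients of \<open>z\<close> in terms of \<open>e\<close>. The one at
    \<open>m\<close> is 1, so \<open>z = 0\<close> almost everywhere would contradict independence;
    hence \<open>z\<close> can be normalised.\<close>
  define b where "b = (\<lambda>k. if k < m then - (\<Sum>j<m. L2_inner S (e m) (u j) * a j k) else 1)"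
  have zb: "z x = (\<Sum>k<Suc m. b k * e k x)" for x
  proof -
    have "p x = (\<Sum>k<m. (\<Sum>j<m. L2_inner S (e m) (u j) * a j k) * e k x)"
      unfolding p_def u_def sum_distrib_left sum_distrib_right
      by (subst sum.swap) (simp add: mult.assoc)
    then show ?thesis by (simp add: z_def b_def sum_negf)
  qed
  have zz: "L2_inner S z z > 0"
  proof (rule ccontr)
    assume "\<not> L2_inner S z z > 0"
    then have "AE x in lebesgue_on S. z x = 0"
      using L2_inner_self_nonneg[of S z] by (intro L2_inner_self_eq_0 zsi) auto
    then have "\<forall>k<Suc m. b k = 0" unfolding zb by (rule Suc.prems(2))
    then show False by (auto simp: b_def dest: spec[of _ m])
  qed
  define s where "s = sqrt (L2_inner S z z)"
  have s: "s > 0" "s * s = L2_inner S z z" using zz by (auto simp: s_def)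
  define a' where "a' = (\<lambda>j k. if j < m then (if k < m then a j k else 0) else b k / s)"
  have u1: "(\<lambda>x. \<Sum>k<Suc m. a' j k * e k x) = (if j < m then u j else (\<lambda>x. z x / s))" for j
    by (auto simp: a'_def u_def zb fun_eq_iff sum_divide_distrib add_divide_distrib)
  have "L2_inner S (\<lambda>x. z x / s) (u i) = 0" "L2_inner S (u i) (\<lambda>x. z x / s) = 0" if "i < m" for i
    using zu[OF that] by (simp_all add: L2_inner_def mult.commute)
  moreover have "L2_inner S (\<lambda>x. z x / s) (\<lambda>x. z x / s) = 1"
    using s zz by (simp add: L2_inner_def)
  ultimately have "\<forall>i<Suc m. \<forall>j<Suc m. L2_inner S (if i < m then u i else (\<lambda>x. z x / s)) (if j < m then u j else (\<lambda>x. z x / s)) = of_bool (i = j)"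
    using a by (auto simp: u_def less_Suc_eq)
  then show ?case unfolding u1[symmetric] by blast
qed auto

text \<open>For each \<mu> the eigenspace has as many basis functions as \<mu> has indices in
  \<open>ev\<close>, and a bijection distributes an orthonormal basis over these indices. Different
  eigenvalues are orthogonal anyway.\<close>

lemma orthonormal_eigenfunctions:
  fixes ev :: "nat \<Rightarrow> real"
  assumes S: "open S" "bounded S" and ev: "dirichlet_eigenvalues l S ev"
  shows "\<exists>u. (\<forall>i\<ge>1. weak_eigenfunction l S (ev i) (u i)) \<and>
     (\<forall>i\<ge>1. \<forall>j\<ge>1. L2_inner S (u i) (u j) = of_bool (i = j))"
proof -
  define N where "N = (\<lambda>\<mu>. {i \<in> {1..}. ev i = \<mu>})"
  have fin: "finite (N \<mu>)" and dim: "has_ae_dim S (eigenspace l S \<mu>) (card (N \<mu>))" for \<mu>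
    using ev by (auto simp: dirichlet_eigenvalues_def N_def)
  have "\<exists>w. \<forall>i<card (N \<mu>). weak_eigenfunction l S \<mu> (w i) \<and>
      (\<forall>j<card (N \<mu>). L2_inner S (w i) (w j) = of_bool (i = j))" for \<mu>
  proof -
    obtain e where e: "\<forall>j<card (N \<mu>). e j \<in> eigenspace l S \<mu>"
      and ind: "\<And>c::nat \<Rightarrow> real. AE x in lebesgue_on S. (\<Sum>j<card (N \<mu>). c j * e j x) = 0 \<Longrightarrow> \<forall>j<card (N \<mu>). c j = 0"
      using dim[of \<mu>] unfolding has_ae_dim_def by blast
    have we: "weak_eigenfunction l S \<mu> (e j)" if "j < card (N \<mu>)" for j
      using eigenspace_weak_eigenfunction[OF S ev] e that by blast
    obtain a where "\<forall>i<card (N \<mu>). \<forall>j<card (N \<mu>). L2_inner S (\<lambda>x. \<Sum>k<card (N \<mu>). a i k * e k x)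
        (\<lambda>x. \<Sum>k<card (N \<mu>). a j k * e k x) = of_bool (i = j)"
      using gram_schmidt_L2[of "card (N \<mu>)" e S] we ind weak_eigenfunction_square_integrable by blast
    moreover have "weak_eigenfunction l S \<mu> (\<lambda>x. \<Sum>k<card (N \<mu>). a i k * e k x)" for i
      using we by (intro weak_eigenfunction_sum S) auto
    ultimately show ?thesis by (intro exI[of _ "\<lambda>i x. \<Sum>k<card (N \<mu>). a i k * e k x"]) auto
  qed
  then obtain W where W: "\<And>\<mu> i. i < card (N \<mu>) \<Longrightarrow> weak_eigenfunction l S \<mu> (W \<mu> i)"
      "\<And>\<mu> i j. i < card (N \<mu>) \<Longrightarrow> j < card (N \<mu>) \<Longrightarrow> L2_inner S (W \<mu> i) (W \<mu> j) = of_bool (i = j)"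
    by metis
  have "\<forall>\<mu>. \<exists>h. bij_betw h (N \<mu>) {0..<card (N \<mu>)}"
    using ex_bij_betw_finite_nat[OF fin] by blast
  then obtain h where h: "\<And>\<mu>. bij_betw (h \<mu>) (N \<mu>) {0..<card (N \<mu>)}" by metis
  define u where "u = (\<lambda>i. W (ev i) (h (ev i) i))"
  have lt: "h (ev i) i < card (N (ev i))" if "i \<ge> 1" for i
    using bij_betwE[OF h[of "ev i"]] that by (auto simp: N_def)
  have 1: "weak_eigenfunction l S (ev i) (u i)" if "i \<ge> 1" for i
    using W(1) lt[OF that] by (simp add: u_def)
  have "L2_inner S (u i) (u j) = of_bool (i = j)" if i: "i \<ge> 1" and j: "j \<ge> 1" for i j
  proof (cases "ev i = ev j")
    case True
    have "h (ev i) i = h (ev i) j \<longleftrightarrow> i = j"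
      using h[of "ev i"] i j True by (auto simp: bij_betw_def N_def dest: inj_onD)
    then show ?thesis using W(2)[OF lt[OF i], of "h (ev i) j"] lt[OF j] True by (simp add: u_def)
  next
    case False
    then show ?thesis using weak_eigenfunction_orthogonal[OF S 1[OF i] 1[OF j]] by auto
  qed
  with 1 show ?thesis by (intro exI[of _ u]) auto
qed

section \<open>The spectral density of an orthonormal family\<close>

text \<open>Values of \<open>u\<close> outside \<open>S\<close> are arbitrary, so the extension by
  zero is built in.\<close>

definition fourier_on :: "(real^'n::finite) set \<Rightarrow> (real^'n \<Rightarrow> real) \<Rightarrow> real^'n \<Rightarrow> complex" where
  "fourier_on S u = rfourier (\<lambda>x. indicator S x * u x)"

context
  fixes S :: "(real^'n::finite) set"
  assumes S: "open S" "bounded S"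
begin

lemma square_integrable_cos_sin:
  "(\<lambda>x. cos (\<xi> \<bullet> x)) \<in> square_integrable S" "(\<lambda>x. sin (\<xi> \<bullet> x)) \<in> square_integrable S"
  by (intro square_integrable_continuous S continuous_intros)+

lemma square_integrable_integrable:
  assumes "u \<in> square_integrable S"
  shows "integrable (lebesgue_on S) u"
proof -
  have "(\<lambda>x. 1) \<in> square_integrable S" by (intro square_integrable_continuous S continuous_intros)
  from square_integrable_mult[OF assms this] show ?thesis by simp
qed

text \<open>Since \<open>S\<close> is bounded, cosine and sine are square integrable on it. As
  pairings with them the values of the transform are accessible to Bessel's inequality and converge
  along sequences that converge in the mean.\<close>

lemma fourier_on_eq:
  assumes u: "u \<in> square_integrable S"
  shows "fourier_on S u \<xi> = Complex (L2_inner S u (\<lambda>x. cos (\<xi> \<bullet> x))) (- L2_inner S u (\<lambda>x. sin (\<xi> \<bullet> x)))"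
proof -
  have "fourier_on S u \<xi> = (\<integral>x. indicator S x *\<^sub>R (complex_of_real (u x) * cis (- (\<xi> \<bullet> x))) \<partial>lebesgue)"
    unfolding fourier_on_def fourier_def by (simp add: scaleR_conv_of_real mult.assoc)
  also have "\<dots> = (\<integral>x. complex_of_real (u x) * cis (- (\<xi> \<bullet> x)) \<partial>lebesgue_on S)"
    using S(1) by (intro integral_restrict_space[symmetric]) (simp add: borel_open)
  also have "\<dots> = (\<integral>x. complex_of_real (u x * cos (\<xi> \<bullet> x)) - \<i> * complex_of_real (u x * sin (\<xi> \<bullet> x)) \<partial>lebesgue_on S)"
    by (intro Bochner_Integration.integral_cong refl) (simp add: complex_eq_iff)
  also have "\<dots> = complex_of_real (L2_inner S u (\<lambda>x. cos (\<xi> \<bullet> x))) - \<i> * complex_of_real (L2_inner S u (\<lambda>x. sin (\<xi> \<bullet> x)))"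
    unfolding L2_inner_def integral_complex_of_real[symmetric]
    by (subst Bochner_Integration.integral_diff)
       (use square_integrable_mult[OF u square_integrable_cos_sin(1)[of \<xi>]] square_integrable_mult[OF u square_integrable_cos_sin(2)[of \<xi>]] in
        \<open>simp_all del: of_real_mult\<close>)
  finally show ?thesis by (simp add: complex_eq_iff)
qed

lemma fourier_on_diff:
  assumes "u \<in> square_integrable S" "w \<in> square_integrable S"
  shows "fourier_on S (\<lambda>x. u x - w x) \<xi> = fourier_on S u \<xi> - fourier_on S w \<xi>"
  unfolding fourier_on_eq[OF assms(1)] fourier_on_eq[OF assms(2)] fourier_on_eq[OF square_integrable_diff[OF assms]]
  by (simp add: complex_eq_iff L2_inner_diff[OF assms square_integrable_cos_sin(1)] L2_inner_diff[OF assms square_integrable_cos_sin(2)])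

lemma continuous_on_fourier_on:
  assumes "u \<in> square_integrable S"
  shows "continuous_on UNIV (fourier_on S u)"
  unfolding fourier_on_def
proof (intro continuous_on_fourier integrable_of_real)
  show "integrable lebesgue (\<lambda>x. indicator S x * u x)"
    using square_integrable_integrable[OF assms] S(1) by (subst (asm) integrable_restrict_space) (auto simp: borel_open)
qed

lemma fourier_on_test_function:
  assumes "\<phi> \<in> test_functions S"
  shows "fourier_on S \<phi> = rfourier \<phi>"
proof -
  have "indicator S x * \<phi> x = \<phi> x" for x
    using assms by (auto simp: test_functions_def indicator_def)
  then show ?thesis by (simp only: fourier_on_def)
qed

lemma fourier_on_tendsto:
  assumes "L2_tendsto S f u"
  shows "(\<lambda>n. fourier_on S (f n) \<xi>) \<longlonglongrightarrow> fourier_on S u \<xi>"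
proof -
  have si: "u \<in> square_integrable S" "f n \<in> square_integrable S" for n using assms by (auto simp: L2_tendsto_def)
  show ?thesis
    unfolding fourier_on_eq[OF si(1)] fourier_on_eq[OF si(2)]
    by (intro tendsto_Complex tendsto_minus L2_tendsto_inner assms L2_tendsto_const square_integrable_cos_sin)
qed

end

text \<open>Carries integral bounds from test functions to their limits. The weight \<open>w\<close>
  is 1 for the mass and \<open>norm \<xi> ^ (2 * l)\<close> for the energy.\<close>

lemma Fatou_weighted_norm:
  fixes g :: "nat \<Rightarrow> 'a::euclidean_space \<Rightarrow> complex"
  assumes lim: "\<And>x. (\<lambda>n. g n x) \<longlonglongrightarrow> G x" and [measurable]: "G \<in> borel_measurable borel"
    and w: "\<And>x. 0 \<le> w x" "w \<in> borel_measurable borel"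
    and I: "\<And>n. has_bochner_integral lborel (\<lambda>x. w x * (norm (g n x))\<^sup>2) (I n)" and L: "I \<longlonglongrightarrow> L"
  shows "integrable lborel (\<lambda>x. w x * (norm (G x))\<^sup>2)" "(LBINT x. w x * (norm (G x))\<^sup>2) \<le> L"
proof -
  note [measurable] = w(2)
  have int: "integrable lborel (\<lambda>x. w x * (norm (g n x))\<^sup>2)" for n using I by (simp add: has_bochner_integral_iff)
  have nn: "0 \<le> I n" for n
  proof -
    have "0 \<le> (LBINT x. w x * (norm (g n x))\<^sup>2)" using w by (intro integral_nonneg_AE) simp
    then show ?thesis using I[of n] by (simp add: has_bochner_integral_iff)
  qed
  then have L0: "0 \<le> L" using L by (meson LIMSEQ_le_const)
  have "(\<integral>\<^sup>+x. ennreal (w x * (norm (G x))\<^sup>2) \<partial>lborel) = (\<integral>\<^sup>+x. liminf (\<lambda>n. ennreal (w x * (norm (g n x))\<^sup>2)) \<partial>lborel)"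
  proof (intro nn_integral_cong)
    fix x
    have "(\<lambda>n. ennreal (w x * (norm (g n x))\<^sup>2)) \<longlonglongrightarrow> ennreal (w x * (norm (G x))\<^sup>2)"
      by (intro tendsto_ennrealI tendsto_intros lim)
    then show "ennreal (w x * (norm (G x))\<^sup>2) = liminf (\<lambda>n. ennreal (w x * (norm (g n x))\<^sup>2))"
      by (simp add: lim_imp_Liminf)
  qed
  also have "\<dots> \<le> liminf (\<lambda>n. \<integral>\<^sup>+x. ennreal (w x * (norm (g n x))\<^sup>2) \<partial>lborel)"
    using borel_measurable_integrable[OF int] by (intro nn_integral_liminf) simp
  also have "(\<lambda>n. \<integral>\<^sup>+x. ennreal (w x * (norm (g n x))\<^sup>2) \<partial>lborel) = (\<lambda>n. ennreal (I n))"
    using int I w by (subst nn_integral_eq_integral) (auto simp: has_bochner_integral_iff)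
  also have "liminf (\<lambda>n. ennreal (I n)) = ennreal L"
    by (intro lim_imp_Liminf tendsto_ennrealI L) simp
  finally have le: "(\<integral>\<^sup>+x. ennreal (w x * (norm (G x))\<^sup>2) \<partial>lborel) \<le> ennreal L" .
  show "integrable lborel (\<lambda>x. w x * (norm (G x))\<^sup>2)"
  proof (rule integrableI_bounded)
    show "(\<integral>\<^sup>+x. ennreal (norm (w x * (norm (G x))\<^sup>2)) \<partial>lborel) < \<infinity>"
      using le w by (auto intro: le_less_trans simp: abs_mult)
  qed measurable
  then have "ennreal (LBINT x. w x * (norm (G x))\<^sup>2) \<le> ennreal L"
    using le w by (subst nn_integral_eq_integral[symmetric]) auto
  then show "(LBINT x. w x * (norm (G x))\<^sup>2) \<le> L" using L0 by simp
qed

context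
  fixes S :: "(real^'n::finite) set"
  assumes S: "open S" "bounded S"
begin

text \<open>The factor 1 is the weight required by \<open>Fatou_weighted_norm\<close>.\<close>

lemma plancherel_test:
  assumes "\<phi> \<in> test_functions S"
  shows "has_bochner_integral lborel (\<lambda>\<xi>. 1 * (norm (fourier_on S \<phi> \<xi>))\<^sup>2) ((2 * pi) ^ CARD('n) * L2_inner S \<phi> \<phi>)"
  using plancherel_test_functions[OF assms assms] L2_inner_test_function[OF S(1) assms test_function_integrable(1)[OF assms]]
  by (simp add: fourier_on_test_function[OF S assms] power2_norm_eq_inner)

text \<open>Fatou's lemma gives only the upper bound, whereas the bathtub principle needs mass from
  below. Applied to \<open>u - \<phi> n\<close> it shows that the error is small, and \<open>(a +
  b)\<^sup>2 \<le> (1 + \<delta>) * a\<^sup>2 + (1 + 1 / \<delta>) * b\<^sup>2\<close> transfers the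
  identity for \<open>\<phi> n\<close> to \<open>u\<close>: first \<open>n\<close> tends to
  infinity, then \<delta> to 0.\<close>

lemma plancherel_on:
  assumes t: "\<And>n. \<phi> n \<in> test_functions S" and lim: "L2_tendsto S \<phi> u"
  shows "has_bochner_integral lborel (\<lambda>\<xi>. (norm (fourier_on S u \<xi>))\<^sup>2) ((2 * pi) ^ CARD('n) * L2_inner S u u)"
proof -
  let ?F = "fourier_on S" and ?c = "(2 * pi) ^ CARD('n)"
  let ?J = "LBINT \<xi>. (norm (?F u \<xi>))\<^sup>2"
  have usi: "u \<in> square_integrable S" and si: "\<phi> n \<in> square_integrable S" for n
    using lim by (auto simp: L2_tendsto_def)
  have meas: "?F f \<in> borel_measurable borel" if "f \<in> square_integrable S" for f
    by (intro borel_measurable_continuous_onI continuous_on_fourier_on S that)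
  note [measurable] = meas[OF usi] meas[OF si]
  have 1: "integrable lborel (\<lambda>\<xi>. 1 * (norm (?F u \<xi>))\<^sup>2)" "(LBINT \<xi>. 1 * (norm (?F u \<xi>))\<^sup>2) \<le> ?c * L2_inner S u u"
    using Fatou_weighted_norm[OF fourier_on_tendsto[OF S lim] meas[OF usi] _ _ plancherel_test[OF t]
        tendsto_mult_left[OF L2_tendsto_inner[OF lim lim]]] by simp_all
  define d where "d = (\<lambda>n x. u x - \<phi> n x)"
  have dsi: "d n \<in> square_integrable S" for n unfolding d_def by (intro square_integrable_diff usi si)
  have 2: "integrable lborel (\<lambda>\<xi>. 1 * (norm (?F (d n) \<xi>))\<^sup>2)"
    "(LBINT \<xi>. 1 * (norm (?F (d n) \<xi>))\<^sup>2) \<le> ?c * L2_inner S (d n) (d n)" for n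
  proof -
    have tm: "(\<lambda>x. 1 * \<phi> m x + (- 1) * \<phi> n x) \<in> test_functions S" for m by (intro test_functions_lincomb t)
    have "L2_tendsto S (\<lambda>m x. 1 * \<phi> m x + (- 1) * \<phi> n x) (\<lambda>x. 1 * u x + (- 1) * \<phi> n x)"
      by (intro L2_tendsto_lincomb lim L2_tendsto_const si)
    then have lm: "L2_tendsto S (\<lambda>m x. 1 * \<phi> m x + (- 1) * \<phi> n x) (d n)" by (simp add: d_def)
    show "integrable lborel (\<lambda>\<xi>. 1 * (norm (?F (d n) \<xi>))\<^sup>2)"
      "(LBINT \<xi>. 1 * (norm (?F (d n) \<xi>))\<^sup>2) \<le> ?c * L2_inner S (d n) (d n)"
      using Fatou_weighted_norm[OF fourier_on_tendsto[OF S lm] meas[OF dsi] _ _ plancherel_test[OF tm]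
          tendsto_mult_left[OF L2_tendsto_inner[OF lm lm]]] by simp_all
  qed
  have "?c * L2_inner S u u \<le> (1 + \<delta>) * ?J" if \<delta>: "\<delta> > 0" for \<delta>
  proof (rule LIMSEQ_le)
    have dl: "(\<lambda>n. L2_inner S (d n) (d n)) \<longlonglongrightarrow> 0"
      using lim by (simp add: L2_tendsto_def d_def L2_inner_def power2_commute flip: power2_eq_square)
    show "(\<lambda>n. ?c * L2_inner S (\<phi> n) (\<phi> n)) \<longlonglongrightarrow> ?c * L2_inner S u u"
      by (intro tendsto_mult_left L2_tendsto_inner lim)
    have "(\<lambda>n. (1 + \<delta>) * ?J + (1 + 1 / \<delta>) * (?c * L2_inner S (d n) (d n))) \<longlonglongrightarrow>
      (1 + \<delta>) * ?J + (1 + 1 / \<delta>) * (?c * 0)"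
      by (intro tendsto_intros dl)
    then show "(\<lambda>n. (1 + \<delta>) * ?J + (1 + 1 / \<delta>) * (?c * L2_inner S (d n) (d n))) \<longlonglongrightarrow>
      (1 + \<delta>) * ?J" by simp
    have "?c * L2_inner S (\<phi> n) (\<phi> n) \<le> (1 + \<delta>) * ?J + (1 + 1 / \<delta>) * (?c * L2_inner S (d n) (d n))" for n
    proof -
      have "?c * L2_inner S (\<phi> n) (\<phi> n) = (LBINT \<xi>. (norm (?F (\<phi> n) \<xi>))\<^sup>2)"
        using plancherel_test[OF t] by (simp add: has_bochner_integral_iff)
      also have "\<dots> \<le> (LBINT \<xi>. (1 + \<delta>) * (norm (?F u \<xi>))\<^sup>2 + (1 + 1 / \<delta>) * (norm (?F (d n) \<xi>))\<^sup>2)"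
      proof (rule integral_mono)
        fix \<xi>
        let ?a = "norm (?F u \<xi>)" and ?b = "norm (?F (d n) \<xi>)"
        have "?F (\<phi> n) \<xi> = ?F u \<xi> - ?F (d n) \<xi>"
          unfolding d_def fourier_on_diff[OF S usi si] by simp
        then have "norm (?F (\<phi> n) \<xi>) \<le> ?a + ?b" using norm_triangle_ineq4 by metis
        then have "(norm (?F (\<phi> n) \<xi>))\<^sup>2 \<le> (?a + ?b)\<^sup>2" by (intro power_mono) auto
        also have "(?a + ?b)\<^sup>2 \<le> (1 + \<delta>) * ?a\<^sup>2 + (1 + 1 / \<delta>) * ?b\<^sup>2"
        proof -
          have "(1 + \<delta>) * ?a\<^sup>2 + (1 + 1 / \<delta>) * ?b\<^sup>2 - (?a + ?b)\<^sup>2 = (\<delta> * ?a - ?b)\<^sup>2 / \<delta>"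
            using \<delta> by (simp add: power2_eq_square field_simps)
          also have "\<dots> \<ge> 0" using \<delta> by simp
          finally show ?thesis by simp
        qed
        finally show "(norm (?F (\<phi> n) \<xi>))\<^sup>2 \<le> (1 + \<delta>) * ?a\<^sup>2 + (1 + 1 / \<delta>) * ?b\<^sup>2" .
      qed (use 1 2 plancherel_test[OF t] in \<open>auto simp: has_bochner_integral_iff\<close>)
      also have "\<dots> = (1 + \<delta>) * ?J + (1 + 1 / \<delta>) * (LBINT \<xi>. (norm (?F (d n) \<xi>))\<^sup>2)"
        using 1(1) 2(1)[of n] by simp
      also have "\<dots> \<le> (1 + \<delta>) * ?J + (1 + 1 / \<delta>) * (?c * L2_inner S (d n) (d n))"
        using 2(2)[of n] \<delta> by (intro add_left_mono mult_left_mono) auto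
      finally show ?thesis .
    qed
    then show "\<exists>N. \<forall>n\<ge>N. ?c * L2_inner S (\<phi> n) (\<phi> n) \<le> (1 + \<delta>) * ?J + (1 + 1 / \<delta>) * (?c * L2_inner S (d n) (d n))"
      by blast
  qed
  then have ge: "?c * L2_inner S u u \<le> (1 + \<delta>) * ?J" if "\<delta> > 0" for \<delta> using that .
  have J0: "?J \<ge> 0" by simp
  have "?c * L2_inner S u u \<le> ?J"
  proof (rule field_le_epsilon)
    fix e :: real assume e: "e > 0"
    have "?J + 1 > 0" using J0 by linarith
    \<comment> \<open>With \<open>\<delta> = e / (?J + 1)\<close> the excess
      \<open>\<delta> * ?J\<close> is at most \<open>e\<close>; the summand 1 covers
      \<open>?J = 0\<close>.\<close>
    then have "e / (?J + 1) * ?J \<le> e" using e unfolding times_divide_eq_left by (simp only: pos_divide_le_eq) simp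
    then show "?c * L2_inner S u u \<le> ?J + e"
      using ge[of "e / (?J + 1)"] e J0 by (simp add: distrib_right)
  qed
  then show ?thesis using 1 by (simp add: has_bochner_integral_iff)
qed

text \<open>For the moment an upper bound is enough, since the moment is what bounds the eigenvalues
  from below. The limit in Fatou's lemma is evaluated by \<open>energy_identity\<close> for the pair
  \<open>u\<close>, \<open>u\<close>.\<close>

lemma fourier_energy_on:
  assumes u: "weak_eigenfunction l S \<mu> u"
  shows "has_bochner_integral lborel (\<lambda>\<xi>. (norm (fourier_on S u \<xi>))\<^sup>2) ((2 * pi) ^ CARD('n) * L2_inner S u u)"
    and "integrable lborel (\<lambda>\<xi>. norm \<xi> ^ (2 * l) * (norm (fourier_on S u \<xi>))\<^sup>2)"
    and "(LBINT \<xi>. norm \<xi> ^ (2 * l) * (norm (fourier_on S u \<xi>))\<^sup>2) \<le> (2 * pi) ^ CARD('n) * (\<mu> * L2_inner S u u)"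
proof -
  obtain v \<phi> where A: "H0_approx l S u v \<phi>" using u by (auto simp: weak_eigenfunction_def)
  then have t: "\<phi> n \<in> test_functions S" and lim: "L2_tendsto S \<phi> u"
    and D: "\<And>is. is \<in> words l \<Longrightarrow> L2_tendsto S (\<lambda>n. pdiffs is (\<phi> n)) (v is)" for n
    by (auto simp: H0_approx_def)
  have usi: "u \<in> square_integrable S" using lim by (simp add: L2_tendsto_def)
  show "has_bochner_integral lborel (\<lambda>\<xi>. (norm (fourier_on S u \<xi>))\<^sup>2) ((2 * pi) ^ CARD('n) * L2_inner S u u)"
    by (rule plancherel_on[OF t lim])
  have I: "has_bochner_integral lborel (\<lambda>\<xi>. norm \<xi> ^ (2 * l) * (norm (fourier_on S (\<phi> n) \<xi>))\<^sup>2)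
      ((2 * pi) ^ CARD('n) * (\<Sum>is\<in>words l. L2_inner S (pdiffs is (\<phi> n)) (pdiffs is (\<phi> n))))" for n
    using energy_test_functions(1)[OF t t, of l n n]
    by (simp add: fourier_on_test_function[OF S t] power2_norm_eq_inner L2_inner_test_function[OF S(1)]
        test_functions_pdiffs t test_function_integrable(1)[of _ S])
  have L: "(\<lambda>n. (2 * pi) ^ CARD('n) * (\<Sum>is\<in>words l. L2_inner S (pdiffs is (\<phi> n)) (pdiffs is (\<phi> n)))) \<longlonglongrightarrow>
      (2 * pi) ^ CARD('n) * (\<Sum>is\<in>words l. L2_inner S (v is) (v is))"
    by (intro tendsto_mult_left tendsto_sum L2_tendsto_inner D)
  have m: "fourier_on S u \<in> borel_measurable borel"
    by (intro borel_measurable_continuous_onI continuous_on_fourier_on S usi)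
  have w: "(0::real) \<le> norm \<xi> ^ (2 * l)" "(\<lambda>\<xi>. norm \<xi> ^ (2 * l)) \<in> borel_measurable borel" for \<xi> :: "real^'n" by simp_all
  note F = Fatou_weighted_norm[OF fourier_on_tendsto[OF S lim] m w I L]
  show "integrable lborel (\<lambda>\<xi>. norm \<xi> ^ (2 * l) * (norm (fourier_on S u \<xi>))\<^sup>2)" by (rule F(1))
  show "(LBINT \<xi>. norm \<xi> ^ (2 * l) * (norm (fourier_on S u \<xi>))\<^sup>2) \<le> (2 * pi) ^ CARD('n) * (\<mu> * L2_inner S u u)"
    using F(2) energy_identity[OF S A u A] by simp
qed

section \<open>Height, slope and moment of the spectral density\<close>

lemma bessel_L2:
  assumes A: "finite A" and u: "\<And>i. i \<in> A \<Longrightarrow> u i \<in> square_integrable S"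
    and on: "\<And>i j. i \<in> A \<Longrightarrow> j \<in> A \<Longrightarrow> L2_inner S (u i) (u j) = of_bool (i = j)"
    and g: "g \<in> square_integrable S"
  shows "(\<Sum>i\<in>A. (L2_inner S (u i) g)\<^sup>2) \<le> L2_inner S g g"
proof -
  define p where "p = (\<lambda>x. \<Sum>i\<in>A. L2_inner S (u i) g * u i x)"
  have p: "p \<in> square_integrable S" unfolding p_def by (intro square_integrable_sum A u)
  let ?S = "\<Sum>i\<in>A. (L2_inner S (u i) g)\<^sup>2"
  have pz: "L2_inner S p z = (\<Sum>i\<in>A. L2_inner S (u i) g * L2_inner S (u i) z)" if "z \<in> square_integrable S" for z
    unfolding p_def by (rule L2_inner_sum[OF A u that])
  have pg: "L2_inner S p g = ?S" unfolding pz[OF g] by (simp add: power2_eq_square)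
  have pu: "L2_inner S p (u i) = L2_inner S (u i) g" if "i \<in> A" for i
  proof -
    have "L2_inner S p (u i) = (\<Sum>j\<in>A. if j = i then L2_inner S (u i) g else 0)"
      unfolding pz[OF u[OF that]] by (intro sum.cong) (auto simp: on that)
    then show ?thesis using A that by simp
  qed
  have pp: "L2_inner S p p = ?S"
    unfolding pz[OF p] by (intro sum.cong refl) (simp add: L2_inner_commute[of _ _ p] pu power2_eq_square)
  have d: "(\<lambda>x. g x - p x) \<in> square_integrable S" by (intro square_integrable_diff g p)
  have "0 \<le> L2_inner S (\<lambda>x. g x - p x) (\<lambda>x. g x - p x)" by (rule L2_inner_self_nonneg)
  also have "\<dots> = L2_inner S g (\<lambda>x. g x - p x) - L2_inner S p (\<lambda>x. g x - p x)"
    by (rule L2_inner_diff[OF g p d])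
  also have "L2_inner S g (\<lambda>x. g x - p x) = L2_inner S g g - L2_inner S p g"
    by (subst L2_inner_commute) (rule L2_inner_diff[OF g p g])
  also have "L2_inner S p (\<lambda>x. g x - p x) = L2_inner S g p - L2_inner S p p"
    by (subst L2_inner_commute) (rule L2_inner_diff[OF g p p])
  finally show ?thesis using pg pp by (simp add: L2_inner_commute)
qed

lemma norm_fourier_on_diff:
  assumes u: "u \<in> square_integrable S"
  shows "(norm (fourier_on S u \<xi> - fourier_on S u \<eta>))\<^sup>2 =
    (L2_inner S u (\<lambda>x. cos (\<xi> \<bullet> x) - cos (\<eta> \<bullet> x)))\<^sup>2 + (L2_inner S u (\<lambda>x. sin (\<xi> \<bullet> x) - sin (\<eta> \<bullet> x)))\<^sup>2"
proof -
  note cs = square_integrable_cos_sin[OF S]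
  have "L2_inner S u (\<lambda>x. cos (\<xi> \<bullet> x) - cos (\<eta> \<bullet> x)) = L2_inner S u (\<lambda>x. cos (\<xi> \<bullet> x)) - L2_inner S u (\<lambda>x. cos (\<eta> \<bullet> x))"
    unfolding L2_inner_commute[of S u] by (intro L2_inner_diff cs u)
  moreover have "L2_inner S u (\<lambda>x. sin (\<xi> \<bullet> x) - sin (\<eta> \<bullet> x)) = L2_inner S u (\<lambda>x. sin (\<xi> \<bullet> x)) - L2_inner S u (\<lambda>x. sin (\<eta> \<bullet> x))"
    unfolding L2_inner_commute[of S u] by (intro L2_inner_diff cs u)
  ultimately show ?thesis
    unfolding fourier_on_eq[OF S u] by (simp add: cmod_power2 power2_commute)
qed

text \<open>A chord of the unit circle is no longer than its arc.\<close>

lemma cos_sin_dist_le: "(cos a - cos b)\<^sup>2 + (sin a - sin b)\<^sup>2 \<le> (a - b)\<^sup>2" for a b :: real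
proof -
  have "(cos a - cos b)\<^sup>2 + (sin a - sin b)\<^sup>2 =
      ((sin a)\<^sup>2 + (cos a)\<^sup>2) + ((sin b)\<^sup>2 + (cos b)\<^sup>2) - 2 * (cos a * cos b + sin a * sin b)"
    by (simp add: power2_eq_square algebra_simps)
  also have "\<dots> = 2 - 2 * cos (2 * ((a - b) / 2))"
  proof -
    have "2 * ((a - b) / 2) = a - b" by simp
    then show ?thesis by (simp only: cos_diff sin_cos_squared_add)
  qed
  also have "\<dots> = 4 * (sin ((a - b) / 2))\<^sup>2" unfolding cos_double_sin by simp
  also have "\<dots> \<le> 4 * ((a - b) / 2)\<^sup>2"
    by (intro mult_left_mono abs_le_square_iff[THEN iffD1] abs_sin_x_le_abs_x) simp
  finally show ?thesis by (simp add: power2_eq_square)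
qed

context
  fixes A :: "'i set" and u :: "'i \<Rightarrow> real^'n \<Rightarrow> real"
  assumes A: "finite A" and u: "\<And>i. i \<in> A \<Longrightarrow> u i \<in> square_integrable S"
    and on: "\<And>i j. i \<in> A \<Longrightarrow> j \<in> A \<Longrightarrow> L2_inner S (u i) (u j) = of_bool (i = j)"
begin

text \<open>Bessel's inequality for cosine and sine separately; their squares add up to 1, which
  integrates to the volume whatever \<xi> and the number of functions are.\<close>

lemma sum_norm_fourier_le:
  "(\<Sum>i\<in>A. (norm (fourier_on S (u i) \<xi>))\<^sup>2) \<le> measure lebesgue S"
proof -
  note cs = square_integrable_cos_sin[OF S]
  have "(\<Sum>i\<in>A. (norm (fourier_on S (u i) \<xi>))\<^sup>2) =
      (\<Sum>i\<in>A. (L2_inner S (u i) (\<lambda>x. cos (\<xi> \<bullet> x)))\<^sup>2) + (\<Sum>i\<in>A. (L2_inner S (u i) (\<lambda>x. sin (\<xi> \<bullet> x)))\<^sup>2)"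
    unfolding sum.distrib[symmetric]
    by (intro sum.cong refl) (simp add: fourier_on_eq[OF S u] cmod_power2)
  also have "\<dots> \<le> L2_inner S (\<lambda>x. cos (\<xi> \<bullet> x)) (\<lambda>x. cos (\<xi> \<bullet> x)) + L2_inner S (\<lambda>x. sin (\<xi> \<bullet> x)) (\<lambda>x. sin (\<xi> \<bullet> x))"
    by (intro add_mono bessel_L2 A u on cs)
  also have "\<dots> = (\<integral>x. (cos (\<xi> \<bullet> x) * cos (\<xi> \<bullet> x) + sin (\<xi> \<bullet> x) * sin (\<xi> \<bullet> x)) \<partial>lebesgue_on S)"
    unfolding L2_inner_def by (intro Bochner_Integration.integral_add[symmetric] square_integrable_mult cs)
  also have "\<dots> = (\<integral>x. 1 \<partial>lebesgue_on S)"
    by (intro Bochner_Integration.integral_cong refl) (metis power2_eq_square sin_cos_squared_add2)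
  also have "\<dots> = measure lebesgue S"
    using S(1) by (simp add: measure_restrict_space borel_open)
  finally show ?thesis .
qed

text \<open>Bessel's inequality for the differences of the characters. The chord bound and
  Cauchy-Schwarz estimate the squared difference at \<open>x\<close> by
  \<open>(norm (\<xi> - \<eta>) * norm x)\<^sup>2\<close>, whence the moment of inertia.\<close>

lemma sum_norm_fourier_diff_le:
  "(\<Sum>i\<in>A. (norm (fourier_on S (u i) \<xi> - fourier_on S (u i) \<eta>))\<^sup>2) \<le>
     (norm (\<xi> - \<eta>))\<^sup>2 * integral\<^sup>L (lebesgue_on S) (\<lambda>x. (norm x)\<^sup>2)"
proof -
  let ?c = "\<lambda>x. cos (\<xi> \<bullet> x) - cos (\<eta> \<bullet> x)" and ?s = "\<lambda>x. sin (\<xi> \<bullet> x) - sin (\<eta> \<bullet> x)"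
  have cs: "?c \<in> square_integrable S" "?s \<in> square_integrable S"
    by (intro square_integrable_diff square_integrable_cos_sin S)+
  have "(\<Sum>i\<in>A. (norm (fourier_on S (u i) \<xi> - fourier_on S (u i) \<eta>))\<^sup>2) =
      (\<Sum>i\<in>A. (L2_inner S (u i) ?c)\<^sup>2) + (\<Sum>i\<in>A. (L2_inner S (u i) ?s)\<^sup>2)"
    unfolding sum.distrib[symmetric] by (intro sum.cong refl norm_fourier_on_diff u)
  also have "\<dots> \<le> L2_inner S ?c ?c + L2_inner S ?s ?s"
    by (intro add_mono bessel_L2 A u on cs)
  also have "\<dots> = (\<integral>x. ?c x * ?c x + ?s x * ?s x \<partial>lebesgue_on S)"
    unfolding L2_inner_def by (intro Bochner_Integration.integral_add[symmetric] square_integrable_mult cs)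
  also have "\<dots> \<le> (\<integral>x. (norm (\<xi> - \<eta>))\<^sup>2 * (norm x)\<^sup>2 \<partial>lebesgue_on S)"
  proof (rule integral_mono)
    show "integrable (lebesgue_on S) (\<lambda>x. ?c x * ?c x + ?s x * ?s x)"
      by (intro Bochner_Integration.integrable_add square_integrable_mult cs)
    show "integrable (lebesgue_on S) (\<lambda>x. (norm (\<xi> - \<eta>))\<^sup>2 * (norm x)\<^sup>2)"
      by (intro integrable_lebesgue_on_bounded S continuous_intros)
    fix x
    have "?c x * ?c x + ?s x * ?s x \<le> (\<xi> \<bullet> x - \<eta> \<bullet> x)\<^sup>2"
      using cos_sin_dist_le[of "\<xi> \<bullet> x" "\<eta> \<bullet> x"] by (simp add: power2_eq_square)
    also have "\<dots> \<le> (norm (\<xi> - \<eta>) * norm x)\<^sup>2"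
      using Cauchy_Schwarz_ineq2[of "\<xi> - \<eta>" x] by (simp add: inner_diff_left abs_le_square_iff[symmetric])
    finally show "?c x * ?c x + ?s x * ?s x \<le> (norm (\<xi> - \<eta>))\<^sup>2 * (norm x)\<^sup>2" by (simp add: power_mult_distrib)
  qed
  finally show ?thesis by simp
qed

text \<open>The sum of squares is \<open>a\<^sup>2\<close>, where \<open>a\<close> is the Euclidean
  norm of the vector of transforms. It is bounded by the root of the volume and has the root of the
  inertia as Lipschitz constant; the difference of two squares then brings in the factor 2 that
  appears in \<open>rho\<close>.\<close>

lemma sum_norm_fourier_lipschitz:
  "\<bar>(\<Sum>i\<in>A. (norm (fourier_on S (u i) \<xi>))\<^sup>2) - (\<Sum>i\<in>A. (norm (fourier_on S (u i) \<eta>))\<^sup>2)\<bar> \<le>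
     2 * sqrt (measure lebesgue S * integral\<^sup>L (lebesgue_on S) (\<lambda>x. (norm x)\<^sup>2)) * norm (\<xi> - \<eta>)"
proof -
  let ?V = "measure lebesgue S" and ?I = "integral\<^sup>L (lebesgue_on S) (\<lambda>x. (norm x)\<^sup>2)"
  define a where "a = (\<lambda>\<xi>. L2_set (\<lambda>i. norm (fourier_on S (u i) \<xi>)) A)"
  have a2: "(\<Sum>i\<in>A. (norm (fourier_on S (u i) \<xi>))\<^sup>2) = (a \<xi>)\<^sup>2" for \<xi>
    by (simp add: a_def L2_set_def sum_nonneg)
  have a0: "0 \<le> a \<xi>" for \<xi> by (simp add: a_def L2_set_nonneg)
  have aV: "a \<xi> \<le> sqrt ?V" for \<xi>
    using sum_norm_fourier_le[of \<xi>] by (intro real_le_rsqrt) (simp add: a2)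
  have tri: "a \<xi> \<le> a \<eta> + norm (\<xi> - \<eta>) * sqrt ?I" for \<xi> \<eta>
  proof -
    have "a \<xi> \<le> L2_set (\<lambda>i. norm (fourier_on S (u i) \<eta>) + norm (fourier_on S (u i) \<xi> - fourier_on S (u i) \<eta>)) A"
      unfolding a_def by (intro L2_set_mono) (metis add_diff_cancel_left' diff_add_cancel norm_triangle_ineq add.commute, simp)
    also have "\<dots> \<le> a \<eta> + L2_set (\<lambda>i. norm (fourier_on S (u i) \<xi> - fourier_on S (u i) \<eta>)) A"
      unfolding a_def by (rule L2_set_triangle_ineq)
    also have "L2_set (\<lambda>i. norm (fourier_on S (u i) \<xi> - fourier_on S (u i) \<eta>)) A \<le> sqrt ((norm (\<xi> - \<eta>))\<^sup>2 * ?I)"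
      unfolding L2_set_def by (intro real_sqrt_le_mono sum_norm_fourier_diff_le)
    finally show ?thesis by (simp add: real_sqrt_mult)
  qed
  have d: "\<bar>a \<xi> - a \<eta>\<bar> \<le> norm (\<xi> - \<eta>) * sqrt ?I"
    using tri[of \<xi> \<eta>] tri[of \<eta> \<xi>] by (simp add: norm_minus_commute)
  have "\<bar>(a \<xi>)\<^sup>2 - (a \<eta>)\<^sup>2\<bar> = \<bar>a \<xi> - a \<eta>\<bar> * (a \<xi> + a \<eta>)"
    using a0[of \<xi>] a0[of \<eta>] by (simp add: power2_eq_square square_diff_square_factored abs_mult)
  also have "\<dots> \<le> (norm (\<xi> - \<eta>) * sqrt ?I) * (sqrt ?V + sqrt ?V)"
    using d aV a0 by (intro mult_mono add_mono) (auto intro: add_nonneg_nonneg order_trans[OF abs_ge_zero])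
  finally show ?thesis by (simp add: a2 real_sqrt_mult mult_ac)
qed

end

lemma eigenvalue_sum_ge_moment:
  fixes ev :: "nat \<Rightarrow> real"
  assumes ev: "dirichlet_eigenvalues l S ev"
  defines "V \<equiv> measure lebesgue S" and "I \<equiv> integral\<^sup>L (lebesgue_on S) (\<lambda>x. (norm x)\<^sup>2)"
  defines "\<alpha> \<equiv> V / (2 * pi) ^ CARD('n)" and "\<rho> \<equiv> 2 / (2 * pi) ^ CARD('n) * sqrt (V * I)"
  assumes pos: "V > 0" "I > 0" and t: "t \<ge> 0"
    and mass: "unit_ball_vol CARD('n) * \<alpha> * unif_moment t (\<alpha> / \<rho>) CARD('n) \<le> k"
  shows "CARD('n) / (CARD('n) + 2 * l) * (unit_ball_vol CARD('n) * \<alpha> * unif_moment t (\<alpha> / \<rho>) (CARD('n) + 2 * l))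
    \<le> (\<Sum>i=1..k. ev i)"
proof -
  obtain u where u: "\<And>i. i \<ge> 1 \<Longrightarrow> weak_eigenfunction l S (ev i) (u i)"
    and on: "\<And>i j. i \<ge> 1 \<Longrightarrow> j \<ge> 1 \<Longrightarrow> L2_inner S (u i) (u j) = of_bool (i = j)"
    using orthonormal_eigenfunctions[OF S ev] by blast
  have usi: "u i \<in> square_integrable S" if "i \<ge> 1" for i
    using u[OF that] by (rule weak_eigenfunction_square_integrable)
  define c where "c = (2 * pi) ^ CARD('n)"
  let ?w = "\<lambda>i \<xi>. norm \<xi> ^ (2 * l) * (norm (fourier_on S (u i) \<xi>))\<^sup>2"
  have c: "c > 0" by (simp add: c_def)
  have \<alpha>: "\<alpha> > 0" and \<rho>: "\<rho> > 0" using pos c by (simp_all add: \<alpha>_def \<rho>_def c_def)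
  define f where "f = (\<lambda>\<xi>. (\<Sum>i=1..k. (norm (fourier_on S (u i) \<xi>))\<^sup>2) / c)"
  have one: "L2_inner S (u i) (u i) = 1" if "i \<ge> 1" for i using on[OF that that] by simp
  have F: "has_bochner_integral lborel (\<lambda>\<xi>. (norm (fourier_on S (u i) \<xi>))\<^sup>2) c"
    "integrable lborel (\<lambda>\<xi>. ?w i \<xi>)"
    "(LBINT \<xi>. ?w i \<xi>) \<le> c * ev i" if "i \<in> {1..k}" for i
    using fourier_energy_on[OF u[of i]] one[of i] that by (simp_all add: c_def)
  have "has_bochner_integral lborel f ((\<Sum>i=1..k. c) / c)"
    unfolding f_def by (intro has_bochner_integral_divide_zero has_bochner_integral_sum F)
  then have f1: "integrable lborel f" "integral\<^sup>L lborel f = k"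
    using c by (simp_all add: has_bochner_integral_iff)
  have feq: "norm \<xi> ^ (2 * l) * f \<xi> = (\<Sum>i=1..k. ?w i \<xi>) / c" for \<xi>
    by (simp add: f_def sum_distrib_left)
  have f2: "integrable lborel (\<lambda>\<xi>. norm \<xi> ^ (2 * l) * f \<xi>)"
    unfolding feq by (intro integrable_divide_zero Bochner_Integration.integrable_sum F)
  have "(LBINT \<xi>. norm \<xi> ^ (2 * l) * f \<xi>) =
      (\<Sum>i=1..k. (LBINT \<xi>. ?w i \<xi>)) / c"
    unfolding feq using F(2) by (simp add: Bochner_Integration.integral_sum)
  also have "\<dots> \<le> (\<Sum>i=1..k. c * ev i) / c"
    using c F(3) by (intro divide_right_mono sum_mono) auto
  also have "\<dots> = (\<Sum>i=1..k. ev i)" using c by (simp add: sum_distrib_left[symmetric])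
  finally have le: "(LBINT \<xi>. norm \<xi> ^ (2 * l) * f \<xi>) \<le> (\<Sum>i=1..k. ev i)" .
  \<comment> \<open>The radial moments of the profile in terms of \<open>unif_moment\<close>;
    dividing by the length \<open>\<alpha> / \<rho>\<close> turns the factor \<rho> into \<alpha>.
    The case \<open>p = 0\<close> is the mass, \<open>p = 2 * l\<close> the energy.\<close>
  have moment: "has_bochner_integral lborel (\<lambda>x::real^'n. norm x ^ p * profile \<alpha> \<rho> t (norm x))
      (CARD('n) / (CARD('n) + p) * (unit_ball_vol CARD('n) * \<alpha> * unif_moment t (\<alpha> / \<rho>) (CARD('n) + p)))" for p
  proof -
    define q where "q = CARD('n) + p"
    have q: "q > 0" by (simp add: q_def)
    have "real CARD('n) / real q * (unit_ball_vol CARD('n) * \<alpha> * unif_moment t (\<alpha> / \<rho>) q) =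
      real CARD('n) * unit_ball_vol CARD('n) * \<rho> * ((t + \<alpha> / \<rho>) ^ (q + 1) - t ^ (q + 1)) / (real q * (real q + 1))"
      using \<alpha> \<rho> q by (simp add: unif_moment_def add.commute mult_ac)
    then show ?thesis
      using has_bochner_integral_norm_power_profile[OF \<alpha> \<rho> t, of p, where 'a="real^'n"]
      by (simp add: q_def)
  qed
  have "(LBINT x. norm x ^ (2 * l) * profile \<alpha> \<rho> t (norm (x::real^'n))) \<le> (LBINT x. norm x ^ (2 * l) * f x)"
  proof (rule bathtub[OF _ _ _ _ \<alpha> \<rho> t f1(1) f2])
    show "f \<in> borel_measurable borel" using borel_measurable_integrable[OF f1(1)] by simp
    show "0 \<le> f x" for x using c by (simp add: f_def sum_nonneg)
    show "f x \<le> \<alpha>" for x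
      unfolding f_def \<alpha>_def V_def c_def[symmetric]
      using c usi on by (intro divide_right_mono sum_norm_fourier_le) auto
    show "\<bar>f x - f y\<bar> \<le> \<rho> * norm (x - y)" for x y
    proof -
      have "\<bar>f x - f y\<bar> = \<bar>(\<Sum>i=1..k. (norm (fourier_on S (u i) x))\<^sup>2) - (\<Sum>i=1..k. (norm (fourier_on S (u i) y))\<^sup>2)\<bar> / c"
        using c by (simp add: f_def diff_divide_distrib[symmetric])
      also have "\<dots> \<le> (2 * sqrt (V * I) * norm (x - y)) / c"
        unfolding V_def I_def using c usi on by (intro divide_right_mono sum_norm_fourier_lipschitz) auto
      finally show ?thesis by (simp add: \<rho>_def c_def)
    qed
    show "(LBINT x. profile \<alpha> \<rho> t (norm (x::real^'n))) \<le> (LBINT x. f x)"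
      using moment[of 0] mass f1(2) by (simp add: has_bochner_integral_iff)
  qed
  with le moment[of "2 * l"] show ?thesis by (simp add: has_bochner_integral_iff)
qed

end

text \<open>The function \<open>(norm x)\<^sup>2 - R\<^sup>2\<close> is negative inside the ball and
  positive outside, so among all sets its integral is smallest over the ball. For equal volumes the
  terms with \<open>R\<^sup>2\<close> cancel.\<close>

lemma inertia_ge_ball:
  fixes S :: "(real^'n::finite) set"
  assumes S: "open S" "bounded S" and R: "R \<ge> 0" and V: "measure lebesgue S = unit_ball_vol CARD('n) * R ^ CARD('n)"
  shows "CARD('n) / (CARD('n) + 2) * measure lebesgue S * R\<^sup>2 \<le> integral\<^sup>L (lebesgue_on S) (\<lambda>x. (norm x)\<^sup>2)"
proof -
  let ?n = "CARD('n)" and ?w = "unit_ball_vol CARD('n)"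
  have FTC: "(LBINT r. r ^ (?n - 1) * (r\<^sup>2 * indicator {0..R} r) * indicator {0..} r) = R ^ (?n + 2) / (?n + 2)"
  proof -
    have "(\<lambda>r. r ^ (?n - 1) * (r\<^sup>2 * indicator {0..R} r) * indicator {0..} r) = (\<lambda>r. r ^ (?n + 1) * indicator {0..R} r)"
    proof
      fix r :: real
      have "r ^ (?n - 1) * r\<^sup>2 = r ^ (?n - 1 + 2)" by (simp only: power_add)
      also have "?n - 1 + 2 = ?n + 1" using zero_less_card_finite[where 'a='n] by linarith
      finally show "r ^ (?n - 1) * (r\<^sup>2 * indicator {0..R} r) * indicator {0..} r = r ^ (?n + 1) * indicator {0..R} r"
        by (auto simp: indicator_def mult.assoc[symmetric])
    qed
    moreover have "(LBINT r. r ^ (?n + 1) * indicator {0..R} r) = R ^ (?n + 2) / (?n + 2) - 0 ^ (?n + 2) / (?n + 2)"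
    proof (rule integral_FTC_Icc_real[OF R])
      show "((\<lambda>r. r ^ (?n + 2) / real (?n + 2)) has_real_derivative x ^ (?n + 1)) (at x)" for x :: real
        using DERIV_cdivide[OF DERIV_pow[of "?n + 2" x], of "real (?n + 2)"] by simp
    qed (auto intro!: continuous_intros)
    ultimately show ?thesis by simp
  qed
  have "(LBINT x. 1 * ((norm x)\<^sup>2 * indicator {0..R} (norm (x::real^'n)))) = ?n * ?w * (R ^ (?n + 2) / (?n + 2))"
    by (subst integral_homogeneous_radial[where M = ?w]) (auto simp: emeasure_cball FTC[unfolded One_nat_def])
  also have "(\<lambda>x::real^'n. 1 * ((norm x)\<^sup>2 * indicator {0..R} (norm x))) = (\<lambda>x. indicator (cball 0 R) x * (norm x)\<^sup>2)"
    by (auto simp: indicator_def)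
  finally have B2: "(LBINT x. indicator (cball (0::real^'n) R) x * (norm x)\<^sup>2) = ?n / (?n + 2) * measure lebesgue S * R\<^sup>2"
    unfolding V by (simp add: power_add power2_eq_square)
  have B1: "(LBINT x. indicator (cball (0::real^'n) R) x) = measure lebesgue S"
    using content_cball[OF R, of "0::real^'n"] by (simp add: V)
  have "continuous_on (cball (0::real^'n) R) (\<lambda>x. (norm x)\<^sup>2 - R\<^sup>2)" "continuous_on (cball (0::real^'n) R) (\<lambda>x. (norm x)\<^sup>2)"
    by (intro continuous_intros)+
  then have iB: "integrable lborel (\<lambda>x. indicator (cball (0::real^'n) R) x * ((norm x)\<^sup>2 - R\<^sup>2))"
    "integrable lborel (\<lambda>x. indicator (cball (0::real^'n) R) x * (norm x)\<^sup>2)"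
    using borel_integrable_compact[OF compact_cball, of "0::real^'n" R "\<lambda>x. (norm x)\<^sup>2 - R\<^sup>2"]
      borel_integrable_compact[OF compact_cball, of "0::real^'n" R "\<lambda>x. (norm x)\<^sup>2"]
    by simp_all
  have iB0: "integrable lborel (indicator (cball (0::real^'n) R) :: _ \<Rightarrow> real)"
    by (intro integrable_real_indicator emeasure_bounded_finite bounded_cball) simp
  have iS: "integrable (lebesgue_on S) (\<lambda>x. (norm x)\<^sup>2 - R\<^sup>2)" "integrable (lebesgue_on S) (\<lambda>x. (norm x)\<^sup>2)"
    "integrable (lebesgue_on S) (\<lambda>x. R\<^sup>2)"
    by (intro integrable_lebesgue_on_bounded S continuous_intros)+
  have "(\<integral>x. indicator (cball (0::real^'n) R) x * ((norm x)\<^sup>2 - R\<^sup>2) \<partial>lebesgue) \<le> (\<integral>x. indicator S x * ((norm x)\<^sup>2 - R\<^sup>2) \<partial>lebesgue)"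
  proof (rule integral_mono)
    show "integrable lebesgue (\<lambda>x. indicator (cball (0::real^'n) R) x * ((norm x)\<^sup>2 - R\<^sup>2))"
      using iB(1) by (subst integrable_completion) (auto dest: borel_measurable_integrable)
    show "integrable lebesgue (\<lambda>x. indicator S x * ((norm x)\<^sup>2 - R\<^sup>2))"
      using iS(1) S(1) by (subst (asm) integrable_restrict_space) (auto simp: borel_open)
    show "indicator (cball 0 R) x * ((norm x)\<^sup>2 - R\<^sup>2) \<le> indicator S x * ((norm x)\<^sup>2 - R\<^sup>2)" for x :: "real^'n"
      using R by (auto simp: indicator_def power_mono not_le abs_le_square_iff[symmetric])
  qed
  also have "(\<integral>x. indicator S x * ((norm x)\<^sup>2 - R\<^sup>2) \<partial>lebesgue) = (\<integral>x. (norm x)\<^sup>2 - R\<^sup>2 \<partial>lebesgue_on S)"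
    using S(1) by (subst integral_restrict_space) (auto simp: borel_open)
  also have "\<dots> = (\<integral>x. (norm x)\<^sup>2 \<partial>lebesgue_on S) - measure lebesgue S * R\<^sup>2"
    using iS S(1) by (subst Bochner_Integration.integral_diff) (auto simp: measure_restrict_space borel_open)
  also have "(\<integral>x. indicator (cball (0::real^'n) R) x * ((norm x)\<^sup>2 - R\<^sup>2) \<partial>lebesgue) =
      (LBINT x. indicator (cball (0::real^'n) R) x * (norm x)\<^sup>2 - indicator (cball 0 R) x * R\<^sup>2)"
    using iB(1) by (subst integral_completion) (auto dest: borel_measurable_integrable simp: right_diff_distrib)
  also have "\<dots> = ?n / (?n + 2) * measure lebesgue S * R\<^sup>2 - measure lebesgue S * R\<^sup>2"
    using iB iB0 B1 B2 by (simp del: integral_indicator)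
  finally show ?thesis by simp
qed

section \<open>Lower bounds for the sums of eigenvalues\<close>

lemma pow4_powr:
  assumes "(x::real) > 0"
  shows "(x ^ 4) powr r = x powr (4 * r)"
proof -
  have "x ^ 4 = x powr 4" using assms by (simp only: powr_numeral)
  then show ?thesis by (simp only: powr_powr)
qed

lemma pow4_powr_numeral:
  fixes x :: real
  assumes "x > 0" "4 * r = numeral n"
  shows "(x ^ 4) powr r = x ^ numeral n"
  using assms by (simp only: pow4_powr powr_numeral)

lemma pow4_powr_plus:
  fixes x :: real
  assumes "x > 0" "4 * r = 2 * real l + c"
  shows "(x ^ 4) powr r = x ^ (2 * l) * x powr c"
proof -
  have "x powr (2 * real l) = x ^ (2 * l)" using powr_realpow[OF assms(1), of "2 * l"] by simp
  then show ?thesis using assms by (simp add: pow4_powr powr_add)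
qed

lemma pow4_powr_minus:
  fixes x :: real
  assumes "x > 0" "4 * r = c - 2 * real l"
  shows "(x ^ 4) powr r = x powr c / x ^ (2 * l)"
proof -
  have "x powr (2 * real l) = x ^ (2 * l)" using powr_realpow[OF assms(1), of "2 * l"] by simp
  then show ?thesis using assms by (simp add: pow4_powr powr_diff)
qed

text \<open>Substituting fourth powers for \<open>\<omega>\<^sub>4\<close>, \<open>\<alpha>\<close> and \<open>k\<close> turns all terms of the theorem into
  monomials.  The number \<open>y\<close> is the normalised length \<open>\<alpha> / \<rho>\<close> of the interval; it is small because \<open>\<Omega>\<close> has
  at least the moment of inertia of the ball of the same volume.\<close>

lemma scaled_eigenvalue_bound:
  fixes l k :: nat and S :: "(real^4) set" and ev :: "nat \<Rightarrow> real"
  assumes S: "open S" "S \<noteq> {}" "bounded S" and ev: "dirichlet_eigenvalues l S ev" and k: "k \<ge> 1"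
  obtains a b \<kappa> y t :: real where "a > 0" "b > 0" "\<kappa> > 0" "y > 0" "y ^ 4 * k \<le> 9 / 4096"
    "omega4 = b ^ 4" "alpha S = a ^ 4" "real k = (a * b * \<kappa>) ^ 4" "vol S = (2 * pi * a) ^ 4"
    "inertia S = (2 * pi * a) ^ 4 / (4 * \<kappa>\<^sup>2 * y\<^sup>2)" "rho S = a ^ 4 / (\<kappa> * y)"
    "normalised_interval t y"
    "2 / (real l + 2) * (a ^ 4 * b ^ 4 * \<kappa> ^ 4 * \<kappa> ^ (2 * l)) * unif_moment t y (2 * (l + 2)) \<le> (\<Sum>i=1..k. ev i)"
proof -
  define V I where "V = vol S" and "I = inertia S"
  have V: "V > 0"
  proof -
    have "S \<in> lmeasurable" using S by (simp add: lmeasurable_open)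
    moreover have "\<not> negligible S" using S by (meson open_not_negligible)
    ultimately show ?thesis
      using measure_nonneg[of lebesgue S] by (auto simp: V_def vol_def negligible_iff_measure less_le)
  qed
  have om: "omega4 > 0" by (simp add: omega4_eq)
  define a where "a = (V / (2 * pi) ^ 4) powr (1/4)"
  define b where "b = omega4 powr (1/4)"
  have ab: "a > 0" "b > 0" using V om by (simp_all add: a_def b_def)
  have root4: "(x powr (1/4)) ^ 4 = x" if "x > 0" for x :: real
    using that by (simp add: powr_power)
  have a4: "a ^ 4 = V / (2 * pi) ^ 4" using V unfolding a_def by (intro root4) simp
  have b4: "b ^ 4 = omega4" using om unfolding b_def by (intro root4)
  \<comment> \<open>The radius in Weyl's law: the ball of radius \<kappa> with density
    \<open>alpha S\<close> has mass \<open>k\<close>.\<close>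
  define \<kappa> where "\<kappa> = (k / (omega4 * a ^ 4)) powr (1/4)"
  have \<kappa>: "\<kappa> > 0" using k om ab by (simp add: \<kappa>_def)
  have \<kappa>4: "\<kappa> ^ 4 = k / (omega4 * a ^ 4)" using k om ab unfolding \<kappa>_def by (intro root4) simp
  have V4: "V = (2 * pi * a) ^ 4" unfolding power_mult_distrib a4 by simp
  \<comment> \<open>The radius of the ball with the same volume as \<open>S\<close>.\<close>
  define R where "R = (V / omega4) powr (1/4)"
  have R: "R > 0" using V om by (simp add: R_def)
  have R4: "R ^ 4 = V / omega4" using V om unfolding R_def by (intro root4) simp
  have I_ge: "2/3 * V * R\<^sup>2 \<le> I"
  proof -
    have "V = omega4 * R ^ 4" using R4 om by simp
    then have "measure lebesgue S = unit_ball_vol CARD(4) * R ^ CARD(4)"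
      by (simp add: V_def vol_def omega4_def)
    from inertia_ge_ball[OF S(1,3) _ this] R show ?thesis
      by (simp add: V_def I_def vol_def inertia_def)
  qed
  have "2/3 * V * R\<^sup>2 > 0" by (intro mult_pos_pos zero_less_power V R) simp
  then have I: "I > 0" using I_ge by (rule less_le_trans)
  define m where "m = alpha S / rho S"
  have al: "alpha S = a ^ 4" unfolding alpha_def a4 V_def ..
  have rho: "rho S = 2 / (2 * pi) ^ 4 * sqrt (V * I)" by (simp add: rho_def V_def I_def)
  have rho0: "rho S > 0" using V I by (simp add: rho)
  have m: "m > 0" using rho0 ab by (simp add: m_def al)
  have "m = V / (2 * sqrt (V * I))" unfolding m_def al rho a4 by simp
  then have m2: "m\<^sup>2 = V / (4 * I)"
    using V I by (simp add: power_divide power_mult_distrib) (simp add: power2_eq_square)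
  define y where "y = m / \<kappa>"
  have y: "y > 0" using m \<kappa> by (simp add: y_def)
  have m_eq: "m = \<kappa> * y" using \<kappa> by (simp add: y_def)
  \<comment> \<open>The comparison of inertias gives
    \<open>m\<^sup>2 * R\<^sup>2 \<le> 3 / 8\<close>. In the fourth power the geometric quantities
    cancel up to \<open>omega4\<^sup>2 / (2 * pi) ^ 4 = 1 / 64\<close>, so the bound is 9/64 *
    1/64.\<close>
  have y4: "y ^ 4 * k \<le> 9 / 4096"
  proof -
    have "m\<^sup>2 * R\<^sup>2 \<le> 3 / 8" using I_ge V I unfolding m2 by (simp add: field_simps)
    then have "(m\<^sup>2 * R\<^sup>2)\<^sup>2 \<le> (3 / 8)\<^sup>2" by (intro power_mono) auto
    then have mR: "m ^ 4 * R ^ 4 \<le> 9 / 64"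
      by (simp add: power_mult_distrib power2_eq_square power4_eq_xxxx mult_ac)
    have "y ^ 4 * k = m ^ 4 * (omega4 * a ^ 4)"
      unfolding y_def power_divide \<kappa>4 using k by simp
    also have "\<dots> = m ^ 4 * R ^ 4 * (omega4\<^sup>2 / (2 * pi) ^ 4)"
      unfolding R4 a4 using om by (simp add: power2_eq_square)
    also have "omega4\<^sup>2 / (2 * pi) ^ 4 = 1 / 64"
      unfolding omega4_eq by (simp add: power_divide power_mult_distrib flip: power_mult)
    also have "m ^ 4 * R ^ 4 * (1 / 64) \<le> 9 / 64 * (1 / 64)" by (intro mult_right_mono mR) simp
    finally show ?thesis by simp
  qed
  have "y ^ 4 \<le> y ^ 4 * k" using k y by simp
  then have "y ^ 4 \<le> (1/4) ^ 4" using y4 by (simp add: power4_eq_xxxx)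
  then have y14: "y \<le> 1/4" using y by (subst (asm) power_mono_iff) auto
  obtain t where t: "t \<ge> 0" and mom: "normalised_interval t y"
    using exists_normalised_interval[OF y y14] by blast
  have mom4: "unif_moment t y 4 = 1" using mom by (simp add: normalised_interval_def)
  have k4: "real k = (a * b * \<kappa>) ^ 4"
    unfolding power_mult_distrib b4 \<kappa>4 using ab om by simp
  have c4: "CARD(4) = 4" by simp
  have al': "measure lebesgue S / (2 * pi) ^ 4 = alpha S" by (simp add: alpha_def vol_def)
  have rho': "2 / (2 * pi) ^ 4 * sqrt (measure lebesgue S * integral\<^sup>L (lebesgue_on S) (\<lambda>x. (norm x)\<^sup>2)) = rho S"
    by (simp only: rho_def vol_def inertia_def)
  have mk: "alpha S / rho S = \<kappa> * y" using m_eq by (simp only: m_def)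
  \<comment> \<open>Rescaling by \<kappa> turns the interval with left end
    \<open>\<kappa> * t\<close> into the normalised one. For \<open>q = 4\<close> the right side is
    \<open>k\<close>, so the profile has exactly the mass of the spectral density.\<close>
  have scale: "omega4 * alpha S * unif_moment (\<kappa> * t) (alpha S / rho S) q =
      a ^ 4 * b ^ 4 * (\<kappa> ^ q * unif_moment t y q)" for q
    unfolding mk unfolding al b4 using \<kappa> by (simp add: unif_moment_scale)
  have B: "4 / real (4 + 2 * l) * (omega4 * alpha S * unif_moment (\<kappa> * t) (alpha S / rho S) (4 + 2 * l)) \<le> (\<Sum>i=1..k. ev i)"
  proof (rule eigenvalue_sum_ge_moment[OF S(1,3) ev, where t = "\<kappa> * t" and k = k,
        unfolded c4 of_nat_numeral al' rho' omega4_def[symmetric]])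
    show "measure lebesgue S > 0" "integral\<^sup>L (lebesgue_on S) (\<lambda>x. (norm x)\<^sup>2) > 0"
      using V I by (simp_all add: V_def I_def vol_def inertia_def)
    show "0 \<le> \<kappa> * t" using \<kappa> t by simp
    show "omega4 * alpha S * unif_moment (\<kappa> * t) (alpha S / rho S) 4 \<le> k"
      unfolding scale mom4 k4 by (simp add: power_mult_distrib)
  qed
  have main: "2 / (real l + 2) * (a ^ 4 * b ^ 4 * \<kappa> ^ 4 * \<kappa> ^ (2 * l)) * unif_moment t y (2 * (l + 2)) \<le> (\<Sum>i=1..k. ev i)"
  proof -
    have 1: "4 + 2 * l = 2 * (l + 2)" by simp
    have 2: "\<kappa> ^ (2 * (l + 2)) = \<kappa> ^ 4 * \<kappa> ^ (2 * l)" by (simp only: 1[symmetric] power_add)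
    have 3: "4 / real (2 * (l + 2)) = 2 / (real l + 2)" by (simp add: field_simps)
    show ?thesis using B unfolding scale 1 2 3 by (simp only: mult.assoc)
  qed
  show thesis
  proof (rule that[OF ab \<kappa> y y4 b4[symmetric] al k4 _ _ _ mom main])
    show "vol S = (2 * pi * a) ^ 4" using V4 by (simp add: V_def)
    show "rho S = a ^ 4 / (\<kappa> * y)" using rho0 ab unfolding m_eq[symmetric] m_def al by simp
    have VI: "4 * \<kappa>\<^sup>2 * y\<^sup>2 = V / I" using m2 I by (simp add: m_eq power_mult_distrib)
    have "I = V / (V / I)" using V I by simp
    then show "inertia S = (2 * pi * a) ^ 4 / (4 * \<kappa>\<^sup>2 * y\<^sup>2)"
      unfolding V4[symmetric] VI by (simp only: I_def)
  qed
qed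

text \<open>The entry of the maximum with a = 2 * l + 4 and i = 1: there the quotient of binomial
  coefficients is (a - 1) / 4.\<close>

lemma k2_ge: "1 / 455 * ((2 * real l + 3) / 4) ^ 4 \<le> k2 l"
proof -
  let ?S = "{(real (a choose (i + 1)) / (2 * real (a choose i))) ^ 4 | a i.
     a \<in> {2 * l + 4, 2 * l + 3, 2 * l + 2} \<and> i \<in> {1..2 * l + 3} \<and> a choose i \<noteq> 0}"
  have "finite ({2 * l + 4, 2 * l + 3, 2 * l + 2} \<times> {1..2 * l + 3})" by simp
  then have "finite ((\<lambda>(a, i). (real (a choose (i + 1)) / (2 * real (a choose i))) ^ 4) `
      ({2 * l + 4, 2 * l + 3, 2 * l + 2} \<times> {1..2 * l + 3}))" by (rule finite_imageI)
  then have fin: "finite ?S" by (rule rev_finite_subset) (auto simp: image_iff split_beta intro!: bexI)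
  have "real ((2 * l + 4) choose 2) = real (2 * l + 4) * (2 * real l + 3) / 2"
    unfolding choose_two by (subst real_of_nat_div) auto
  then have "real ((2 * l + 4) choose (1 + 1)) / (2 * real ((2 * l + 4) choose 1)) =
      (real (2 * l + 4) * (2 * real l + 3) / 2) / (2 * real (2 * l + 4))"
    by (simp only: one_add_one choose_one)
  also have "\<dots> = (2 * real l + 3) / 4"
  proof -
    have *: "N * X / 2 / (2 * N) = X / 4" if "N > 0" for N X :: real using that by simp
    show ?thesis by (rule *) simp
  qed
  finally have c: "real ((2 * l + 4) choose (1 + 1)) / (2 * real ((2 * l + 4) choose 1)) = (2 * real l + 3) / 4" .
  have "(real ((2 * l + 4) choose (1 + 1)) / (2 * real ((2 * l + 4) choose 1))) ^ 4 \<in> ?S"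
    by (rule CollectI, rule exI[of _ "2 * l + 4"], rule exI[of _ 1]) auto
  then have "((2 * real l + 3) / 4) ^ 4 \<in> ?S" by (simp only: c)
  then have "((2 * real l + 3) / 4) ^ 4 \<le> Max ?S" by (rule Max_ge[OF fin])
  then show ?thesis by (simp add: k2_def)
qed

text \<open>For \<open>k = 1\<close> the hypothesis allows \<open>y\<close> up to the fourth root of
  9/4096, about 0.2165; 22/100 rounds this up.\<close>

lemma side_length_le:
  fixes y :: real
  assumes "y ^ 4 * real k \<le> 9 / 4096" "k \<ge> 1" "y > 0"
  shows "y \<le> 22/100"
proof -
  have "y ^ 4 * 1 \<le> y ^ 4 * real k" using assms by (intro mult_left_mono) auto
  then have "y ^ 4 \<le> (22/100) ^ 4" using assms(1) by (simp add: power4_eq_xxxx)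
  then show ?thesis using assms(3) by (subst (asm) power_mono_iff) auto
qed

theorem theorem3p3:
  fixes l :: nat and \<Omega> :: "(real^4) set" and ev :: "nat \<Rightarrow> real"
  assumes "l \<ge> 1"
    and "open \<Omega>" and "connected \<Omega>" and "\<Omega> \<noteq> {}" and "bounded \<Omega>"
    and "dirichlet_eigenvalues l \<Omega> ev"
  shows
   "(l = 1 \<longrightarrow> (\<forall>k::nat. k \<ge> 1 \<longrightarrow>
      (\<Sum>i=1..k. ev i) \<ge>
        2 / (3 * omega4 powr (1/2)) * ((2 * pi) ^ 4 / vol \<Omega>) powr (1/2) * real k powr (3/2)
        + 1/12 * (vol \<Omega> / inertia \<Omega>) * real k
        - 7 * omega4 powr (1/2) / (960 * (2 * pi) ^ 2)
            * (vol \<Omega> powr (5/2) / inertia \<Omega> ^ 2) * real k powr (1/2)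
        + 47 * omega4 / (114688 * (2 * pi) ^ 4) * (vol \<Omega> ^ 4 / inertia \<Omega> ^ 3)
        + omega4 powr (5/4) / (150 * rho \<Omega> ^ 7)
            * (vol \<Omega> / (2 * pi) ^ 4) powr (33/4) * real k powr (-1/4)
        - 449/122880 * (omega4 powr (3/2) / rho \<Omega> ^ 8)
            * (vol \<Omega> / (2 * pi) ^ 4) powr (19/2) * real k powr (-1/2)))
    \<and>
    (l = 2 \<longrightarrow> (\<forall>k::nat. k \<ge> 1 \<longrightarrow>
      (\<Sum>i=1..k. ev i) \<ge>
        1 / (2 * omega4) * ((2 * pi) ^ 4 / vol \<Omega>) * real k ^ 2
        + pi ^ 2 / (12 * omega4 powr (1/2)) * (vol \<Omega> powr (1/2) / inertia \<Omega>) * real k powr (3/2)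
        - 1/80 * (vol \<Omega> ^ 2 / inertia \<Omega> ^ 2) * real k
        + 61 * omega4 powr (1/2) / (1280 * rho \<Omega> ^ 6)
            * (vol \<Omega> / (2 * pi) ^ 4) powr (13/2) * real k powr (1/2)
        + omega4 powr (3/4) / (150 * rho \<Omega> ^ 7)
            * (vol \<Omega> / (2 * pi) ^ 4) powr (31/4) * real k powr (1/4)
        - 17423 * omega4 / (1843200 * rho \<Omega> ^ 8) * (vol \<Omega> / (2 * pi) ^ 4) ^ 9
        + 7 * omega4 powr (5/4) / (1200 * rho \<Omega> ^ 9)
            * (vol \<Omega> / (2 * pi) ^ 4) powr (41/4) * real k powr (-1/4)))
    \<and>
    (l \<ge> 3 \<longrightarrow> (\<forall>k::nat. k \<ge> 1 \<longrightarrow> real k \<ge> max (k1 l) (k2 l) \<longrightarrow>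
      (\<Sum>i=1..k. ev i) \<ge>
        2 / ((real l + 2) * omega4 powr (real l / 2))
            * alpha \<Omega> powr (- real l / 2) * real k powr ((real l + 2) / 2)
        + (2 * pi) ^ 8 * real l / (12 * omega4 powr ((real l - 1) / 2) * vol \<Omega> * inertia \<Omega>)
            * alpha \<Omega> powr ((5 - real l) / 2) * real k powr ((real l + 1) / 2)
        - 128 * (4 * real l + 7) * (2 * real l + 1) * pi ^ 12
              / (3 * omega4 powr ((2 * real l - 3) / 4) * (vol \<Omega> * inertia \<Omega>) powr (3/2))
            * alpha \<Omega> powr ((15 - 2 * real l) / 4) * real k powr ((2 * real l + 1) / 4)
        + (2 * real l + 3) * (2 * real l - 1) * (real l + 1)
              / (12 * omega4 powr ((real l - 2) / 2) * rho \<Omega> ^ 4)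
            * alpha \<Omega> powr ((10 - real l) / 2) * real k powr (real l / 2)
        - (2 * real l + 3) * (2 * real l + 1) * (real l + 1) * real l
              / (18 * omega4 powr ((2 * real l - 5) / 4) * rho \<Omega> ^ 5)
            * alpha \<Omega> powr ((25 - 2 * real l) / 4) * real k powr ((2 * real l - 1) / 4)))"
proof (intro conjI impI allI, goal_cases)
  case (1 k)
  note l = 1(1) and k = 1(2)
  obtain a b \<kappa> y t :: real where pos: "a > 0" "b > 0" "\<kappa> > 0" "y > 0" and y4: "y ^ 4 * k \<le> 9 / 4096"
    and om: "omega4 = b ^ 4" and "alpha \<Omega> = a ^ 4" and kk: "real k = (a * b * \<kappa>) ^ 4" and V: "vol \<Omega> = (2 * pi * a) ^ 4"
    and I: "inertia \<Omega> = (2 * pi * a) ^ 4 / (4 * \<kappa>\<^sup>2 * y\<^sup>2)" and rho: "rho \<Omega> = a ^ 4 / (\<kappa> * y)"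
    and mom: "normalised_interval t y"
    and bound: "2 / (real l + 2) * (a ^ 4 * b ^ 4 * \<kappa> ^ 4 * \<kappa> ^ (2 * l)) * unif_moment t y (2 * (l + 2)) \<le> (\<Sum>i=1..k. ev i)"
    by (rule scaled_eigenvalue_bound[OF assms(2,4,5,6) k])
  note nz = pos[THEN less_imp_neq, symmetric]
  have al: "vol \<Omega> / (2 * pi) ^ 4 = a ^ 4" "(2 * pi) ^ 4 / vol \<Omega> = (1 / a) ^ 4"
    unfolding V using pos by (simp_all add: power_mult_distrib power_divide)
  have y: "y \<le> 22/100" using y4 k pos(4) by (rule side_length_le)
  \<comment> \<open>The leading term is \<open>2/3 * U\<close>. Below, every term of the claim is
    written as this factor times a monomial in \<open>y\<close>.\<close>
  define U where "U = a ^ 4 * b ^ 4 * \<kappa> ^ 6"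
  have p: "omega4 powr (1/2) = b ^ 2" "omega4 powr (5/4) = b ^ 5" "omega4 powr (3/2) = b ^ 6"
    "((2 * pi) ^ 4 / vol \<Omega>) powr (1/2) = (1 / a) ^ 2" "real k powr (3/2) = (a * b * \<kappa>) ^ 6"
    "real k powr (1/2) = (a * b * \<kappa>) ^ 2" "vol \<Omega> powr (5/2) = (2 * pi * a) ^ 10"
    "(vol \<Omega> / (2 * pi) ^ 4) powr (33/4) = a ^ 33" "(vol \<Omega> / (2 * pi) ^ 4) powr (19/2) = a ^ 38"
    unfolding al unfolding om kk V using pos by (intro pow4_powr_numeral; simp)+
  have p': "real k powr (-1/4) = 1 / (a * b * \<kappa>)" "real k powr (-1/2) = 1 / (a * b * \<kappa>) ^ 2"
    unfolding kk using pos by (simp_all add: pow4_powr powr_neg_one powr_neg_numeral)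
  have r: "2 / (3 * omega4 powr (1/2)) * ((2 * pi) ^ 4 / vol \<Omega>) powr (1/2) * real k powr (3/2) = 2/3 * U"
      "1/12 * (vol \<Omega> / inertia \<Omega>) * real k = 2/3 * U * (y\<^sup>2 / 2)"
      "7 * omega4 powr (1/2) / (960 * (2 * pi) ^ 2) * (vol \<Omega> powr (5/2) / inertia \<Omega> ^ 2) * real k powr (1/2) = 2/3 * U * (7/40 * y ^ 4)"
      "47 * omega4 / (114688 * (2 * pi) ^ 4) * (vol \<Omega> ^ 4 / inertia \<Omega> ^ 3) = 2/3 * U * (47 * 96 / 114688 * y ^ 6)"
      "omega4 powr (5/4) / (150 * rho \<Omega> ^ 7) * (vol \<Omega> / (2 * pi) ^ 4) powr (33/4) * real k powr (-1/4) = 2/3 * U * (y ^ 7 / 100)"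
      "449/122880 * (omega4 powr (3/2) / rho \<Omega> ^ 8) * (vol \<Omega> / (2 * pi) ^ 4) powr (19/2) * real k powr (-1/2) = 2/3 * U * (449 * 3 / 245760 * y ^ 8)"
    unfolding p p' unfolding om kk V I rho U_def using nz
    by (simp_all add: divide_simps power_mult_distrib) (simp_all add: eval_nat_numeral)
  have "2/3 * U * (1 + y\<^sup>2 / 2 - 7/40 * y ^ 4 + 47 * 96 / 114688 * y ^ 6 + y ^ 7 / 100 - 449 * 3 / 245760 * y ^ 8) \<le> 2/3 * U * unif_moment t y 6"
    using pos y by (intro mult_left_mono normalised_bound_1[OF _ _ mom]) (simp_all add: U_def)
  also have "\<dots> \<le> (\<Sum>i=1..k. ev i)"
    using bound by (simp add: l U_def eval_nat_numeral mult_ac)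
  finally show ?case
    unfolding r by (simp only: distrib_left right_diff_distrib mult_1_right)
next
  case (2 k)
  note l = 2(1) and k = 2(2)
  obtain a b \<kappa> y t :: real where pos: "a > 0" "b > 0" "\<kappa> > 0" "y > 0" and y4: "y ^ 4 * k \<le> 9 / 4096"
    and om: "omega4 = b ^ 4" and "alpha \<Omega> = a ^ 4" and kk: "real k = (a * b * \<kappa>) ^ 4" and V: "vol \<Omega> = (2 * pi * a) ^ 4"
    and I: "inertia \<Omega> = (2 * pi * a) ^ 4 / (4 * \<kappa>\<^sup>2 * y\<^sup>2)" and rho: "rho \<Omega> = a ^ 4 / (\<kappa> * y)"
    and mom: "normalised_interval t y"
    and bound: "2 / (real l + 2) * (a ^ 4 * b ^ 4 * \<kappa> ^ 4 * \<kappa> ^ (2 * l)) * unif_moment t y (2 * (l + 2)) \<le> (\<Sum>i=1..k. ev i)"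
    by (rule scaled_eigenvalue_bound[OF assms(2,4,5,6) k])
  note nz = pos[THEN less_imp_neq, symmetric]
  have al: "vol \<Omega> / (2 * pi) ^ 4 = a ^ 4"
    unfolding V using pos by (simp add: power_mult_distrib power_divide)
  have y: "y \<le> 22/100" using y4 k pos(4) by (rule side_length_le)
  \<comment> \<open>For \<open>l = 2\<close> the leading term is \<open>1/2 * U\<close>, and the
    relevant moment has order 8.\<close>
  define U where "U = a ^ 4 * b ^ 4 * \<kappa> ^ 8"
  have p: "omega4 powr (1/2) = b ^ 2" "omega4 powr (3/4) = b ^ 3" "omega4 powr (5/4) = b ^ 5"
    "vol \<Omega> powr (1/2) = (2 * pi * a) ^ 2" "real k powr (3/2) = (a * b * \<kappa>) ^ 6"
    "real k powr (1/2) = (a * b * \<kappa>) ^ 2"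
    "(vol \<Omega> / (2 * pi) ^ 4) powr (13/2) = a ^ 26" "(vol \<Omega> / (2 * pi) ^ 4) powr (31/4) = a ^ 31"
    "(vol \<Omega> / (2 * pi) ^ 4) powr (41/4) = a ^ 41"
    unfolding al unfolding om kk V using pos by (intro pow4_powr_numeral; simp)+
  have p': "real k powr (-1/4) = 1 / (a * b * \<kappa>)" "real k powr (1/4) = a * b * \<kappa>"
    unfolding kk using pos by (simp_all add: pow4_powr powr_neg_one)
  have r: "1 / (2 * omega4) * ((2 * pi) ^ 4 / vol \<Omega>) * real k ^ 2 = 1/2 * U"
      "pi ^ 2 / (12 * omega4 powr (1/2)) * (vol \<Omega> powr (1/2) / inertia \<Omega>) * real k powr (3/2) = 1/2 * U * (y\<^sup>2 / 6)"
      "1/80 * (vol \<Omega> ^ 2 / inertia \<Omega> ^ 2) * real k = 1/2 * U * (2/5 * y ^ 4)"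
      "61 * omega4 powr (1/2) / (1280 * rho \<Omega> ^ 6) * (vol \<Omega> / (2 * pi) ^ 4) powr (13/2) * real k powr (1/2) = 1/2 * U * (61/640 * y ^ 6)"
      "omega4 powr (3/4) / (150 * rho \<Omega> ^ 7) * (vol \<Omega> / (2 * pi) ^ 4) powr (31/4) * real k powr (1/4) = 1/2 * U * (y ^ 7 / 75)"
      "17423 * omega4 / (1843200 * rho \<Omega> ^ 8) * (vol \<Omega> / (2 * pi) ^ 4) ^ 9 = 1/2 * U * (17423/921600 * y ^ 8)"
      "7 * omega4 powr (5/4) / (1200 * rho \<Omega> ^ 9) * (vol \<Omega> / (2 * pi) ^ 4) powr (41/4) * real k powr (-1/4) = 1/2 * U * (7/600 * y ^ 9)"
    unfolding p p' unfolding al unfolding om kk V I rho U_def using nz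
    by (simp_all add: divide_simps power_mult_distrib) (simp_all add: eval_nat_numeral)
  have "1/2 * U * (1 + y\<^sup>2 / 6 - 2/5 * y ^ 4 + 61/640 * y ^ 6 + y ^ 7 / 75 - 17423/921600 * y ^ 8 + 7/600 * y ^ 9) \<le> 1/2 * U * unif_moment t y 8"
    using pos y normalised_bound_ge2[of 4, OF _ pos(4) _ mom] by (intro mult_left_mono normalised_bound_2) (simp_all add: U_def)
  also have "\<dots> \<le> (\<Sum>i=1..k. ev i)"
    using bound by (simp add: l U_def eval_nat_numeral mult_ac)
  finally show ?case
    unfolding r by (simp only: distrib_left right_diff_distrib mult_1_right)
next
  case (3 k)
  note l = 3(1) and k = 3(2) and kk2 = 3(3)
  obtain a b \<kappa> y t :: real where pos: "a > 0" "b > 0" "\<kappa> > 0" "y > 0" and y4: "y ^ 4 * k \<le> 9 / 4096"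
    and om: "omega4 = b ^ 4" and al: "alpha \<Omega> = a ^ 4" and kk: "real k = (a * b * \<kappa>) ^ 4" and V: "vol \<Omega> = (2 * pi * a) ^ 4"
    and I: "inertia \<Omega> = (2 * pi * a) ^ 4 / (4 * \<kappa>\<^sup>2 * y\<^sup>2)" and rho: "rho \<Omega> = a ^ 4 / (\<kappa> * y)"
    and mom: "normalised_interval t y"
    and bound: "2 / (real l + 2) * (a ^ 4 * b ^ 4 * \<kappa> ^ 4 * \<kappa> ^ (2 * l)) * unif_moment t y (2 * (l + 2)) \<le> (\<Sum>i=1..k. ev i)"
    by (rule scaled_eigenvalue_bound[OF assms(2,4,5,6) k])
  note nz = pos[THEN less_imp_neq, symmetric]
  have y: "y \<le> 22/100" using y4 k pos(4) by (rule side_length_le)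
  have yl: "y * (2 * l + 3) \<le> 4"
  proof -
    \<comment> \<open>The constant 455 fits the bound 9/4096: 9 * 455 = 4095, so the product stays
      just below 1.\<close>
    have "y ^ 4 * (1 / 455 * ((2 * real l + 3) / 4) ^ 4) \<le> y ^ 4 * k"
      using k2_ge[of l] kk2 by (intro mult_left_mono) auto
    then have "y ^ 4 * ((2 * real l + 3) / 4) ^ 4 \<le> 1" using y4 by linarith
    then have "(y * ((2 * real l + 3) / 4)) ^ 4 \<le> 1 ^ 4" by (simp only: power_mult_distrib power_one)
    then have "y * ((2 * real l + 3) / 4) \<le> 1" using pos by (subst (asm) power_mono_iff) auto
    then show ?thesis by simp
  qed
  define U where "U = a ^ 4 * b ^ 4 * \<kappa> ^ 4 * \<kappa> ^ (2 * l)"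
  \<comment> \<open>\<open>A\<close>, \<open>B\<close> and \<open>C\<close> collect the powers with
    exponent \<open>2 * l\<close>. They cancel in the identities \<open>r\<close>, which then
    involve only fixed powers of \<open>a\<close>, \<open>b\<close>, \<kappa> and
    \<open>y\<close>.\<close>
  define A where "A = a ^ (2 * l)"
  define B where "B = b ^ (2 * l)"
  define C where "C = \<kappa> ^ (2 * l)"
  have ABC: "A > 0" "B > 0" "C > 0" using pos by (simp_all add: A_def B_def C_def)
  note nz' = ABC[THEN less_imp_neq, symmetric]
  have "a * b * \<kappa> > 0" using pos by simp
  have kp: "(a * b * \<kappa>) ^ (2 * l) = A * B * C"
    by (simp add: A_def B_def C_def power_mult_distrib)
  have po: "omega4 powr (real l / 2) = B" "omega4 powr ((real l - 1) / 2) = B / b ^ 2"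
    "omega4 powr ((2 * real l - 3) / 4) = B / b ^ 3" "omega4 powr ((real l - 2) / 2) = B / b ^ 4"
    "omega4 powr ((2 * real l - 5) / 4) = B / b ^ 5"
    unfolding om B_def
    using pow4_powr_plus[OF pos(2), of "real l / 2" l 0] pow4_powr_plus[OF pos(2), of "(real l - 1) / 2" l "-2"]
      pow4_powr_plus[OF pos(2), of "(2 * real l - 3) / 4" l "-3"] pow4_powr_plus[OF pos(2), of "(real l - 2) / 2" l "-4"]
      pow4_powr_plus[OF pos(2), of "(2 * real l - 5) / 4" l "-5"] pos
    by (simp_all add: powr_neg_numeral)
  have pa: "alpha \<Omega> powr (- real l / 2) = 1 / A" "alpha \<Omega> powr ((5 - real l) / 2) = a ^ 10 / A"
    "alpha \<Omega> powr ((15 - 2 * real l) / 4) = a ^ 15 / A" "alpha \<Omega> powr ((10 - real l) / 2) = a ^ 20 / A"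
    "alpha \<Omega> powr ((25 - 2 * real l) / 4) = a ^ 25 / A"
    unfolding al A_def
    using pow4_powr_minus[OF pos(1), of "- real l / 2" 0 l] pow4_powr_minus[OF pos(1), of "(5 - real l) / 2" 10 l]
      pow4_powr_minus[OF pos(1), of "(15 - 2 * real l) / 4" 15 l] pow4_powr_minus[OF pos(1), of "(10 - real l) / 2" 20 l]
      pow4_powr_minus[OF pos(1), of "(25 - 2 * real l) / 4" 25 l] pos
    by simp_all
  have pk: "real k powr ((real l + 2) / 2) = A * B * C * (a * b * \<kappa>) ^ 4" "real k powr ((real l + 1) / 2) = A * B * C * (a * b * \<kappa>) ^ 2"
    "real k powr ((2 * real l + 1) / 4) = A * B * C * (a * b * \<kappa>)" "real k powr (real l / 2) = A * B * C"
    "real k powr ((2 * real l - 1) / 4) = A * B * C / (a * b * \<kappa>)"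
    unfolding kk kp[symmetric]
    using pow4_powr_plus[OF \<open>a * b * \<kappa> > 0\<close>, of "(real l + 2) / 2" l 4] pow4_powr_plus[OF \<open>a * b * \<kappa> > 0\<close>, of "(real l + 1) / 2" l 2]
      pow4_powr_plus[OF \<open>a * b * \<kappa> > 0\<close>, of "(2 * real l + 1) / 4" l 1] pow4_powr_plus[OF \<open>a * b * \<kappa> > 0\<close>, of "real l / 2" l 0]
      pow4_powr_plus[OF \<open>a * b * \<kappa> > 0\<close>, of "(2 * real l - 1) / 4" l "-1"] \<open>a * b * \<kappa> > 0\<close> nz
    by (simp_all add: powr_neg_one)
  have VI: "(vol \<Omega> * inertia \<Omega>) powr (3/2) = ((2 * pi * a) ^ 4 / (2 * \<kappa> * y)) ^ 3"
  proof -
    \<comment> \<open>The product of volume and inertia is the square of \<open>Q\<close>, so its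
      power 3/2 is rational in \<open>a\<close>, \<kappa> and \<open>y\<close>.\<close>
    define Q where "Q = (2 * pi * a) ^ 4 / (2 * \<kappa> * y)"
    have "Q > 0" using pos by (simp add: Q_def)
    moreover have "vol \<Omega> * inertia \<Omega> = Q powr 2"
      using \<open>Q > 0\<close> unfolding V I by (simp add: Q_def power_divide power_mult_distrib power2_eq_square)
    moreover have "(Q powr 2) powr (3/2) = Q ^ 3" using \<open>Q > 0\<close> unfolding powr_powr by simp
    ultimately show ?thesis by (simp only: Q_def)
  qed
  have r: "2 / ((real l + 2) * omega4 powr (real l / 2)) * alpha \<Omega> powr (- real l / 2) * real k powr ((real l + 2) / 2)
        = U * (2 / (real l + 2))"
      "(2 * pi) ^ 8 * real l / (12 * omega4 powr ((real l - 1) / 2) * vol \<Omega> * inertia \<Omega>)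
            * alpha \<Omega> powr ((5 - real l) / 2) * real k powr ((real l + 1) / 2) = U * (real l / 3 * y\<^sup>2)"
      "128 * (4 * real l + 7) * (2 * real l + 1) * pi ^ 12
              / (3 * omega4 powr ((2 * real l - 3) / 4) * (vol \<Omega> * inertia \<Omega>) powr (3/2))
            * alpha \<Omega> powr ((15 - 2 * real l) / 4) * real k powr ((2 * real l + 1) / 4)
        = U * ((4 * real l + 7) * (2 * real l + 1) / 12 * y ^ 3)"
      "(2 * real l + 3) * (2 * real l - 1) * (real l + 1)
              / (12 * omega4 powr ((real l - 2) / 2) * rho \<Omega> ^ 4)
            * alpha \<Omega> powr ((10 - real l) / 2) * real k powr (real l / 2)
        = U * ((2 * real l + 3) * (2 * real l - 1) * (real l + 1) / 12 * y ^ 4)"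
      "(2 * real l + 3) * (2 * real l + 1) * (real l + 1) * real l
              / (18 * omega4 powr ((2 * real l - 5) / 4) * rho \<Omega> ^ 5)
            * alpha \<Omega> powr ((25 - 2 * real l) / 4) * real k powr ((2 * real l - 1) / 4)
        = U * ((2 * real l + 3) * (2 * real l + 1) * (real l + 1) * real l / 18 * y ^ 5)"
    unfolding po pa pk VI unfolding V I rho U_def C_def[symmetric] using nz nz'
    by (simp_all add: power_mult_distrib power_divide) (simp_all add: eval_nat_numeral mult_ac)
  have "U * (2 / (real l + 2) + real l / 3 * y\<^sup>2 - (4 * real l + 7) * (2 * real l + 1) / 12 * y ^ 3
      + (2 * real l + 3) * (2 * real l - 1) * (real l + 1) / 12 * y ^ 4
      - (2 * real l + 3) * (2 * real l + 1) * (real l + 1) * real l / 18 * y ^ 5) \<le> U * (2 / (real l + 2) * unif_moment t y (2 * (l + 2)))"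
  proof (intro mult_left_mono normalised_bound_ge3)
    show "1 + (real l + 2) * real l * (y\<^sup>2 / 6 - y ^ 4 / 40) - (real l + 2) * (real l + 1) * real l / 30 * y ^ 4 \<le> unif_moment t y (2 * (l + 2))"
      using normalised_bound_ge2[of "l + 2", OF _ pos(4) _ mom] y l by (simp add: algebra_simps)
  qed (use pos yl l in \<open>simp_all add: U_def\<close>)
  also have "\<dots> \<le> (\<Sum>i=1..k. ev i)"
    using bound by (simp add: U_def mult_ac)
  finally show ?case
    unfolding r by (simp only: distrib_left right_diff_distrib)
qed

end
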